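(* The following two statements are equivalent. (A) For every smooth periodic set of data $(u_0,f,T)$ there exists a smooth periodic solution $(u,p,u_0,f,T)$ to the Navier-Stokes system with this data. (B) For every smooth homogeneous periodic set of data $(u_0,0,T)$ there exists a smooth periodic solution $(u,p,u_0,0,T)$ to the Navier-Stokes system with this data.
   Context: A smooth periodic set of data $(u_0,f,T)$, with period $L>0$, consists of a time $0<T<\infty$, a smooth divergence-free vector field $u_0:\mathbf{R}^3\to\mathbf{R}^3$ and a smooth vector field $f:[0,T]\times\mathbf{R}^3\to\mathbf{R}^3$ with $u_0(x+Lk)=u_0(x)$ and $f(t,x+Lk)=f(t,x)$ for all $t\in[0,T]$, $x\in\mathbf{R}^3$, $k\in\mathbf{Z}^3$. It is homogeneous if $f=0$. A smooth periodic solution $(u,p,u_0,f,T)$ with period $L$ consists of such data together with smooth functions $u:[0,T]\times\mathbf{R}^3\to\mathbf{R}^3$ and $p:[0,T]\times\mathbf{R}^3\to\mathbf{R}$ satisfying $\partial_tu+(u\cdot\nabla)u=\Delta u-\nabla p+f$ and $\nabla\cdot u=0$ on $[0,T]\times\mathbf{R}^3$, $u(0,\cdot)=u_0$, and $u(t,x+Lk)=u(t,x)$ for all $t\in[0,T]$, $x\in\mathbf{R}^3$, $k\in\mathbf{Z}^3$. The pressure $p$ is NOT required to be periodic. *)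

theory Defs
  imports "HOL-Analysis.Analysis"
begin

(* C^k regularity of f on S, with derivatives taken relative to S, so that at boundary points
   they are one-sided. For the sets used below (the whole space and the slab [0,T] x R^3 with
   T > 0) derivatives relative to S are unique, so that frechet_derivative is the derivative. *)
fun Ck_on :: "nat \<Rightarrow> ('a::real_normed_vector \<Rightarrow> 'b::real_normed_vector) \<Rightarrow> 'a set \<Rightarrow> bool" where
  "Ck_on 0 f S \<longleftrightarrow> continuous_on S f"
| "Ck_on (Suc k) f S \<longleftrightarrow>
     f differentiable_on S \<and> (\<forall>v. Ck_on k (\<lambda>x. frechet_derivative f (at x within S) v) S)"

definition smooth_on :: "('a::real_normed_vector \<Rightarrow> 'b::real_normed_vector) \<Rightarrow> 'a set \<Rightarrow> bool" where
  "smooth_on f S \<longleftrightarrow> (\<forall>k. Ck_on k f S)"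

(* Joint smoothness in (t,x) on the closed slab [0,T] x R^3, up to and including t = 0 and t = T. *)
definition spacetime_smooth :: "real \<Rightarrow> (real \<Rightarrow> real^3 \<Rightarrow> 'b::real_normed_vector) \<Rightarrow> bool" where
  "spacetime_smooth T g \<longleftrightarrow> smooth_on (\<lambda>(t, x). g t x) ({0..T} \<times> UNIV)"

definition partial_deriv :: "3 \<Rightarrow> (real^3 \<Rightarrow> 'b::real_normed_vector) \<Rightarrow> real^3 \<Rightarrow> 'b" where
  "partial_deriv i g x = frechet_derivative g (at x) (axis i 1)"

definition time_deriv :: "real \<Rightarrow> (real \<Rightarrow> real^3 \<Rightarrow> 'b::real_normed_vector) \<Rightarrow> real \<Rightarrow> real^3 \<Rightarrow> 'b" where
  "time_deriv T g t x = vector_derivative (\<lambda>s. g s x) (at t within {0..T})"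

definition grad :: "(real^3 \<Rightarrow> real) \<Rightarrow> real^3 \<Rightarrow> real^3" where
  "grad q x = (\<chi> i. partial_deriv i q x)"

definition divergence :: "(real^3 \<Rightarrow> real^3) \<Rightarrow> real^3 \<Rightarrow> real" where
  "divergence v x = (\<Sum>i\<in>UNIV. partial_deriv i v x $ i)"

definition laplacian :: "(real^3 \<Rightarrow> real^3) \<Rightarrow> real^3 \<Rightarrow> real^3" where
  "laplacian v x = (\<Sum>i\<in>UNIV. partial_deriv i (partial_deriv i v) x)"

(* (v . nabla) w *)
definition advection :: "(real^3 \<Rightarrow> real^3) \<Rightarrow> (real^3 \<Rightarrow> real^3) \<Rightarrow> real^3 \<Rightarrow> real^3" where
  "advection v w x = (\<Sum>i\<in>UNIV. v x $ i *\<^sub>R partial_deriv i w x)"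

definition lattice_periodic :: "real \<Rightarrow> (real^3 \<Rightarrow> 'b) \<Rightarrow> bool" where
  "lattice_periodic L g \<longleftrightarrow> (\<forall>x. \<forall>k::int^3. g (x + L *\<^sub>R (\<chi> i. of_int (k $ i))) = g x)"

(* Functions of time are total in HOL; only their values on [0,T] are constrained, and only
   these values enter any of the conditions below. *)
definition smooth_periodic_data ::
  "real \<Rightarrow> (real^3 \<Rightarrow> real^3) \<Rightarrow> (real \<Rightarrow> real^3 \<Rightarrow> real^3) \<Rightarrow> real \<Rightarrow> bool" where
  "smooth_periodic_data L u0 f T \<longleftrightarrow>
     0 < L \<and> 0 < T \<and>
     smooth_on u0 UNIV \<and> (\<forall>x. divergence u0 x = 0) \<and>
     spacetime_smooth T f \<and>
     lattice_periodic L u0 \<and> (\<forall>t\<in>{0..T}. lattice_periodic L (f t))"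

(* Periodicity is imposed on the velocity u only, not on the pressure p. *)
definition smooth_periodic_solution ::
  "real \<Rightarrow> (real \<Rightarrow> real^3 \<Rightarrow> real^3) \<Rightarrow> (real \<Rightarrow> real^3 \<Rightarrow> real) \<Rightarrow>
   (real^3 \<Rightarrow> real^3) \<Rightarrow> (real \<Rightarrow> real^3 \<Rightarrow> real^3) \<Rightarrow> real \<Rightarrow> bool" where
  "smooth_periodic_solution L u p u0 f T \<longleftrightarrow>
     smooth_periodic_data L u0 f T \<and>
     spacetime_smooth T u \<and> spacetime_smooth T p \<and>
     (\<forall>t\<in>{0..T}. \<forall>x.
        time_deriv T u t x + advection (u t) (u t) x = laplacian (u t) x - grad (p t) x + f t x) \<and>
     (\<forall>t\<in>{0..T}. \<forall>x. divergence (u t) x = 0) \<and>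
     (\<forall>x. u 0 x = u0 x) \<and>
     (\<forall>t\<in>{0..T}. lattice_periodic L (u t))"

end

theory Submission
  imports Defs
begin

text \<open>Let v solve the homogeneous system. In a frame moving along X(t) = kappa t^2 omega, with omega not
  orthogonal to any nonzero lattice frequency, the force becomes f(t, y + X(t)); every nonzero Fourier mode of
  it oscillates rapidly in time when kappa is large, so the response of the heat flow to it is uniformly
  small. A contraction argument for the Fourier coefficients then gives a smooth solution v + w of the
  system in the moving frame, on all of [0,T]. Moving back costs the inertial force and the mean of f, which
  are constant in space and are absorbed by a pressure that is linear in x.\<close>

subsection \<open>Functions of class C^k\<close>

text \<open>The force is not small, while a flow near v can be controlled only as long as the
  perturbation w stays small, so the smallness cannot come from the size of f. The threshold
  \<open>\<epsilon>\<close> of \<open>perturbed_solution\<close> depends on v, L and T but not on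
  the force. Hence kappa may be chosen after it, and it is the response of the heat flow to the
  force, not the force itself, that has to lie below \<open>\<epsilon>\<close>. The mean of f is the
  one mode that a moving frame cannot make oscillate, which is why it is split off. The path is
  quadratic because X(0) = 0 and X'(0) = 0 leave the initial velocity unchanged, while its speed
  vanishes at t = 0 only, where a short time interval can be discarded. The pressure that comes with
  v may fail to be periodic, so it is carried along unchanged; only the velocity and the force are
  expanded in Fourier series.\<close>

definition thick :: "'a::euclidean_space set \<Rightarrow> bool" where
  "thick S \<longleftrightarrow> (\<forall>x\<in>S. \<forall>i\<in>Basis. \<forall>e>0. \<exists>d. 0 < \<bar>d\<bar> \<and> \<bar>d\<bar> < e \<and> x + d *\<^sub>R i \<in> S)"

text \<open>At t = 0 and t = T only one sign of the time increment stays in the slab; this is why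
  \<open>thick\<close> asks for a nonzero increment of either sign along each basis vector.\<close>

lemma thick_slab:
  fixes T :: real
  assumes "T > 0"
  shows "thick ({0..T} \<times> (UNIV :: 'a::euclidean_space set))"
  unfolding thick_def
proof (intro ballI allI impI)
  fix x i :: "real \<times> 'a" and e :: real
  assume x: "x \<in> {0..T} \<times> (UNIV :: 'a set)" and i: "i \<in> Basis" and e: "e > 0"
  consider (t) "i = (1, 0)" | (s) "fst i = 0"
    using i by (auto simp: Basis_prod_def)
  then show "\<exists>d. 0 < \<bar>d\<bar> \<and> \<bar>d\<bar> < e \<and> x + d *\<^sub>R i \<in> {0..T} \<times> (UNIV :: 'a set)"
  proof cases
    case t
    show ?thesis
    proof (cases "fst x < T")
      case True
      then show ?thesis using t x e
        by (intro exI[of _ "min (T - fst x) e / 2"]) (auto simp: mem_Times_iff min_def field_simps)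
    next
      case False
      then show ?thesis using t x e assms
        by (intro exI[of _ "- (min T e / 2)"]) (auto simp: mem_Times_iff min_def)
    qed
  next
    case s
    then show ?thesis using x e by (intro exI[of _ "e / 2"]) (auto simp: mem_Times_iff)
  qed
qed

text \<open>\<open>thick\<close> is the condition of
  \<open>frechet_derivative_unique_within\<close>: derivatives within S are unique, so the choice
  made by \<open>frechet_derivative\<close> can be evaluated, at boundary points as well.\<close>

lemma frechet_derivative_eqI:
  assumes "thick S" "x \<in> S" "(f has_derivative f') (at x within S)"
  shows "frechet_derivative f (at x within S) = f'"
proof (rule frechet_derivative_unique_within[OF _ assms(3)])
  show "(f has_derivative frechet_derivative f (at x within S)) (at x within S)"
    using assms(3) differentiableI frechet_derivative_works by blast
qed (use assms thick_def in blast)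

lemma Ck_on_cong:
  assumes "\<And>x. x \<in> S \<Longrightarrow> f x = g x"
  shows "Ck_on k f S \<longleftrightarrow> Ck_on k g S"
  using assms
proof (induction k arbitrary: f g)
  case 0
  then show ?case by (simp cong: continuous_on_cong)
next
  case (Suc k)
  have *: "(f has_derivative F) (at x within S) \<longleftrightarrow> (g has_derivative F) (at x within S)"
    if "x \<in> S" for x F
  proof
    assume "(f has_derivative F) (at x within S)"
    then show "(g has_derivative F) (at x within S)"
      by (rule has_derivative_transform[OF that, rotated]) (simp add: Suc.prems)
  next
    assume "(g has_derivative F) (at x within S)"
    then show "(f has_derivative F) (at x within S)"
      by (rule has_derivative_transform[OF that, rotated]) (simp add: Suc.prems)
  qed
  have "Ck_on k (\<lambda>x. frechet_derivative f (at x within S) v) S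
      \<longleftrightarrow> Ck_on k (\<lambda>x. frechet_derivative g (at x within S) v) S" for v
    by (rule Suc.IH) (simp add: frechet_derivative_def *)
  moreover have "f differentiable_on S \<longleftrightarrow> g differentiable_on S"
    unfolding differentiable_on_def differentiable_def using * by blast
  ultimately show ?case by (simp only: Ck_on.simps)
qed

text \<open>Any family of derivatives may be exhibited here, and \<open>Ck_on_SucE\<close> hands one
  back; the closure proofs for sums, products and compositions thus work with a named derivative
  instead of \<open>frechet_derivative\<close>.\<close>

lemma Ck_on_SucI:
  assumes "thick S" and d: "\<And>x. x \<in> S \<Longrightarrow> (f has_derivative f' x) (at x within S)"
    and "\<And>v. Ck_on k (\<lambda>x. f' x v) S"
  shows "Ck_on (Suc k) f S"
proof -
  have "Ck_on k (\<lambda>x. frechet_derivative f (at x within S) v) S" for v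
    using assms(3)[of v] frechet_derivative_eqI[OF assms(1) _ d]
    by (subst Ck_on_cong[where g = "\<lambda>x. f' x v"]) auto
  moreover have "f differentiable_on S"
    using d unfolding differentiable_on_def differentiable_def by blast
  ultimately show ?thesis by simp
qed

lemma Ck_on_SucE:
  assumes "Ck_on (Suc k) f S"
  obtains f' where "\<And>x. x \<in> S \<Longrightarrow> (f has_derivative f' x) (at x within S)"
    and "\<And>v. Ck_on k (\<lambda>x. f' x v) S"
proof
  show "(f has_derivative frechet_derivative f (at x within S)) (at x within S)" if "x \<in> S" for x
    using assms that by (auto simp: differentiable_on_def frechet_derivative_works)
qed (use assms in auto)

lemma Ck_on_Suc_imp: "Ck_on (Suc k) f S \<Longrightarrow> Ck_on k f S"
  by (induction k arbitrary: f) (auto simp: differentiable_imp_continuous_on)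

lemma Ck_on_bounded_linear:
  assumes "thick S" "bounded_linear h" "Ck_on k f S"
  shows "Ck_on k (\<lambda>x. h (f x)) S"
  using assms(3)
proof (induction k arbitrary: f)
  case 0
  then show ?case using bounded_linear.continuous_on[OF assms(2)] by simp
next
  case (Suc k)
  from Suc.prems obtain f' where f': "\<And>x. x \<in> S \<Longrightarrow> (f has_derivative f' x) (at x within S)"
    "\<And>v. Ck_on k (\<lambda>x. f' x v) S" by (rule Ck_on_SucE) blast
  show ?case
  proof (rule Ck_on_SucI[OF assms(1)])
    show "((\<lambda>x. h (f x)) has_derivative (\<lambda>v. h (f' x v))) (at x within S)" if "x \<in> S" for x
      using bounded_linear.has_derivative[OF assms(2) f'(1)[OF that]] .
    show "Ck_on k (\<lambda>x. h (f' x v)) S" for v using Suc.IH f'(2) by blast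
  qed
qed

lemma Ck_on_const: "thick S \<Longrightarrow> Ck_on k (\<lambda>x. c) S"
proof (induction k arbitrary: c)
  case (Suc k)
  show ?case by (rule Ck_on_SucI[OF Suc.prems, where f' = "\<lambda>x v. 0"]) (use Suc in auto)
qed simp

lemma Ck_on_linear: "thick S \<Longrightarrow> bounded_linear h \<Longrightarrow> Ck_on k h S"
proof (cases k)
  case 0
  assume "bounded_linear h"
  then show ?thesis using 0 by (simp add: linear_continuous_on)
next
  case (Suc k)
  assume S: "thick S" and h: "bounded_linear h"
  show ?thesis unfolding Suc
    by (rule Ck_on_SucI[OF S, where f' = "\<lambda>x v. h v"])
      (use S h in \<open>auto intro: Ck_on_const bounded_linear_imp_has_derivative\<close>)
qed

lemma Ck_on_add:
  assumes S: "thick S" and "Ck_on k f S" "Ck_on k g S"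
  shows "Ck_on k (\<lambda>x. f x + g x) S"
  using assms(2,3)
proof (induction k arbitrary: f g)
  case 0
  then show ?case by (simp add: continuous_on_add)
next
  case (Suc k)
  obtain f' where f': "\<And>x. x \<in> S \<Longrightarrow> (f has_derivative f' x) (at x within S)"
    "\<And>v. Ck_on k (\<lambda>x. f' x v) S" using Ck_on_SucE[OF Suc.prems(1)] by blast
  obtain g' where g': "\<And>x. x \<in> S \<Longrightarrow> (g has_derivative g' x) (at x within S)"
    "\<And>v. Ck_on k (\<lambda>x. g' x v) S" using Ck_on_SucE[OF Suc.prems(2)] by blast
  show ?case
    by (rule Ck_on_SucI[OF S, where f' = "\<lambda>x v. f' x v + g' x v"])
      (use f' g' Suc.IH in \<open>auto intro: has_derivative_add\<close>)
qed

lemma Ck_on_sum: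
  assumes S: "thick S" and "\<And>i. i \<in> I \<Longrightarrow> Ck_on k (f i) S"
  shows "Ck_on k (\<lambda>x. \<Sum>i\<in>I. f i x) S"
  using assms(2)
  by (induction I rule: infinite_finite_induct) (auto intro: Ck_on_const Ck_on_add S)

lemma Ck_on_scaleR:
  assumes S: "thick S" and "Ck_on k f S" "Ck_on k g S"
  shows "Ck_on k (\<lambda>x. f x *\<^sub>R g x) S"
  using assms(2,3)
proof (induction k arbitrary: f g)
  case 0
  then show ?case by (simp add: continuous_on_scaleR)
next
  case (Suc k)
  obtain f' where f': "\<And>x. x \<in> S \<Longrightarrow> (f has_derivative f' x) (at x within S)"
    "\<And>v. Ck_on k (\<lambda>x. f' x v) S" using Ck_on_SucE[OF Suc.prems(1)] by blast
  obtain g' where g': "\<And>x. x \<in> S \<Longrightarrow> (g has_derivative g' x) (at x within S)"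
    "\<And>v. Ck_on k (\<lambda>x. g' x v) S" using Ck_on_SucE[OF Suc.prems(2)] by blast
  show ?case
  proof (rule Ck_on_SucI[OF S, where f' = "\<lambda>x v. f x *\<^sub>R g' x v + f' x v *\<^sub>R g x"])
    show "((\<lambda>x. f x *\<^sub>R g x) has_derivative (\<lambda>v. f x *\<^sub>R g' x v + f' x v *\<^sub>R g x)) (at x within S)"
      if "x \<in> S" for x using has_derivative_scaleR[OF f'(1) g'(1)] that by blast
    show "Ck_on k (\<lambda>x. f x *\<^sub>R g' x v + f' x v *\<^sub>R g x) S" for v
      by (intro Ck_on_add S Suc.IH f'(2) g'(2) Ck_on_Suc_imp[OF Suc.prems(1)] Ck_on_Suc_imp[OF Suc.prems(2)])
  qed
qed

lemma Ck_on_compose: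
  fixes \<phi> :: "'a::euclidean_space \<Rightarrow> 'b::euclidean_space"
  assumes S: "thick S" and \<phi>: "\<phi> ` S \<subseteq> R" "Ck_on k \<phi> S" and "Ck_on k g R"
  shows "Ck_on k (\<lambda>x. g (\<phi> x)) S"
  using assms(3,4)
proof (induction k arbitrary: g)
  case 0
  then show ?case using \<phi>(1) by (auto intro: continuous_on_compose2)
next
  case (Suc k)
  obtain \<phi>' where \<phi>': "\<And>x. x \<in> S \<Longrightarrow> (\<phi> has_derivative \<phi>' x) (at x within S)"
    "\<And>v. Ck_on k (\<lambda>x. \<phi>' x v) S" using Ck_on_SucE[OF Suc.prems(1)] by blast
  obtain g' where g': "\<And>x. x \<in> R \<Longrightarrow> (g has_derivative g' x) (at x within R)"
    "\<And>v. Ck_on k (\<lambda>x. g' x v) R" using Ck_on_SucE[OF Suc.prems(2)] by blast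
  have k: "Ck_on k \<phi> S" using Ck_on_Suc_imp Suc.prems(1) by blast
  show ?case
  \<comment> \<open>In the chain rule the direction \<open>\<phi>' x v\<close> varies with x,
    whereas \<open>Ck_on\<close> speaks of fixed directions. Expanding it in the basis leaves
    products of scalar coefficients with derivatives of g in fixed directions.\<close>
  proof (rule Ck_on_SucI[OF S, where f' = "\<lambda>x v. \<Sum>b\<in>Basis. (\<phi>' x v \<bullet> b) *\<^sub>R g' (\<phi> x) b"])
    fix x assume x: "x \<in> S"
    then have comp: "((\<lambda>x. g (\<phi> x)) has_derivative (\<lambda>v. g' (\<phi> x) (\<phi>' x v))) (at x within S)"
      using \<phi>(1) by (intro has_derivative_in_compose2[OF g'(1) _ _ \<phi>'(1)]) auto
    have lin: "g' (\<phi> x) w = (\<Sum>b\<in>Basis. (w \<bullet> b) *\<^sub>R g' (\<phi> x) b)" for w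
    proof -
      have "linear (g' (\<phi> x))" using g'(1) \<phi>(1) x has_derivative_linear by blast
      then have "g' (\<phi> x) (\<Sum>b\<in>Basis. (w \<bullet> b) *\<^sub>R b) = (\<Sum>b\<in>Basis. (w \<bullet> b) *\<^sub>R g' (\<phi> x) b)"
        by (simp add: linear_sum linear_scale)
      then show ?thesis by (simp add: euclidean_representation)
    qed
    from comp show "((\<lambda>x. g (\<phi> x)) has_derivative (\<lambda>v. \<Sum>b\<in>Basis. (\<phi>' x v \<bullet> b) *\<^sub>R g' (\<phi> x) b))
        (at x within S)" by (rule has_derivative_eq_rhs) (rule ext, rule lin)
  next
    fix v
    show "Ck_on k (\<lambda>x. \<Sum>b\<in>Basis. (\<phi>' x v \<bullet> b) *\<^sub>R g' (\<phi> x) b) S"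
      using Suc.IH[OF k g'(2)] \<phi>'(2)
      by (intro Ck_on_sum Ck_on_scaleR S Ck_on_bounded_linear[OF S bounded_linear_inner_left]) auto
  qed
qed

text \<open>A class of functions that is closed under differentiation in every fixed direction
  consists of smooth functions. It is applied to the class of Fourier series and to the class of
  partial Fourier integrals, both of which differentiate into members of the same class.\<close>

lemma smooth_on_coinduct:
  assumes S: "thick S" and "P f"
    and step: "\<And>f. P f \<Longrightarrow> \<exists>f'. (\<forall>x\<in>S. (f has_derivative f' x) (at x within S)) \<and> (\<forall>v. P (\<lambda>x. f' x v))"
  shows "smooth_on f S"
  unfolding smooth_on_def
proof
  fix k show "Ck_on k f S" using \<open>P f\<close>
  proof (induction k arbitrary: f)
    case 0
    then show ?case using step
      by (metis Ck_on.simps(1) continuous_on_eq_continuous_within has_derivative_continuous)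
  next
    case (Suc k)
    from step[OF Suc.prems] obtain f' where "\<forall>x\<in>S. (f has_derivative f' x) (at x within S)"
      "\<forall>v. P (\<lambda>x. f' x v)" by blast
    then show ?case by (intro Ck_on_SucI[OF S, of _ f']) (auto intro: Suc.IH)
  qed
qed

lemma smooth_on_imp_continuous_on: "smooth_on f S \<Longrightarrow> continuous_on S f"
  unfolding smooth_on_def using Ck_on.simps(1) by blast

lemma smooth_on_bounded_linear:
  "thick S \<Longrightarrow> bounded_linear h \<Longrightarrow> smooth_on f S \<Longrightarrow> smooth_on (\<lambda>x. h (f x)) S"
  unfolding smooth_on_def by (auto intro: Ck_on_bounded_linear)

lemma smooth_on_const: "thick S \<Longrightarrow> smooth_on (\<lambda>x. c) S"
  unfolding smooth_on_def by (auto intro: Ck_on_const)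

lemma smooth_on_linear: "thick S \<Longrightarrow> bounded_linear h \<Longrightarrow> smooth_on h S"
  unfolding smooth_on_def by (auto intro: Ck_on_linear)

lemma smooth_on_add: "thick S \<Longrightarrow> smooth_on f S \<Longrightarrow> smooth_on g S \<Longrightarrow> smooth_on (\<lambda>x. f x + g x) S"
  unfolding smooth_on_def by (auto intro: Ck_on_add)

lemma smooth_on_diff:
  assumes "thick S" "smooth_on f S" "smooth_on g S"
  shows "smooth_on (\<lambda>x. f x - g x) S"
  using smooth_on_add[OF assms(1,2) smooth_on_bounded_linear[OF assms(1) bounded_linear_minus[OF bounded_linear_ident] assms(3)]]
  by simp

lemma smooth_on_sum:
  "thick S \<Longrightarrow> (\<And>i. i \<in> I \<Longrightarrow> smooth_on (f i) S) \<Longrightarrow> smooth_on (\<lambda>x. \<Sum>i\<in>I. f i x) S"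
  unfolding smooth_on_def by (auto intro: Ck_on_sum)

lemma smooth_on_scaleR:
  "thick S \<Longrightarrow> smooth_on f S \<Longrightarrow> smooth_on g S \<Longrightarrow> smooth_on (\<lambda>x. f x *\<^sub>R g x) S"
  unfolding smooth_on_def by (auto intro: Ck_on_scaleR)

lemma smooth_on_compose:
  fixes \<phi> :: "'a::euclidean_space \<Rightarrow> 'b::euclidean_space"
  assumes "thick S" "\<phi> ` S \<subseteq> R" "smooth_on \<phi> S" "smooth_on g R"
  shows "smooth_on (\<lambda>x. g (\<phi> x)) S"
  using assms unfolding smooth_on_def by (blast intro: Ck_on_compose)

lemma smooth_on_vec:
  fixes f :: "'a::euclidean_space \<Rightarrow> real^3"
  assumes "thick S" "\<And>i. smooth_on (\<lambda>x. f x $ i) S"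
  shows "smooth_on f S"
proof -
  have eq: "(\<lambda>x. \<Sum>i\<in>UNIV. (f x $ i) *\<^sub>R axis i 1) = f"
    by (simp add: fun_eq_iff vec_eq_iff axis_def if_distrib[where f = "\<lambda>z. _ * z"] cong: if_cong)
  have "smooth_on (\<lambda>x. \<Sum>i\<in>UNIV. (f x $ i) *\<^sub>R axis i (1::real)) S"
    by (intro smooth_on_sum smooth_on_scaleR smooth_on_const assms)
  then show ?thesis unfolding eq .
qed

section \<open>Separate derivatives in time and space on the slab\<close>

lemma slab_derivative_time:
  assumes "(g has_derivative D) (at (t, x) within {0..T} \<times> UNIV)"
  shows "((\<lambda>s. g (s, x)) has_vector_derivative D (1, 0)) (at t within {0..T})"
proof -
  have d: "((\<lambda>s. g (s, x)) has_derivative (\<lambda>h. D (h, 0))) (at t within {0..T})"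
    by (rule has_derivative_in_compose[where f = "\<lambda>s. (s, x)" and g = g])
      (auto intro!: derivative_eq_intros has_derivative_subset[OF assms])
  have e: "D (h, 0) = h *\<^sub>R D (1, 0)" for h
    using linear_scale[OF has_derivative_linear[OF assms], of h "(1, 0)"] by simp
  show ?thesis unfolding has_vector_derivative_def
    by (rule has_derivative_eq_rhs[OF d]) (rule ext, rule e)
qed

lemma slab_derivative_space:
  fixes T :: real
  assumes "(g has_derivative D) (at (t, x) within {0..T} \<times> UNIV)" "t \<in> {0..T}"
  shows "((\<lambda>x. g (t, x)) has_derivative (\<lambda>h. D (0, h))) (at x)"
  by (rule has_derivative_in_compose[where f = "\<lambda>x. (t, x)" and g = g])
      (use assms(2) in \<open>auto intro!: derivative_eq_intros has_derivative_subset[OF assms(1)]\<close>)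

subsection \<open>Sums over the lattice\<close>

lemma norm_summable_imp_summable:
  fixes f :: "'k \<Rightarrow> 'b::banach"
  assumes "\<And>k. norm (f k) \<le> B k" "B summable_on UNIV"
  shows "(\<lambda>k. norm (f k)) summable_on UNIV" "f summable_on UNIV" "norm (\<Sum>\<^sub>\<infinity>k. f k) \<le> (\<Sum>\<^sub>\<infinity>k. B k)"
proof -
  show 1: "(\<lambda>k. norm (f k)) summable_on UNIV"
    by (rule Infinite_Sum.abs_summable_on_comparison_test'[OF assms(2)]) (rule assms(1))
  then show 2: "f summable_on UNIV" by (rule abs_summable_summable)
  have "norm (\<Sum>\<^sub>\<infinity>k. f k) \<le> (\<Sum>\<^sub>\<infinity>k. norm (f k))" by (rule norm_infsum_bound[OF 1])
  also have "\<dots> \<le> (\<Sum>\<^sub>\<infinity>k. B k)" by (rule infsum_mono[OF 1 assms(2) assms(1)])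
  finally show "norm (\<Sum>\<^sub>\<infinity>k. f k) \<le> (\<Sum>\<^sub>\<infinity>k. B k)" .
qed

text \<open>The same summable B dominates the terms and, up to the factor norm h, their derivatives,
  so the tails are small uniformly in z and linearly in h. Enumerating the index set by
  \<open>e\<close> makes \<open>has_derivative_series\<close> applicable; absolute convergence
  identifies its ordered sums with the unordered ones.\<close>

lemma has_derivative_infsum:
  fixes f :: "'k::countable \<Rightarrow> 'a::real_normed_vector \<Rightarrow> 'b::banach"
  assumes inf: "infinite (UNIV :: 'k set)" and S: "convex S" and z0: "z0 \<in> S"
    and d: "\<And>k z. z \<in> S \<Longrightarrow> (f k has_derivative f' k z) (at z within S)"
    and f: "\<And>k z. z \<in> S \<Longrightarrow> norm (f k z) \<le> B k"
    and f': "\<And>k z h. z \<in> S \<Longrightarrow> norm (f' k z h) \<le> B k * norm h"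
    and B: "B summable_on UNIV"
  shows "((\<lambda>z. \<Sum>\<^sub>\<infinity>k. f k z) has_derivative (\<lambda>h. \<Sum>\<^sub>\<infinity>k. f' k z0 h)) (at z0 within S)"
proof -
  define e :: "nat \<Rightarrow> 'k" where "e = from_nat_into UNIV"
  have e: "bij_betw e UNIV UNIV"
    unfolding e_def by (rule bij_betw_from_nat_into) (use inf in auto)
  have Be: "(\<lambda>n. B (e n)) summable_on UNIV"
    using B summable_on_reindex_bij_betw[OF e] by blast
  have B0: "B k \<ge> 0" for k using f[OF z0, of k] norm_ge_zero order_trans by blast
  have Bs: "summable (\<lambda>n. B (e n))" using Be by (rule summable_on_imp_summable)
  have sums: "(\<lambda>n. g (e n)) sums (\<Sum>\<^sub>\<infinity>k. g k)"
    if "\<And>k. norm (g k) \<le> B k * c" for g :: "'k \<Rightarrow> 'b" and c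
  proof -
    have "g summable_on UNIV"
      by (rule norm_summable_imp_summable(2)[OF that]) (intro summable_on_cmult_left B)
    then have "((\<lambda>n. g (e n)) has_sum (\<Sum>\<^sub>\<infinity>k. g k)) UNIV"
      using has_sum_reindex_bij_betw[OF e, of g] by auto
    then show ?thesis by (rule has_sum_imp_sums)
  qed
  have "\<exists>g. \<forall>z\<in>S. (\<lambda>n. f (e n) z) sums g z \<and>
      (g has_derivative (\<lambda>h. \<Sum>\<^sub>\<infinity>k. f' k z h)) (at z within S)"
  proof (rule has_derivative_series[OF S d _ z0])
    show "(\<lambda>n. f (e n) z0) sums (\<Sum>\<^sub>\<infinity>k. f k z0)"
      by (rule sums[where c = 1]) (use f z0 in auto)
    fix \<epsilon> :: real assume \<epsilon>: "\<epsilon> > 0"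
    have "\<forall>\<^sub>F n in sequentially. norm (\<Sum>i. B (e (i + n))) < \<epsilon>"
      using suminf_exist_split[OF \<epsilon> Bs] unfolding eventually_sequentially by blast
    then show "\<forall>\<^sub>F n in sequentially. \<forall>z\<in>S. \<forall>h.
        norm ((\<Sum>i<n. f' (e i) z h) - (\<Sum>\<^sub>\<infinity>k. f' k z h)) \<le> \<epsilon> * norm h"
    proof eventually_elim
      case (elim n)
      show ?case
      proof (intro ballI allI)
        fix z h assume z: "z \<in> S"
        let ?g = "\<lambda>n. f' (e n) z h"
        have s: "?g sums (\<Sum>\<^sub>\<infinity>k. f' k z h)" by (rule sums) (rule f'[OF z])
        have sB: "summable (\<lambda>i. B (e (i + n)) * norm h)"
          by (intro summable_mult2 summable_ignore_initial_segment[OF Bs])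
        have "(\<Sum>i<n. ?g i) - (\<Sum>\<^sub>\<infinity>k. f' k z h) = - (\<Sum>i. ?g (i + n))"
          using suminf_split_initial_segment[OF sums_summable[OF s], of n] sums_unique[OF s] by simp
        moreover have "norm (\<Sum>i. ?g (i + n)) \<le> (\<Sum>i. B (e (i + n)) * norm h)"
          by (rule norm_suminf_le[OF _ sB]) (rule f'[OF z])
        moreover have "(\<Sum>i. B (e (i + n)) * norm h) = (\<Sum>i. B (e (i + n))) * norm h"
          by (rule suminf_mult2[symmetric]) (rule summable_ignore_initial_segment[OF Bs])
        moreover have "(\<Sum>i. B (e (i + n))) * norm h \<le> \<epsilon> * norm h"
          using elim by (intro mult_right_mono) auto
        ultimately show "norm ((\<Sum>i<n. ?g i) - (\<Sum>\<^sub>\<infinity>k. f' k z h)) \<le> \<epsilon> * norm h"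
          by simp
      qed
    qed
  qed
  then obtain g where g: "\<And>z. z \<in> S \<Longrightarrow> (\<lambda>n. f (e n) z) sums g z"
    "\<And>z. z \<in> S \<Longrightarrow> (g has_derivative (\<lambda>h. \<Sum>\<^sub>\<infinity>k. f' k z h)) (at z within S)" by blast
  have "g z = (\<Sum>\<^sub>\<infinity>k. f k z)" if "z \<in> S" for z
    by (rule sums_unique2[OF g(1)[OF that]], rule sums[where c = 1]) (use f that in auto)
  then show ?thesis
    by (intro has_derivative_transform[OF z0 _ g(2)[OF z0]]) auto
qed

lemma continuous_on_infsum:
  fixes f :: "'k \<Rightarrow> 'a::topological_space \<Rightarrow> 'b::banach"
  assumes "\<And>k. continuous_on S (f k)" "\<And>k z. z \<in> S \<Longrightarrow> norm (f k z) \<le> B k" "B summable_on UNIV"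
  shows "continuous_on S (\<lambda>z. \<Sum>\<^sub>\<infinity>k. f k z)"
proof (rule uniform_limit_theorem)
  show "uniform_limit S (\<lambda>X z. \<Sum>k\<in>X. f k z) (\<lambda>z. \<Sum>\<^sub>\<infinity>k. f k z) (finite_subsets_at_top UNIV)"
    by (rule Weierstrass_m_test_general) (use assms in auto)
qed (auto intro!: always_eventually continuous_on_sum assms)

text \<open>Starting at 1 avoids a special case at k = 0 in quotients. With the l1 norm one factor
  of the weight splits into 1 plus the three absolute coordinates, which is how decay is gained in
  \<open>coef_rapid\<close>.\<close>

definition wt :: "int^3 \<Rightarrow> real" where
  "wt k = 1 + (\<Sum>i\<in>UNIV. \<bar>of_int (k $ i)\<bar>)"

lemma wt_ge_1: "1 \<le> wt k"
  unfolding wt_def by (simp add: sum_nonneg)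

lemma wt_pos: "0 < wt k"
  using wt_ge_1[of k] by linarith

lemma wt_uminus [simp]: "wt (- k) = wt k"
  by (simp add: wt_def)

lemma bound_nonneg:
  assumes "cmod x \<le> C / wt k ^ N" shows "0 \<le> C"
proof -
  have "0 \<le> C / wt k ^ N" using assms norm_ge_zero order_trans by blast
  then show ?thesis
    using zero_less_power[OF wt_pos[of k], of N] by (simp add: zero_le_divide_iff not_less)
qed

lemma wt_triangle: "wt k \<le> wt m + wt (k - m)"
proof -
  have "(\<Sum>i\<in>UNIV. \<bar>of_int (k $ i)\<bar> :: real) \<le> (\<Sum>i\<in>UNIV. \<bar>of_int (m $ i)\<bar> + \<bar>of_int ((k - m) $ i)\<bar>)"
    by (rule sum_mono) simp
  then show ?thesis by (simp add: wt_def sum.distrib)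
qed

lemma abs_nth_le_wt: "\<bar>of_int (k $ i)\<bar> \<le> wt k"
proof -
  have "\<bar>of_int (k $ i)\<bar> \<le> (\<Sum>i\<in>UNIV. \<bar>of_int (k $ i)\<bar> :: real)"
    by (rule member_le_sum) auto
  then show ?thesis by (simp add: wt_def)
qed

lemma summable_int_inverse_square: "(\<lambda>n::int. 1 / (1 + \<bar>of_int n\<bar>) ^ 2 :: real) summable_on UNIV"
  (is "?f summable_on _")
proof -
  have "summable (\<lambda>n::nat. 1 / (1 + real n) ^ 2)"
    using inverse_power_summable[of 2, where ?'a = real] summable_Suc_iff[of "\<lambda>n. inverse (real n ^ 2)"]
    by (simp add: field_simps)
  then have s: "(\<lambda>n::nat. 1 / (1 + real n) ^ 2) summable_on UNIV"
    by (subst summable_on_UNIV_nonneg_real_iff) auto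
  have 1: "?f summable_on (range int)"
    by (subst summable_on_reindex) (use s in \<open>auto simp: o_def inj_on_def\<close>)
  have 2: "?f summable_on (range (\<lambda>n. - int n))"
    by (subst summable_on_reindex) (use s in \<open>auto simp: o_def inj_on_def\<close>)
  have "range int \<union> range (\<lambda>n. - int n) = UNIV"
  proof (intro equalityI subsetI)
    fix n :: int show "n \<in> range int \<union> range (\<lambda>n. - int n)" by (cases n rule: int_cases2) auto
  qed auto
  with summable_on_union[OF 1 2] show ?thesis by simp
qed

lemma bij_int3: "bij_betw (\<lambda>(a, b, c). vector [a, b, c] :: int^3) (UNIV \<times> UNIV \<times> UNIV) UNIV"
proof (rule bij_betw_byWitness[where f' = "\<lambda>k. (k $ 1, k $ 2, k $ 3)"])
qed (auto simp: vec_eq_iff forall_3)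

text \<open>The exponent 6 is two for each of the three coordinates: the weight is at least 1 +
  |k_i| for every i, so its sixth power dominates the product of the three squares, and the sum
  reduces to one-dimensional ones.\<close>

lemma summable_wt: "(\<lambda>k. 1 / wt k ^ 6) summable_on UNIV"
proof -
  let ?h = "\<lambda>n::int. 1 / (1 + \<bar>of_int n\<bar>) ^ 2 :: real"
  have h: "?h summable_on UNIV" by (rule summable_int_inverse_square)
  have prod: "(\<lambda>(x, y). f x * g y) summable_on UNIV \<times> UNIV"
    if "f summable_on UNIV" "g summable_on UNIV" "\<And>x. f x \<ge> 0" "\<And>y. g y \<ge> 0"
    for f :: "int \<Rightarrow> real" and g :: "'c \<Rightarrow> real"
  proof (rule summable_on_SigmaI[where g = "\<lambda>x. f x * (\<Sum>\<^sub>\<infinity>y. g y)"])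
    show "((\<lambda>y. case (x, y) of (x, y) \<Rightarrow> f x * g y) has_sum f x * (\<Sum>\<^sub>\<infinity>y. g y)) UNIV" for x
      using has_sum_cmult_right[OF has_sum_infsum[OF that(2)]] by simp
    show "(\<lambda>x. f x * (\<Sum>\<^sub>\<infinity>y. g y)) summable_on UNIV" by (intro summable_on_cmult_left that)
  qed (use that in auto)
  have "(\<lambda>(x, y). ?h x * (case y of (a, b) \<Rightarrow> ?h a * ?h b)) summable_on UNIV \<times> UNIV"
    by (rule prod) (use h prod[OF h h] in auto)
  then have s: "(\<lambda>(a, b, c). ?h a * (?h b * ?h c)) summable_on UNIV \<times> UNIV \<times> UNIV"
    by (simp add: case_prod_unfold)
  have "(\<lambda>(a, b, c). 1 / wt (vector [a, b, c]) ^ 6) summable_on UNIV \<times> UNIV \<times> UNIV"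
  proof (rule summable_on_comparison_test[OF s], goal_cases)
    case (1 z)
    obtain a b c where z: "z = (a, b, c)" by (cases z)
    define x y w where "x = 1 + \<bar>real_of_int a\<bar>" "y = 1 + \<bar>real_of_int b\<bar>" "w = 1 + \<bar>real_of_int c\<bar>"
    define W where "W = wt (vector [a, b, c])"
    have W: "W = x + y + w - 2" by (simp add: W_def wt_def sum_3 x_y_w_def)
    have p: "x \<ge> 1" "y \<ge> 1" "w \<ge> 1" by (auto simp: x_y_w_def)
    then have "x^2 * (y^2 * w^2) \<le> W^2 * (W^2 * W^2)"
      by (intro mult_mono power_mono) (auto simp: W)
    also have "\<dots> = W ^ 6" by (simp add: power_add[symmetric])
    finally have "1 / W ^ 6 \<le> 1 / (x^2 * (y^2 * w^2))"
      using p by (intro divide_left_mono) (auto simp: W)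
    then show ?case by (simp add: z x_y_w_def W_def)
  next
    case (2 z)
    then show ?case using wt_pos by (auto simp: case_prod_unfold less_imp_le)
  qed
  then have "(\<lambda>z. (\<lambda>k. 1 / wt k ^ 6) ((\<lambda>(a, b, c). vector [a, b, c]) z)) summable_on UNIV \<times> UNIV \<times> UNIV"
    by (simp add: case_prod_unfold)
  then show ?thesis using summable_on_reindex_bij_betw[OF bij_int3] by blast
qed

lemma infinite_int3: "infinite (UNIV :: (int^3) set)"
proof
  assume "finite (UNIV :: (int^3) set)"
  then have "finite (range (\<lambda>k::int^3. k $ 1))" by simp
  moreover have "range (\<lambda>k::int^3. k $ 1) = UNIV"
  proof (rule surjI)
    show "(\<chi> i. n) $ 1 = n" for n :: int by simp
  qed
  ultimately show False using infinite_UNIV_int by simp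
qed

text \<open>Used to split the lattice into finitely many low modes, treated one by one, and high
  modes, treated by decay.\<close>

lemma finite_wt_less: "finite {k. wt k < r}"
proof -
  have "{k. wt k < r} \<subseteq> {k. \<forall>i. k $ i \<in> {- \<lceil>r\<rceil>..\<lceil>r\<rceil>}}"
  proof clarsimp
    fix k i assume "wt k < r"
    then have "\<bar>real_of_int (k $ i)\<bar> < r" using abs_nth_le_wt[of k i] by linarith
    then show "- \<lceil>r\<rceil> \<le> k $ i \<and> k $ i \<le> \<lceil>r\<rceil>" by linarith
  qed
  moreover have "finite {k :: int^3. \<forall>i. k $ i \<in> {- \<lceil>r\<rceil>..\<lceil>r\<rceil>}}"
  proof (rule finite_subset)
    show "{k :: int^3. \<forall>i. k $ i \<in> {- \<lceil>r\<rceil>..\<lceil>r\<rceil>}}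
        \<subseteq> vec_lambda ` (UNIV \<rightarrow>\<^sub>E {- \<lceil>r\<rceil>..\<lceil>r\<rceil>})"
    proof
      fix k :: "int^3" assume "k \<in> {k. \<forall>i. k $ i \<in> {- \<lceil>r\<rceil>..\<lceil>r\<rceil>}}"
      then show "k \<in> vec_lambda ` (UNIV \<rightarrow>\<^sub>E {- \<lceil>r\<rceil>..\<lceil>r\<rceil>})"
        by (intro image_eqI[of _ _ "vec_nth k"]) auto
    qed
  qed (intro finite_imageI finite_PiE, auto)
  ultimately show ?thesis by (rule finite_subset)
qed

subsection \<open>Convolution\<close>

definition conv :: "(int^3 \<Rightarrow> complex) \<Rightarrow> (int^3 \<Rightarrow> complex) \<Rightarrow> int^3 \<Rightarrow> complex" where
  "conv a b k = (\<Sum>\<^sub>\<infinity>m. a m * b (k - m))"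

text \<open>The constant of the algebra property in \<open>conv_bound\<close>: 2 ^ N comes from
  comparing wt k with twice the larger of the two weights, the factor 2 from the two halves of the
  sum in \<open>wt_conv\<close>.\<close>

definition conv_const :: "nat \<Rightarrow> real" where
  "conv_const N = 2 * 2 ^ N * (\<Sum>\<^sub>\<infinity>k. 1 / wt k ^ 6)"

lemma conv_const_nonneg: "0 \<le> conv_const N"
  unfolding conv_const_def by (intro mult_nonneg_nonneg infsum_nonneg) (auto simp: less_imp_le wt_pos)

lemma bij_diff: "bij_betw (\<lambda>m. k - m) UNIV (UNIV :: (int^3) set)"
  by (rule bij_betw_byWitness[where f' = "\<lambda>m. k - m"]) auto

text \<open>The larger of the two weights is at least wt k / 2 and pays for wt k ^ N; the smaller
  one keeps its power N, of which 6 suffices for summability.\<close>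

lemma wt_conv:
  assumes "6 \<le> N"
  shows "1 / (wt m ^ N * wt (k - m) ^ N) \<le> 2 ^ N / wt k ^ N * (1 / wt m ^ 6 + 1 / wt (k - m) ^ 6)"
proof -
  have *: "1 / (p ^ N * q ^ N) \<le> 2 ^ N / r ^ N * (1 / p ^ 6)"
    if "1 \<le> p" "p \<le> q" "r \<le> p + q" "1 \<le> r" for p q r :: real
  proof -
    have "r ^ N \<le> (2 * q) ^ N" using that by (intro power_mono) auto
    then have "r ^ N * p ^ 6 \<le> (2 ^ N * q ^ N) * p ^ N"
      using that assms by (intro mult_mono) (auto simp: power_mult_distrib power_increasing)
    then show ?thesis using that by (simp add: field_simps)
  qed
  show ?thesis
  proof (cases "wt m \<le> wt (k - m)")
    case True
    have "1 / (wt m ^ N * wt (k - m) ^ N) \<le> 2 ^ N / wt k ^ N * (1 / wt m ^ 6)"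
      by (rule *) (use True wt_ge_1 wt_triangle[of k m] in auto)
    also have "\<dots> \<le> 2 ^ N / wt k ^ N * (1 / wt m ^ 6 + 1 / wt (k - m) ^ 6)"
      using wt_pos[of k] wt_pos[of "k - m"] by (intro mult_left_mono) auto
    finally show ?thesis .
  next
    case False
    have "1 / (wt (k - m) ^ N * wt m ^ N) \<le> 2 ^ N / wt k ^ N * (1 / wt (k - m) ^ 6)"
      by (rule *) (use False wt_ge_1 wt_triangle[of k m] in auto)
    also have "\<dots> \<le> 2 ^ N / wt k ^ N * (1 / wt m ^ 6 + 1 / wt (k - m) ^ 6)"
      using wt_pos[of k] wt_pos[of "m"] by (intro mult_left_mono) auto
    finally show ?thesis by (simp add: mult.commute)
  qed
qed

lemma summable_wt_shift: "(\<lambda>m. 1 / wt (k - m) ^ 6) summable_on UNIV"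
  using summable_on_reindex_bij_betw[OF bij_diff, of "\<lambda>k. 1 / wt k ^ 6" k] summable_wt by blast

text \<open>For N at least 6, the sequences bounded by a multiple of wt ^ (- N) form an algebra
  under convolution. The termwise bound and its summability are recorded as well, because continuity
  and differentiation in time need a dominating series.\<close>

lemma conv_bound:
  assumes N: "6 \<le> N" and a: "\<And>m. cmod (a m) \<le> A / wt m ^ N" and b: "\<And>m. cmod (b m) \<le> B / wt m ^ N"
  shows "cmod (a m * b (k - m)) \<le> A * B * (2 ^ N / wt k ^ N * (1 / wt m ^ 6 + 1 / wt (k - m) ^ 6))"
    and "(\<lambda>m. A * B * (2 ^ N / wt k ^ N * (1 / wt m ^ 6 + 1 / wt (k - m) ^ 6))) summable_on UNIV"
    and "(\<lambda>m. a m * b (k - m)) summable_on UNIV"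
    and "cmod (conv a b k) \<le> conv_const N * A * B / wt k ^ N"
proof -
  have A: "A \<ge> 0" and B: "B \<ge> 0" using bound_nonneg[OF a] bound_nonneg[OF b] by blast+
  show 1: "cmod (a m * b (k - m)) \<le> A * B * (2 ^ N / wt k ^ N * (1 / wt m ^ 6 + 1 / wt (k - m) ^ 6))" for m
  proof -
    have "cmod (a m * b (k - m)) \<le> A / wt m ^ N * (B / wt (k - m) ^ N)"
      unfolding norm_mult using A wt_pos[of m]
      by (intro mult_mono a b) auto
    also have "\<dots> = A * B * (1 / (wt m ^ N * wt (k - m) ^ N))" by simp
    also have "\<dots> \<le> A * B * (2 ^ N / wt k ^ N * (1 / wt m ^ 6 + 1 / wt (k - m) ^ 6))"
      by (intro mult_left_mono wt_conv N) (use A B in auto)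
    finally show ?thesis .
  qed
  have s0: "(\<lambda>m. 1 / wt m ^ 6 + 1 / wt (k - m) ^ 6) summable_on UNIV"
    by (intro summable_on_add summable_wt summable_wt_shift)
  show 2: "(\<lambda>m. A * B * (2 ^ N / wt k ^ N * (1 / wt m ^ 6 + 1 / wt (k - m) ^ 6))) summable_on UNIV"
    by (intro summable_on_cmult_right s0)
  show "(\<lambda>m. a m * b (k - m)) summable_on UNIV"
    by (rule norm_summable_imp_summable(2)[OF 1 2])
  have "cmod (conv a b k) \<le> (\<Sum>\<^sub>\<infinity>m. A * B * (2 ^ N / wt k ^ N * (1 / wt m ^ 6 + 1 / wt (k - m) ^ 6)))"
    unfolding conv_def by (rule norm_summable_imp_summable(3)[OF 1 2])
  also have "\<dots> = A * B * (2 ^ N / wt k ^ N * ((\<Sum>\<^sub>\<infinity>m. 1 / wt m ^ 6) + (\<Sum>\<^sub>\<infinity>m. 1 / wt (k - m) ^ 6)))"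
    by (simp only: infsum_cmult_right' infsum_add[OF summable_wt summable_wt_shift])
  also have "(\<Sum>\<^sub>\<infinity>m. 1 / wt (k - m) ^ 6) = (\<Sum>\<^sub>\<infinity>m. 1 / wt m ^ 6)"
    by (rule infsum_reindex_bij_betw[OF bij_diff])
  finally show "cmod (conv a b k) \<le> conv_const N * A * B / wt k ^ N"
    by (simp add: conv_const_def mult_ac)
qed

lemma continuous_on_conv:
  assumes a: "\<And>m t. t \<in> S \<Longrightarrow> cmod (a m t) \<le> A / wt m ^ 6" "\<And>m. continuous_on S (a m)"
    and b: "\<And>m t. t \<in> S \<Longrightarrow> cmod (b m t) \<le> B / wt m ^ 6" "\<And>m. continuous_on S (b m)"
  shows "continuous_on S (\<lambda>t. conv (\<lambda>m. a m t) (\<lambda>m. b m t) k)"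
  unfolding conv_def
proof (rule continuous_on_infsum)
  show "cmod (a m t * b (k - m) t) \<le> A * B * (2 ^ 6 / wt k ^ 6 * (1 / wt m ^ 6 + 1 / wt (k - m) ^ 6))"
    if "t \<in> S" for m t
    by (rule conv_bound(1)[of 6 "\<lambda>m. a m t" _ "\<lambda>m. b m t"]) (use a b that in auto)
  show "(\<lambda>m. A * B * (2 ^ 6 / wt k ^ 6 * (1 / wt m ^ 6 + 1 / wt (k - m) ^ 6))) summable_on UNIV"
    by (intro summable_on_cmult_right summable_on_add summable_wt summable_wt_shift)
  show "continuous_on S (\<lambda>t. a m t * b (k - m) t)" for m
    by (intro continuous_on_mult a b)
qed

text \<open>The family a m * b n is absolutely summable over pairs; summing it along the lines m + n
  = k by Fubini gives the left side, summing it as a product gives the right side.\<close>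

lemma infsum_conv:
  assumes a: "(\<lambda>m. cmod (a m)) summable_on UNIV" and b: "(\<lambda>m. cmod (b m)) summable_on UNIV"
  shows "(\<Sum>\<^sub>\<infinity>k. conv a b k) = (\<Sum>\<^sub>\<infinity>m. a m) * (\<Sum>\<^sub>\<infinity>m. b m)"
proof -
  define G where "G = (\<lambda>(m, n). a m * b n)"
  have "(\<lambda>z. cmod (G z)) summable_on UNIV \<times> UNIV"
    unfolding Infinite_Sum.abs_summable_on_Sigma_iff
  proof (intro conjI ballI)
    show "(\<lambda>y. cmod (G (x, y))) summable_on UNIV" for x
      unfolding G_def by (simp add: norm_mult) (intro summable_on_cmult_right b)
    have "(\<lambda>x. cmod (a x) * (\<Sum>\<^sub>\<infinity>y. cmod (b y))) summable_on UNIV"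
      by (intro summable_on_cmult_left a)
    then show "(\<lambda>x. norm (\<Sum>\<^sub>\<infinity>y. cmod (G (x, y)))) summable_on UNIV"
      by (simp add: G_def norm_mult infsum_cmult_right' infsum_nonneg)
  qed
  then have G: "G summable_on UNIV \<times> UNIV" by (rule abs_summable_summable)
  have bij: "bij_betw (\<lambda>(k, m). (m, k - m)) (UNIV \<times> UNIV) (UNIV \<times> (UNIV :: (int^3) set))"
    by (rule bij_betw_byWitness[where f' = "\<lambda>(m, n). (m + n, m)"]) auto
  let ?F = "\<lambda>z. G ((\<lambda>(k, m). (m, k - m)) z)"
  have F: "?F summable_on UNIV \<times> UNIV"
    using summable_on_reindex_bij_betw[OF bij, of G] G by blast
  have "(\<Sum>\<^sub>\<infinity>k. conv a b k) = (\<Sum>\<^sub>\<infinity>k. \<Sum>\<^sub>\<infinity>m. ?F (k, m))"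
    by (simp add: conv_def G_def)
  also have "\<dots> = infsum ?F (UNIV \<times> UNIV)" by (rule infsum_Sigma_banach[OF F])
  also have "\<dots> = infsum G (UNIV \<times> UNIV)" by (rule infsum_reindex_bij_betw[OF bij])
  also have "\<dots> = (\<Sum>\<^sub>\<infinity>m. \<Sum>\<^sub>\<infinity>n. G (m, n))" by (rule infsum_Sigma_banach[OF G, symmetric])
  also have "\<dots> = (\<Sum>\<^sub>\<infinity>m. a m) * (\<Sum>\<^sub>\<infinity>m. b m)"
    by (simp add: G_def infsum_cmult_right' infsum_cmult_left')
  finally show ?thesis .
qed

lemma conv_diff_left:
  assumes "(\<lambda>m. a m * c (k - m)) summable_on UNIV" "(\<lambda>m. b m * c (k - m)) summable_on UNIV"
  shows "conv (\<lambda>m. a m - b m) c k = conv a c k - conv b c k"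
  unfolding conv_def using infsum_add[OF assms(1) summable_on_uminus[THEN iffD2, OF assms(2)]]
  by (simp add: left_diff_distrib infsum_uminus)

lemma conv_commute: "conv a b k = conv b a k"
proof -
  have "conv a b k = (\<Sum>\<^sub>\<infinity>m. a (k - m) * b (k - (k - m)))"
    unfolding conv_def by (rule infsum_reindex_bij_betw[OF bij_diff, symmetric])
  then show ?thesis by (simp add: conv_def mult.commute)
qed

lemma conv_hermitian:
  assumes "\<And>m. a (- m) = cnj (a m)" "\<And>m. b (- m) = cnj (b m)"
  shows "conv a b (- k) = cnj (conv a b k)"
proof -
  have bij: "bij_betw uminus UNIV (UNIV :: (int^3) set)"
    by (rule bij_betw_byWitness[where f' = uminus]) auto
  have "a (- m) * b (- k - (- m)) = cnj (a m * b (k - m))" for m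
    using assms(1)[of m] assms(2)[of "k - m"] by simp
  then have "cnj (conv a b k) = (\<Sum>\<^sub>\<infinity>m. a (- m) * b (- k - (- m)))"
    by (simp add: conv_def flip: infsum_cnj)
  also have "\<dots> = conv a b (- k)"
    unfolding conv_def by (rule infsum_reindex_bij_betw[OF bij])
  finally show ?thesis ..
qed

subsection \<open>Rapidly decreasing families of Fourier coefficients\<close>

lemma has_derivative_cis:
  assumes "(f has_derivative f') (at x within S)"
  shows "((\<lambda>x. cis (f x)) has_derivative (\<lambda>h. \<i> * of_real (f' h) * cis (f x))) (at x within S)"
proof -
  have "((\<lambda>x. exp (\<i> * of_real (f x))) has_derivative
      (\<lambda>h. exp (\<i> * of_real (f x)) * (\<i> * of_real (f' h)))) (at x within S)"
    by (rule has_derivative_compose[where g = exp])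
      (auto intro!: derivative_eq_intros assms DERIV_exp[unfolded has_field_derivative_def])
  then show ?thesis by (simp add: cis_conv_exp mult.commute)
qed

lemma has_vector_derivative_cis:
  assumes "(f has_real_derivative d) (at t within S)"
  shows "((\<lambda>t. cis (f t)) has_vector_derivative \<i> * of_real d * cis (f t)) (at t within S)"
  using has_derivative_cis[OF assms[unfolded has_field_derivative_def]]
  unfolding has_vector_derivative_def
  by (rule has_derivative_eq_rhs) (simp add: fun_eq_iff scaleR_conv_of_real mult_ac)

type_synonym fam = "int^3 \<Rightarrow> real \<Rightarrow> complex"

text \<open>The growth class of Fourier multipliers such as derivatives and the Laplacian;
  multiplication by them preserves decay faster than every power.\<close>

definition polyb :: "(int^3 \<Rightarrow> complex) \<Rightarrow> bool" where
  "polyb m \<longleftrightarrow> (\<exists>C p. \<forall>k. cmod (m k) \<le> C * wt k ^ p)"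

lemma polyb_const: "polyb (\<lambda>k. c)"
  unfolding polyb_def by (intro exI[of _ "cmod c"] exI[of _ 0]) auto

lemma polyb_mult:
  assumes "polyb m" "polyb n" shows "polyb (\<lambda>k. m k * n k)"
proof -
  obtain C p where m: "\<And>k. cmod (m k) \<le> C * wt k ^ p" using assms(1) polyb_def by blast
  obtain D q where n: "\<And>k. cmod (n k) \<le> D * wt k ^ q" using assms(2) polyb_def by blast
  have "cmod (m k * n k) \<le> (C * D) * wt k ^ (p + q)" for k
  proof -
    have "cmod (m k * n k) \<le> (C * wt k ^ p) * (D * wt k ^ q)"
      unfolding norm_mult by (intro mult_mono m n order_trans[OF norm_ge_zero m]) auto
    then show ?thesis by (simp add: power_add mult_ac)
  qed
  then show ?thesis unfolding polyb_def by blast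
qed

lemma polyb_add:
  assumes "polyb m" "polyb n" shows "polyb (\<lambda>k. m k + n k)"
proof -
  obtain C p where m: "\<And>k. cmod (m k) \<le> C * wt k ^ p" using assms(1) polyb_def by blast
  obtain D q where n: "\<And>k. cmod (n k) \<le> D * wt k ^ q" using assms(2) polyb_def by blast
  have "cmod (m k + n k) \<le> (\<bar>C\<bar> + \<bar>D\<bar>) * wt k ^ (p + q)" for k
  proof -
    have "C * wt k ^ p \<le> \<bar>C\<bar> * wt k ^ (p + q)" "D * wt k ^ q \<le> \<bar>D\<bar> * wt k ^ (p + q)"
      by (intro mult_mono power_increasing; use wt_ge_1[of k] in simp)+
    then show ?thesis using norm_triangle_ineq[of "m k" "n k"] m[of k] n[of k]
      by (simp add: distrib_right)
  qed
  then show ?thesis unfolding polyb_def by blast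
qed

locale torus =
  fixes L T :: real
  assumes L_pos: "0 < L" and T_pos: "0 < T"
begin

abbreviation slab :: "(real \<times> (real^3)) set" where "slab \<equiv> {0..T} \<times> UNIV"

section \<open>Frequencies and exponentials of the torus\<close>

definition xi :: "int^3 \<Rightarrow> real^3" where
  "xi k = (\<chi> i. 2 * pi / L * of_int (k $ i))"

lemma xi_add: "xi (m + n) = xi m + xi n"
  by (simp add: xi_def vec_eq_iff distrib_left)

lemma xi_uminus: "xi (- n) = - xi n"
  by (simp add: xi_def vec_eq_iff)

lemma xi_0 [simp]: "xi 0 = 0"
  by (simp add: xi_def vec_eq_iff)

lemma norm_xi_le: "norm (xi k) \<le> 2 * pi / L * wt k"
proof -
  have "norm (xi k) \<le> (\<Sum>i\<in>UNIV. \<bar>xi k $ i\<bar>)" by (rule norm_le_l1_cart)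
  also have "\<dots> = 2 * pi / L * (\<Sum>i\<in>UNIV. \<bar>of_int (k $ i)\<bar>)"
    using L_pos by (simp add: xi_def abs_mult sum_distrib_left)
  also have "\<dots> \<le> 2 * pi / L * wt k"
    using L_pos by (intro mult_left_mono) (auto simp: wt_def)
  finally show ?thesis .
qed

text \<open>A nonzero integer vector has l1 norm at least 1, so its weight is at most twice that
  norm, and the l1 norm is at most three times the Euclidean one: hence 6.\<close>

lemma norm_xi_ge:
  assumes "k \<noteq> 0"
  shows "2 * pi / L * wt k \<le> 6 * norm (xi k)"
proof -
  have "(\<Sum>i\<in>UNIV. \<bar>k $ i\<bar>) \<noteq> 0"
    using assms by (simp add: sum_nonneg_eq_0_iff vec_eq_iff)
  then have "1 \<le> (\<Sum>i\<in>UNIV. \<bar>k $ i\<bar>)"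
    using sum_nonneg[of UNIV "\<lambda>i. \<bar>k $ i\<bar>"] by linarith
  then have "1 \<le> real_of_int (\<Sum>i\<in>UNIV. \<bar>k $ i\<bar>)" by linarith
  then have "wt k \<le> 2 * (\<Sum>i\<in>UNIV. \<bar>of_int (k $ i)\<bar>)" by (simp add: wt_def)
  then have "2 * pi / L * wt k \<le> 2 * pi / L * (2 * (\<Sum>i\<in>UNIV. \<bar>of_int (k $ i)\<bar>))"
    using L_pos by (intro mult_left_mono) auto
  also have "\<dots> = 2 * (\<Sum>i\<in>UNIV. \<bar>xi k $ i\<bar>)"
    using L_pos by (simp add: xi_def abs_mult sum_distrib_left mult_ac)
  also have "\<dots> \<le> 2 * (\<Sum>i\<in>(UNIV::3 set). norm (xi k))"
    by (intro mult_left_mono sum_mono component_le_norm_cart) auto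
  finally show ?thesis by simp
qed

lemma xi_eq_0_iff: "xi k = 0 \<longleftrightarrow> k = 0"
  using L_pos by (auto simp: xi_def vec_eq_iff)

lemma polyb_xi: "polyb (\<lambda>k. of_real (xi k \<bullet> h))"
  unfolding polyb_def
proof (intro exI allI)
  fix k
  have "\<bar>xi k \<bullet> h\<bar> \<le> norm (xi k) * norm h" by (rule Cauchy_Schwarz_ineq2)
  also have "\<dots> \<le> 2 * pi / L * wt k * norm h" by (intro mult_right_mono norm_xi_le) auto
  finally show "cmod (of_real (xi k \<bullet> h)) \<le> (2 * pi / L * norm h) * wt k ^ 1"
    by (simp add: mult_ac)
qed

lemma polyb_xi_nth: "polyb (\<lambda>k. of_real (xi k $ i))"
  using polyb_xi[of "axis i 1"] by (simp add: inner_axis)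

lemma polyb_heat: "polyb (\<lambda>k. - of_real ((norm (xi k))\<^sup>2))"
proof -
  have "polyb (\<lambda>k. - 1 * (\<Sum>i\<in>UNIV. of_real (xi k $ i) * of_real (xi k $ i)))"
    unfolding sum_3 by (intro polyb_mult polyb_add polyb_xi_nth polyb_const)
  then show ?thesis
    by (simp add: power2_norm_eq_inner inner_vec_def sum_3)
qed

definition mode :: "int^3 \<Rightarrow> real^3 \<Rightarrow> complex" where
  "mode k x = cis (xi k \<bullet> x)"

lemma norm_mode [simp]: "cmod (mode k x) = 1"
  by (simp add: mode_def)

lemma mode_add: "mode (m + n) x = mode m x * mode n x"
  by (simp add: mode_def xi_add inner_add_left cis_mult)

lemma mode_uminus: "mode (- k) x = cnj (mode k x)"
  by (simp add: mode_def xi_uminus cis_cnj)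

lemma mode_0 [simp]: "mode 0 x = 1"
  by (simp add: mode_def)

lemma mode_has_derivative:
  "(mode k has_derivative (\<lambda>h. \<i> * of_real (xi k \<bullet> h) * mode k x)) (at x within S)"
  unfolding mode_def by (rule has_derivative_cis) (auto intro!: derivative_eq_intros)

text \<open>The bound is uniform in time, which is what allows the Fourier series to be
  differentiated jointly in time and space.\<close>

definition rapid :: "fam \<Rightarrow> bool" where
  "rapid a \<longleftrightarrow> (\<forall>N. \<exists>C. \<forall>k. \<forall>t\<in>{0..T}. cmod (a k t) \<le> C / wt k ^ N)"

lemma rapidE:
  assumes "rapid a"
  obtains C where "C \<ge> 0" "\<And>k t. t \<in> {0..T} \<Longrightarrow> cmod (a k t) \<le> C / wt k ^ N"
proof -
  obtain C where C: "\<And>k t. t \<in> {0..T} \<Longrightarrow> cmod (a k t) \<le> C / wt k ^ N"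
    using assms rapid_def by blast
  have "0 \<le> C" by (rule bound_nonneg[OF C[of 0 0]]) (use T_pos in simp)
  then show thesis using that C by blast
qed

text \<open>Finitely many constants are replaced by their sum, so that one bound serves all velocity
  components at once.\<close>

lemma rapid_familyE:
  fixes a :: "'i::finite \<Rightarrow> fam"
  assumes "\<And>j. rapid (a j)"
  obtains C where "C \<ge> 0" "\<And>j k t. t \<in> {0..T} \<Longrightarrow> cmod (a j k t) \<le> C / wt k ^ N"
proof -
  have "\<forall>j. \<exists>C\<ge>0. \<forall>k. \<forall>t\<in>{0..T}. cmod (a j k t) \<le> C / wt k ^ N"
    using rapidE[OF assms] by metis
  from choice[OF this] obtain C where C: "\<forall>j. C j \<ge> 0 \<and> (\<forall>k. \<forall>t\<in>{0..T}. cmod (a j k t) \<le> C j / wt k ^ N)" ..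
  have "cmod (a j k t) \<le> (\<Sum>j\<in>UNIV. C j) / wt k ^ N" if "t \<in> {0..T}" for j k t
  proof -
    have "C j \<le> (\<Sum>j\<in>UNIV. C j)" using C by (intro member_le_sum) auto
    then have "C j / wt k ^ N \<le> (\<Sum>j\<in>UNIV. C j) / wt k ^ N"
      using wt_pos[of k] by (intro divide_right_mono) auto
    then show ?thesis using C that order_trans by blast
  qed
  then show thesis using C by (intro that[of "\<Sum>j\<in>UNIV. C j"]) (auto intro: sum_nonneg)
qed

lemma rapid_cong:
  assumes "\<And>k t. t \<in> {0..T} \<Longrightarrow> a k t = b k t"
  shows "rapid a \<longleftrightarrow> rapid b"
  unfolding rapid_def using assms by simp

lemma rapid_add:
  assumes "rapid a" "rapid b" shows "rapid (\<lambda>k t. a k t + b k t)"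
  unfolding rapid_def
proof
  fix N
  obtain C where C: "\<And>k t. t \<in> {0..T} \<Longrightarrow> cmod (a k t) \<le> C / wt k ^ N" using rapidE[OF assms(1)] by blast
  obtain D where D: "\<And>k t. t \<in> {0..T} \<Longrightarrow> cmod (b k t) \<le> D / wt k ^ N" using rapidE[OF assms(2)] by blast
  have "cmod (a k t + b k t) \<le> (C + D) / wt k ^ N" if "t \<in> {0..T}" for k t
    using norm_triangle_ineq[of "a k t" "b k t"] C[OF that, of k] D[OF that, of k]
    by (simp add: add_divide_distrib)
  then show "\<exists>C. \<forall>k. \<forall>t\<in>{0..T}. cmod (a k t + b k t) \<le> C / wt k ^ N" by blast
qed

lemma rapid_mult:
  assumes "polyb m" "rapid a" shows "rapid (\<lambda>k t. m k * a k t)"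
  unfolding rapid_def
proof
  fix N
  obtain D p where m: "\<And>k. cmod (m k) \<le> D * wt k ^ p" using assms(1) polyb_def by blast
  obtain C where C: "\<And>k t. t \<in> {0..T} \<Longrightarrow> cmod (a k t) \<le> C / wt k ^ (N + p)"
    using rapidE[OF assms(2)] by blast
  have "cmod (m k * a k t) \<le> (D * C) / wt k ^ N" if "t \<in> {0..T}" for k t
  proof -
    have "cmod (m k * a k t) \<le> (D * wt k ^ p) * (C / wt k ^ (N + p))"
      unfolding norm_mult by (intro mult_mono m C that order_trans[OF norm_ge_zero m]) auto
    then show ?thesis using wt_pos[of k] by (simp add: power_add)
  qed
  then show "\<exists>C. \<forall>k. \<forall>t\<in>{0..T}. cmod (m k * a k t) \<le> C / wt k ^ N" by blast
qed

lemma rapid_le: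
  assumes "rapid a" "\<And>k t. t \<in> {0..T} \<Longrightarrow> cmod (b k t) \<le> c * cmod (a k t)" "0 \<le> c"
  shows "rapid b"
  unfolding rapid_def
proof
  fix N
  obtain C where C: "\<And>k t. t \<in> {0..T} \<Longrightarrow> cmod (a k t) \<le> C / wt k ^ N" using rapidE[OF assms(1)] by blast
  have "cmod (b k t) \<le> (c * C) / wt k ^ N" if "t \<in> {0..T}" for k t
    using assms(2)[OF that, of k] mult_left_mono[OF C[OF that, of k] assms(3)] by simp
  then show "\<exists>C. \<forall>k. \<forall>t\<in>{0..T}. cmod (b k t) \<le> C / wt k ^ N" by blast
qed

lemma rapid_conv:
  assumes "rapid a" "rapid b" shows "rapid (\<lambda>k t. conv (\<lambda>m. a m t) (\<lambda>m. b m t) k)"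
  unfolding rapid_def
proof
  fix N
  obtain C where C: "C \<ge> 0" "\<And>k t. t \<in> {0..T} \<Longrightarrow> cmod (a k t) \<le> C / wt k ^ (N + 6)" using rapidE[OF assms(1)] by blast
  obtain D where D: "D \<ge> 0" "\<And>k t. t \<in> {0..T} \<Longrightarrow> cmod (b k t) \<le> D / wt k ^ (N + 6)" using rapidE[OF assms(2)] by blast
  have "cmod (conv (\<lambda>m. a m t) (\<lambda>m. b m t) k) \<le> (conv_const (N + 6) * C * D) / wt k ^ N"
    if "t \<in> {0..T}" for k t
  proof -
    have "cmod (conv (\<lambda>m. a m t) (\<lambda>m. b m t) k) \<le> conv_const (N + 6) * C * D / wt k ^ (N + 6)"
      by (rule conv_bound) (use C D that in auto)
    also have "\<dots> \<le> (conv_const (N + 6) * C * D) / wt k ^ N"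
      by (intro divide_left_mono mult_nonneg_nonneg conv_const_nonneg C D power_increasing)
        (use wt_ge_1[of k] in auto)
    finally show ?thesis .
  qed
  then show "\<exists>C. \<forall>k. \<forall>t\<in>{0..T}. cmod (conv (\<lambda>m. a m t) (\<lambda>m. b m t) k) \<le> C / wt k ^ N" by blast
qed

lemma rapid_summable:
  assumes "rapid a" "t \<in> {0..T}"
  shows "(\<lambda>k. cmod (a k t)) summable_on UNIV" "(\<lambda>k. a k t * mode k x) summable_on UNIV"
    "(\<lambda>k. cmod (a k t * mode k x)) summable_on UNIV" "(\<lambda>k. a k t) summable_on UNIV"
proof -
  obtain C where C: "\<And>k t. t \<in> {0..T} \<Longrightarrow> cmod (a k t) \<le> C / wt k ^ 6" using rapidE[OF assms(1)] by blast
  have s: "(\<lambda>k. C / wt k ^ 6) summable_on UNIV"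
    using summable_on_cmult_right[OF summable_wt, of C] by simp
  have *: "cmod (a k t) \<le> C / wt k ^ 6" "cmod (a k t * mode k x) \<le> C / wt k ^ 6" for k
    using C[OF assms(2)] by (auto simp: norm_mult)
  show "(\<lambda>k. cmod (a k t)) summable_on UNIV" "(\<lambda>k. a k t) summable_on UNIV"
    by (rule norm_summable_imp_summable[OF *(1) s])+
  show "(\<lambda>k. a k t * mode k x) summable_on UNIV" "(\<lambda>k. cmod (a k t * mode k x)) summable_on UNIV"
    by (rule norm_summable_imp_summable[OF *(2) s])+
qed

lemma rapid_conv_summable:
  assumes "rapid a" "rapid b" "t \<in> {0..T}"
  shows "(\<lambda>m. a m t * b (k - m) t) summable_on UNIV"
proof -
  obtain C where C: "\<And>k t. t \<in> {0..T} \<Longrightarrow> cmod (a k t) \<le> C / wt k ^ 6" using rapidE[OF assms(1)] by blast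
  obtain D where D: "\<And>k t. t \<in> {0..T} \<Longrightarrow> cmod (b k t) \<le> D / wt k ^ 6" using rapidE[OF assms(2)] by blast
  show ?thesis by (rule conv_bound(3)[of 6]) (use C D assms in auto)
qed

section \<open>Time regularity of coefficient families\<close>

definition td :: "fam \<Rightarrow> fam" where
  "td a k t = vector_derivative (a k) (at t within {0..T})"

text \<open>Derivatives in space only multiply the coefficients by components of \<open>xi\<close>,
  which rapid decay absorbs; so only the derivatives in time are counted, each of them again being
  required to decay rapidly.\<close>

fun reg :: "nat \<Rightarrow> fam \<Rightarrow> bool" where
  "reg 0 a \<longleftrightarrow> rapid a \<and> (\<forall>k. continuous_on {0..T} (a k))"
| "reg (Suc j) a \<longleftrightarrow> rapid a \<and>
     (\<forall>k. \<forall>t\<in>{0..T}. (a k has_vector_derivative td a k t) (at t within {0..T})) \<and> reg j (td a)"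

definition sreg :: "fam \<Rightarrow> bool" where "sreg a \<longleftrightarrow> (\<forall>j. reg j a)"

lemma reg_rapid: "reg j a \<Longrightarrow> rapid a"
  by (cases j) auto

lemma reg_continuous: "reg j a \<Longrightarrow> continuous_on {0..T} (a k)"
  by (cases j) (auto intro: continuous_on_vector_derivative)

lemma reg_Suc_imp: "reg (Suc j) a \<Longrightarrow> reg j a"
proof (induction j arbitrary: a)
  case 0
  then show ?case using reg_rapid reg_continuous by (metis reg.simps(1))
next
  case (Suc j)
  then have "reg j (td a)" by simp
  with Suc show ?case by simp
qed

lemma td_eq:
  assumes "(a k has_vector_derivative d) (at t within {0..T})" "t \<in> {0..T}"
  shows "td a k t = d"
  unfolding td_def using vector_derivative_within_closed_interval[OF T_pos assms(2,1)] .

lemma reg_cong: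
  assumes "\<And>k t. t \<in> {0..T} \<Longrightarrow> a k t = b k t"
  shows "reg j a \<longleftrightarrow> reg j b"
  using assms
proof (induction j arbitrary: a b)
  case 0
  then have "continuous_on {0..T} (a k) = continuous_on {0..T} (b k)" for k
    by (intro continuous_on_cong) auto
  then show ?case using rapid_cong[of a b] 0 by simp
next
  case (Suc j)
  have *: "(a k has_vector_derivative d) (at t within {0..T}) \<longleftrightarrow> (b k has_vector_derivative d) (at t within {0..T})"
    if "t \<in> {0..T}" for k t d
  proof
    assume "(a k has_vector_derivative d) (at t within {0..T})"
    then show "(b k has_vector_derivative d) (at t within {0..T})"
      by (rule has_vector_derivative_transform[OF that, rotated]) (simp add: Suc.prems)
  next
    assume "(b k has_vector_derivative d) (at t within {0..T})"
    then show "(a k has_vector_derivative d) (at t within {0..T})"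
      by (rule has_vector_derivative_transform[OF that, rotated]) (simp add: Suc.prems)
  qed
  have td: "td a k t = td b k t" if "t \<in> {0..T}" for k t
    unfolding td_def vector_derivative_def using *[OF that] by simp
  have "reg j (td a) = reg j (td b)" by (rule Suc.IH) (rule td)
  moreover have "rapid a = rapid b" by (rule rapid_cong) (rule Suc.prems)
  ultimately show ?case using * td by simp
qed

lemma reg_SucI:
  assumes "rapid a" "reg j a'"
    and d: "\<And>k t. t \<in> {0..T} \<Longrightarrow> (a k has_vector_derivative a' k t) (at t within {0..T})"
  shows "reg (Suc j) a"
proof -
  have td: "td a k t = a' k t" if "t \<in> {0..T}" for k t
    using td_eq[of a k, OF d[OF that] that] .
  have "reg j (td a)" using reg_cong[of "td a" a' j] td assms(2) by blast
  then show ?thesis using assms(1) d td by simp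
qed

lemma reg_add: "reg j a \<Longrightarrow> reg j b \<Longrightarrow> reg j (\<lambda>k t. a k t + b k t)"
proof (induction j arbitrary: a b)
  case 0
  then show ?case by (auto intro: rapid_add continuous_on_add)
next
  case (Suc j)
  show ?case
    by (rule reg_SucI[where a' = "\<lambda>k t. td a k t + td b k t"])
      (use Suc in \<open>auto intro: rapid_add has_vector_derivative_add\<close>)
qed

lemma reg_mult: "polyb m \<Longrightarrow> reg j a \<Longrightarrow> reg j (\<lambda>k t. m k * a k t)"
proof (induction j arbitrary: a)
  case 0
  then show ?case by (auto intro: rapid_mult continuous_on_mult_left)
next
  case (Suc j)
  show ?case
    by (rule reg_SucI[where a' = "\<lambda>k t. m k * td a k t"])
      (use Suc in \<open>auto intro: rapid_mult has_vector_derivative_mult_right\<close>)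
qed

lemma reg_0: "reg j (\<lambda>k t. 0)"
proof (induction j)
  case 0
  show ?case by (auto simp: rapid_def intro: exI[of _ 0])
next
  case (Suc j)
  show ?case by (rule reg_SucI[where a' = "\<lambda>k t. 0"]) (use Suc reg_rapid in auto)
qed

lemma reg_sum: "(\<And>i. i \<in> I \<Longrightarrow> reg j (a i)) \<Longrightarrow> reg j (\<lambda>k t. \<Sum>i\<in>I. a i k t)"
  by (induction I rule: infinite_finite_induct) (auto intro: reg_0 reg_add)

text \<open>Prepares \<open>sreg_phase\<close>, where differentiating the quadratic phase brings
  down a factor t.\<close>

lemma reg_time: "reg j a \<Longrightarrow> reg j (\<lambda>k t. of_real t * a k t)"
proof (induction j arbitrary: a)
  case 0
  have "rapid (\<lambda>k t. of_real t * a k t)"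
    by (rule rapid_le[where c = T and a = a])
      (use 0 T_pos in \<open>auto simp: norm_mult intro!: mult_right_mono\<close>)
  with 0 show ?case by (auto intro!: continuous_intros)
next
  case (Suc j)
  have r: "rapid (\<lambda>k t. of_real t * a k t)"
    by (rule rapid_le[where c = T and a = a])
      (use Suc T_pos in \<open>auto simp: norm_mult intro!: mult_right_mono\<close>)
  show ?case
  proof (rule reg_SucI[OF r])
    show "reg j (\<lambda>k t. of_real t * td a k t + 1 * a k t)"
      using Suc.IH[of "td a"] Suc.prems reg_Suc_imp[OF Suc.prems] by (intro reg_add) auto
    show "((\<lambda>t. of_real t * a k t) has_vector_derivative of_real t * td a k t + 1 * a k t) (at t within {0..T})"
      if "t \<in> {0..T}" for k t
      using Suc.prems that by (intro has_vector_derivative_mult)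
        (auto intro!: derivative_eq_intros)
  qed
qed

lemma reg_conv: "reg j a \<Longrightarrow> reg j b \<Longrightarrow> reg j (\<lambda>k t. conv (\<lambda>m. a m t) (\<lambda>m. b m t) k)"
proof (induction j arbitrary: a b)
  case 0
  have "continuous_on {0..T} (\<lambda>t. conv (\<lambda>m. a m t) (\<lambda>m. b m t) k)" for k
  proof -
    obtain C where C: "\<And>k t. t \<in> {0..T} \<Longrightarrow> cmod (a k t) \<le> C / wt k ^ 6" using rapidE 0 by (metis reg.simps(1))
    obtain D where D: "\<And>k t. t \<in> {0..T} \<Longrightarrow> cmod (b k t) \<le> D / wt k ^ 6" using rapidE 0 by (metis reg.simps(1))
    show ?thesis by (rule continuous_on_conv) (use 0 C D in auto)
  qed
  then show ?case using 0 by (auto intro: rapid_conv)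
next
  case (Suc j)
  show ?case
  proof (rule reg_SucI)
    show "rapid (\<lambda>k t. conv (\<lambda>m. a m t) (\<lambda>m. b m t) k)"
      using Suc.prems reg_rapid by (blast intro: rapid_conv)
    let ?d = "\<lambda>k t. conv (\<lambda>m. a m t) (\<lambda>m. td b m t) k + conv (\<lambda>m. td a m t) (\<lambda>m. b m t) k"
    show "reg j ?d"
      by (intro reg_add Suc.IH reg_Suc_imp[OF Suc.prems(1)] reg_Suc_imp[OF Suc.prems(2)])
        (use Suc.prems in simp_all)
    have r: "rapid a" "rapid b" "rapid (td a)" "rapid (td b)"
      using Suc.prems reg_rapid[of j] by auto
    obtain A where A: "A \<ge> 0" "\<And>k t. t \<in> {0..T} \<Longrightarrow> cmod (a k t) \<le> A / wt k ^ 6" using rapidE[OF r(1)] by blast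
    obtain B where B: "B \<ge> 0" "\<And>k t. t \<in> {0..T} \<Longrightarrow> cmod (b k t) \<le> B / wt k ^ 6" using rapidE[OF r(2)] by blast
    obtain A' where A': "A' \<ge> 0" "\<And>k t. t \<in> {0..T} \<Longrightarrow> cmod (td a k t) \<le> A' / wt k ^ 6" using rapidE[OF r(3)] by blast
    obtain B' where B': "B' \<ge> 0" "\<And>k t. t \<in> {0..T} \<Longrightarrow> cmod (td b k t) \<le> B' / wt k ^ 6" using rapidE[OF r(4)] by blast
    fix k t assume t: "t \<in> {0..T}"
    define w where "w m = 2 ^ 6 / wt k ^ 6 * (1 / wt m ^ 6 + 1 / wt (k - m) ^ 6)" for m
    have w: "w m \<ge> 0" for m using wt_pos[of m] wt_pos[of k] wt_pos[of "k - m"] by (simp add: w_def)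
    \<comment> \<open>\<open>has_derivative_infsum\<close> wants one bound for a term and for its
      derivative: the first summand bounds the product itself, the other two bound its Leibniz
      terms.\<close>
    define Bd where "Bd m = A * B * w m + A * B' * w m + A' * B * w m" for m
    have ws: "(\<lambda>m. c * d * w m) summable_on UNIV" for c d
      unfolding w_def
      by (intro summable_on_cmult_right summable_on_add summable_wt summable_wt_shift)
    have bd: "cmod (a m s * b (k - m) s) \<le> A * B * w m" "cmod (a m s * td b (k - m) s) \<le> A * B' * w m"
      "cmod (td a m s * b (k - m) s) \<le> A' * B * w m" if "s \<in> {0..T}" for m s
      unfolding w_def
      by (rule conv_bound(1)[of 6 "\<lambda>m. a m s" A "\<lambda>m. b m s" B]; use A B that in auto)
        (rule conv_bound(1)[of 6 "\<lambda>m. a m s" A "\<lambda>m. td b m s" B'] 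
           conv_bound(1)[of 6 "\<lambda>m. td a m s" A' "\<lambda>m. b m s" B]; use A B A' B' that in auto)+
    have "((\<lambda>t. \<Sum>\<^sub>\<infinity>m. a m t * b (k - m) t) has_derivative
        (\<lambda>h. \<Sum>\<^sub>\<infinity>m. h *\<^sub>R (a m t * td b (k - m) t + td a m t * b (k - m) t))) (at t within {0..T})"
    proof (rule has_derivative_infsum[OF infinite_int3 _ t, where B = Bd])
      show "Bd summable_on UNIV" unfolding Bd_def by (intro summable_on_add ws)
      show "((\<lambda>t. a m t * b (k - m) t) has_derivative
          (\<lambda>h. h *\<^sub>R (a m s * td b (k - m) s + td a m s * b (k - m) s))) (at s within {0..T})"
        if "s \<in> {0..T}" for m s
        unfolding has_vector_derivative_def[symmetric]
        using Suc.prems that by (intro has_vector_derivative_mult) auto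
      show "cmod (a m s * b (k - m) s) \<le> Bd m" if "s \<in> {0..T}" for m s
        using bd(1)[OF that, of m] A B A' B' w[of m] by (simp add: Bd_def add_increasing2)
      show "cmod (h *\<^sub>R (a m s * td b (k - m) s + td a m s * b (k - m) s)) \<le> Bd m * norm h"
        if "s \<in> {0..T}" for m s h
      proof -
        have "cmod (a m s * td b (k - m) s + td a m s * b (k - m) s) \<le> A * B' * w m + A' * B * w m"
          by (rule order_trans[OF norm_triangle_ineq add_mono[OF bd(2,3)[OF that, of m]]])
        also have "\<dots> \<le> Bd m" using A B w[of m] by (simp add: Bd_def)
        finally show ?thesis using mult_left_mono[of _ _ "\<bar>h\<bar>"] by (simp add: mult.commute[of _ "\<bar>h\<bar>"])
      qed
    qed auto
    moreover have "(\<Sum>\<^sub>\<infinity>m. h *\<^sub>R (a m t * td b (k - m) t + td a m t * b (k - m) t)) = h *\<^sub>R ?d k t" for h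
      unfolding infsum_scaleR_right conv_def
      by (subst infsum_add[symmetric]) (use r t rapid_conv_summable in auto)
    ultimately show "((\<lambda>t. conv (\<lambda>m. a m t) (\<lambda>m. b m t) k) has_vector_derivative ?d k t) (at t within {0..T})"
      unfolding has_vector_derivative_def conv_def[of "\<lambda>m. a m _"] by simp
  qed
qed

subsection \<open>Fourier series\<close>

definition synth :: "fam \<Rightarrow> real \<times> (real^3) \<Rightarrow> complex" where
  "synth a z = (\<Sum>\<^sub>\<infinity>k. a k (fst z) * mode k (snd z))"

text \<open>The coefficients of the derivative of \<open>synth a\<close> in the spacetime direction
  v, as \<open>synth_has_derivative\<close> shows.\<close>

definition dfam :: "fam \<Rightarrow> real \<times> (real^3) \<Rightarrow> fam" where
  "dfam a v k t = of_real (fst v) * td a k t + \<i> * of_real (xi k \<bullet> snd v) * a k t"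

lemma synth_has_derivative:
  assumes a: "reg (Suc 0) a" and z: "z \<in> slab"
  shows "(synth a has_derivative (\<lambda>v. synth (dfam a v) z)) (at z within slab)"
proof -
  \<comment> \<open>One power more than the summable 6: it pays for the factor \<open>xi k\<close>
    produced by differentiating the mode in space. The time derivative has no such factor, hence the
    6 for \<open>td a\<close>.\<close>
  obtain C where C: "C \<ge> 0" "\<And>k t. t \<in> {0..T} \<Longrightarrow> cmod (a k t) \<le> C / wt k ^ 7"
    using rapidE[OF reg_rapid[OF a]] by blast
  obtain D where D: "D \<ge> 0" "\<And>k t. t \<in> {0..T} \<Longrightarrow> cmod (td a k t) \<le> D / wt k ^ 6"
    using rapidE[of "td a"] reg_rapid a by (metis reg.simps(2))
  have C6: "cmod (a k t) \<le> C / wt k ^ 6" if "t \<in> {0..T}" for k t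
  proof -
    have "C / wt k ^ 7 \<le> C / wt k ^ 6"
      using wt_ge_1[of k] C(1) by (intro divide_left_mono power_increasing) auto
    then show ?thesis using C(2)[OF that, of k] by linarith
  qed
  define B where "B k = (C + D + 2 * pi / L * C) / wt k ^ 6" for k
  have B: "B summable_on UNIV"
    unfolding B_def using summable_on_cmult_right[OF summable_wt, of "C + D + 2 * pi / L * C"] by simp
  have "((\<lambda>z. \<Sum>\<^sub>\<infinity>k. a k (fst z) * mode k (snd z)) has_derivative
      (\<lambda>v. \<Sum>\<^sub>\<infinity>k. dfam a v k (fst z) * mode k (snd z))) (at z within slab)"
  proof (rule has_derivative_infsum[OF infinite_int3 _ z _ _ _ B])
    show "convex slab" by (intro convex_Times) auto
    fix k and z :: "real \<times> (real^3)" assume z: "z \<in> slab"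
    then have t: "fst z \<in> {0..T}" by auto
    have "((\<lambda>z. a k (fst z)) has_derivative (\<lambda>v. fst v *\<^sub>R td a k (fst z))) (at z within slab)"
    proof (rule has_derivative_in_compose2[where t = "{0..T}" and g = "a k" and g' = "\<lambda>t h. h *\<^sub>R td a k t"])
      show "(a k has_derivative (\<lambda>h. h *\<^sub>R td a k t)) (at t within {0..T})" if "t \<in> {0..T}" for t
        using a that by (simp add: has_vector_derivative_def)
    qed (use z in \<open>auto intro!: derivative_eq_intros\<close>)
    moreover have "((\<lambda>z. mode k (snd z)) has_derivative
        (\<lambda>v. \<i> * of_real (xi k \<bullet> snd v) * mode k (snd z))) (at z within slab)"
      by (rule has_derivative_compose[OF _ mode_has_derivative]) (auto intro!: derivative_eq_intros)
    ultimately have "((\<lambda>z. a k (fst z) * mode k (snd z)) has_derivative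
        (\<lambda>v. a k (fst z) * (\<i> * of_real (xi k \<bullet> snd v) * mode k (snd z))
            + fst v *\<^sub>R td a k (fst z) * mode k (snd z))) (at z within slab)"
      by (rule has_derivative_mult)
    then show "((\<lambda>z. a k (fst z) * mode k (snd z)) has_derivative
        (\<lambda>v. dfam a v k (fst z) * mode k (snd z))) (at z within slab)"
      by (rule has_derivative_eq_rhs) (simp add: fun_eq_iff dfam_def algebra_simps scaleR_conv_of_real)
    show "cmod (a k (fst z) * mode k (snd z)) \<le> B k"
    proof -
      have "C / wt k ^ 6 \<le> B k" unfolding B_def
        using C(1) D(1) L_pos wt_pos[of k] by (intro divide_right_mono) auto
      then show ?thesis using C6[OF t, of k] by (simp add: norm_mult)
    qed
    show "cmod (dfam a v k (fst z) * mode k (snd z)) \<le> B k * norm v" for v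
    proof -
      have "cmod (dfam a v k (fst z)) \<le> \<bar>fst v\<bar> * (D / wt k ^ 6) + \<bar>xi k \<bullet> snd v\<bar> * (C / wt k ^ 7)"
        unfolding dfam_def
        by (rule order_trans[OF norm_triangle_ineq])
          (simp only: norm_mult norm_of_real norm_ii mult_1, intro add_mono mult_left_mono C(2)[OF t] D(2)[OF t], auto)
      also have "\<dots> \<le> norm v * (D / wt k ^ 6) + (2 * pi / L * wt k * norm v) * (C / wt k ^ 7)"
      proof -
        have "\<bar>xi k \<bullet> snd v\<bar> \<le> norm (xi k) * norm (snd v)" by (rule Cauchy_Schwarz_ineq2)
        also have "\<dots> \<le> (2 * pi / L * wt k) * norm v"
          using norm_snd_le[of "snd v" "fst v"] L_pos wt_pos[of k] by (intro mult_mono norm_xi_le) auto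
        finally show ?thesis
          using norm_fst_le[of "fst v" "snd v"] C(1) D(1) wt_pos[of k]
          by (intro add_mono mult_right_mono) auto
      qed
      also have "\<dots> = (D + 2 * pi / L * C) / wt k ^ 6 * norm v"
        using wt_pos[of k] by (simp add: field_simps power_Suc eval_nat_numeral)
      also have "\<dots> \<le> B k * norm v"
        unfolding B_def using C(1) wt_pos[of k] by (intro mult_right_mono divide_right_mono) auto
      finally show ?thesis by (simp add: norm_mult)
    qed
  qed
  then show ?thesis unfolding synth_def[abs_def] .
qed

lemma sreg_dfam: "sreg a \<Longrightarrow> sreg (dfam a v)"
  unfolding sreg_def dfam_def[abs_def]
proof
  fix j assume a: "\<forall>j. reg j a"
  then have "reg j (td a)" using reg.simps(2)[of j a] by blast
  with a show "reg j (\<lambda>k t. of_real (fst v) * td a k t + \<i> * of_real (xi k \<bullet> snd v) * a k t)"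
    by (intro reg_add reg_mult polyb_const polyb_mult polyb_xi) auto
qed

text \<open>By \<open>synth_has_derivative\<close> and \<open>sreg_dfam\<close> the series of
  \<open>sreg\<close> families are closed under directional derivatives, so coinduction
  applies.\<close>

lemma synth_smooth:
  assumes "sreg a" shows "smooth_on (synth a) slab"
proof (rule smooth_on_coinduct[where P = "\<lambda>g. \<exists>a. sreg a \<and> g = synth a"])
  show "thick slab" by (rule thick_slab[OF T_pos])
  show "\<exists>b. sreg b \<and> synth a = synth b" using assms by blast
  fix g assume "\<exists>a. sreg a \<and> g = synth a"
  then obtain a where a: "sreg a" "g = synth a" by blast
  show "\<exists>f'. (\<forall>x\<in>slab. (g has_derivative f' x) (at x within slab))
      \<and> (\<forall>v. \<exists>a. sreg a \<and> (\<lambda>x. f' x v) = synth a)"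
  proof (intro exI[of _ "\<lambda>z v. synth (dfam a v) z"] conjI ballI allI)
    show "(g has_derivative (\<lambda>v. synth (dfam a v) x)) (at x within slab)" if "x \<in> slab" for x
      unfolding a(2) by (rule synth_has_derivative[OF _ that]) (use a(1) sreg_def in blast)
    show "\<exists>b. sreg b \<and> synth (dfam a v) = synth b" for v
      using sreg_dfam[OF a(1)] by blast
  qed
qed

text \<open>Mode k is the product of the modes m and k - m, so the series of a convolution is a
  Cauchy product of two absolutely convergent series.\<close>

lemma synth_conv:
  assumes "rapid a" "rapid b" "fst z \<in> {0..T}"
  shows "synth (\<lambda>k t. conv (\<lambda>m. a m t) (\<lambda>m. b m t) k) z = synth a z * synth b z"
proof -
  let ?a = "\<lambda>m. a m (fst z) * mode m (snd z)" and ?b = "\<lambda>m. b m (fst z) * mode m (snd z)"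
  have "conv ?a ?b k = conv (\<lambda>m. a m (fst z)) (\<lambda>m. b m (fst z)) k * mode k (snd z)" for k
  proof -
    have "?a m * ?b (k - m) = a m (fst z) * b (k - m) (fst z) * mode k (snd z)" for m
    proof -
      have "mode k (snd z) = mode m (snd z) * mode (k - m) (snd z)"
        using mode_add[of m "k - m" "snd z"] by simp
      then show ?thesis by simp
    qed
    then have "conv ?a ?b k = (\<Sum>\<^sub>\<infinity>m. a m (fst z) * b (k - m) (fst z) * mode k (snd z))"
      unfolding conv_def by (intro infsum_cong)
    then show ?thesis by (simp add: conv_def infsum_cmult_left')
  qed
  then have "synth (\<lambda>k t. conv (\<lambda>m. a m t) (\<lambda>m. b m t) k) z = (\<Sum>\<^sub>\<infinity>k. conv ?a ?b k)"
    by (simp add: synth_def)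
  also have "\<dots> = (\<Sum>\<^sub>\<infinity>m. ?a m) * (\<Sum>\<^sub>\<infinity>m. ?b m)"
    by (rule infsum_conv[OF rapid_summable(3)[OF assms(1,3)] rapid_summable(3)[OF assms(2,3)]])
  finally show ?thesis by (simp add: synth_def)
qed

lemma synth_add:
  assumes "rapid a" "rapid b" "fst z \<in> {0..T}"
  shows "synth (\<lambda>k t. a k t + b k t) z = synth a z + synth b z"
  unfolding synth_def using infsum_add[OF rapid_summable(2)[OF assms(1,3)] rapid_summable(2)[OF assms(2,3)]]
  by (simp add: distrib_right)

lemma synth_cmult: "synth (\<lambda>k t. c * a k t) z = c * synth a z"
  unfolding synth_def by (simp add: mult.assoc infsum_cmult_right')

text \<open>Reindexing by k to - k turns the series into its own complex conjugate.\<close>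

lemma synth_real:
  assumes "\<And>k. a (- k) (fst z) = cnj (a k (fst z))"
  shows "synth a z \<in> \<real>"
proof -
  have bij: "bij_betw uminus UNIV (UNIV :: (int^3) set)"
    by (rule bij_betw_byWitness[where f' = uminus]) auto
  have "synth a z = (\<Sum>\<^sub>\<infinity>k. a (- k) (fst z) * mode (- k) (snd z))"
    unfolding synth_def by (rule infsum_reindex_bij_betw[OF bij, symmetric])
  also have "\<dots> = cnj (synth a z)"
    unfolding synth_def by (simp add: assms mode_uminus flip: infsum_cnj)
  finally show ?thesis by (metis Reals_cnj_iff)
qed

subsection \<open>Fourier series in one variable\<close>

definition wave :: "int \<Rightarrow> real \<Rightarrow> complex" where
  "wave n s = cis (2 * pi / L * of_int n * s)"

lemma wave_0 [simp]: "wave 0 s = 1" "wave n 0 = 1"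
  by (simp_all add: wave_def)

lemma norm_wave [simp]: "cmod (wave n s) = 1"
  by (simp add: wave_def)

lemma wave_add: "wave (m + n) s = wave m s * wave n s"
  by (simp add: wave_def cis_mult distrib_left distrib_right)

lemma cnj_wave: "cnj (wave n s) = wave (- n) s"
  by (simp add: wave_def cis_cnj)

lemma wave_shift: "wave n (s + L * of_int m) = wave n s"
proof -
  have "2 * pi / L * of_int n * (s + L * of_int m) = 2 * pi / L * of_int n * s + 2 * pi * of_int (n * m)"
    using L_pos by (simp add: field_simps)
  then have "wave n (s + L * of_int m) = cis (2 * pi / L * of_int n * s) * cis (2 * pi * of_int (n * m))"
    by (simp only: wave_def cis_mult)
  also have "cis (2 * pi * of_int (n * m)) = 1" by (rule cis_multiple_2pi) simp
  finally show ?thesis by (simp add: wave_def)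
qed

lemma wave_deriv: "(wave n has_vector_derivative \<i> * of_real (2 * pi / L * of_int n) * wave n s) (at s within S)"
  unfolding wave_def[abs_def] by (rule has_vector_derivative_cis) (use L_pos in \<open>auto intro!: derivative_eq_intros\<close>)

lemma continuous_wave: "continuous_on S (wave n)"
  by (rule continuous_on_vector_derivative[OF wave_deriv])

lemma wave_has_integral: "(wave n has_integral (if n = 0 then of_real L else 0)) {0..L}"
proof (cases "n = 0")
  case True
  have "wave 0 = (\<lambda>s. 1)" by auto
  then show ?thesis using True has_integral_const_real[of "1::complex" 0 L] L_pos by (simp add: scaleR_conv_of_real)
next
  case False
  define c where "c = \<i> * complex_of_real (2 * pi / L * of_int n)"
  have c: "c \<noteq> 0" using False L_pos by (simp add: c_def)
  have "((\<lambda>s. c * wave n s / c) has_integral (wave n L / c - wave n 0 / c)) {0..L}"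
    using L_pos unfolding c_def
    by (intro fundamental_theorem_of_calculus has_vector_derivative_divide wave_deriv) auto
  moreover have "wave n L = 1" using wave_shift[of n 0 1] by simp
  ultimately show ?thesis using c False by simp
qed

definition fc :: "int \<Rightarrow> (real \<Rightarrow> complex) \<Rightarrow> complex" where
  "fc n f = integral {0..L} (\<lambda>s. wave (- n) s * f s) / of_real L"

lemma fc_has_integral:
  assumes "continuous_on {0..L} f"
  shows "((\<lambda>s. wave (- n) s * f s) has_integral of_real L * fc n f) {0..L}"
proof -
  have "(\<lambda>s. wave (- n) s * f s) integrable_on {0..L}"
    by (intro integrable_continuous_real continuous_on_mult continuous_wave assms)
  then show ?thesis using L_pos by (simp add: fc_def integrable_integral)
qed

text \<open>Expand the nonnegative integral of |f - p|^2, where p is the partial sum over F.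
  Orthogonality of the waves collapses the double sum to its diagonal, so the two mixed terms and
  this one combine to minus L times the sum of the squared coefficients.\<close>

lemma bessel:
  assumes f: "continuous_on {0..L} f" and F: "finite F"
  shows "(\<Sum>n\<in>F. (cmod (fc n f))\<^sup>2) \<le> integral {0..L} (\<lambda>s. (cmod (f s))\<^sup>2) / L"
proof -
  define c where "c n = fc n f" for n
  define J where "J = integral {0..L} (\<lambda>s. (cmod (f s))\<^sup>2)"
  define p where "p s = (\<Sum>n\<in>F. c n * wave n s)" for s
  have 1: "((\<lambda>s. wave (- n) s * f s) has_integral of_real L * c n) {0..L}" for n
    unfolding c_def by (rule fc_has_integral[OF f])
  have 2: "((\<lambda>s. wave n s * cnj (f s)) has_integral of_real L * cnj (c n)) {0..L}" for n
    using has_integral_cnj[THEN iffD2, OF 1[of n]] by (simp add: o_def cnj_wave)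
  have 3: "((\<lambda>s. of_real ((cmod (f s))\<^sup>2)) has_integral complex_of_real J) {0..L}"
    unfolding J_def
    by (intro has_integral_of_real integrable_integral integrable_continuous_real continuous_intros f)
  have eq: "of_real ((cmod (f s - p s))\<^sup>2) = of_real ((cmod (f s))\<^sup>2)
      - (\<Sum>n\<in>F. cnj (c n) * (wave (- n) s * f s)) - (\<Sum>n\<in>F. c n * (wave n s * cnj (f s)))
      + (\<Sum>n\<in>F. \<Sum>m\<in>F. c n * cnj (c m) * wave (n - m) s)" for s
  proof -
    have "of_real ((cmod (f s - p s))\<^sup>2) = (f s - p s) * cnj (f s - p s)"
      by (simp only: complex_norm_square)
    also have "\<dots> = f s * cnj (f s) - cnj (p s) * f s - p s * cnj (f s) + p s * cnj (p s)"
      by (simp add: algebra_simps)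
    also have "cnj (p s) * f s = (\<Sum>n\<in>F. cnj (c n) * (wave (- n) s * f s))"
      by (simp add: p_def sum_distrib_right cnj_wave mult.assoc)
    also have "p s * cnj (f s) = (\<Sum>n\<in>F. c n * (wave n s * cnj (f s)))"
      by (simp add: p_def sum_distrib_right mult.assoc)
    also have "p s * cnj (p s) = (\<Sum>n\<in>F. \<Sum>m\<in>F. c n * cnj (c m) * wave (n - m) s)"
    proof -
      have w: "c n * wave n s * (cnj (c m) * wave (- m) s) = c n * cnj (c m) * wave (n - m) s" for n m
        using wave_add[of n "- m" s] by simp
      show ?thesis by (simp add: p_def sum_product cnj_wave w)
    qed
    finally show ?thesis by (simp only: complex_norm_square)
  qed
  have "((\<lambda>s. of_real ((cmod (f s - p s))\<^sup>2)) has_integral (complex_of_real J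
      - (\<Sum>n\<in>F. cnj (c n) * (of_real L * c n)) - (\<Sum>n\<in>F. c n * (of_real L * cnj (c n)))
      + (\<Sum>n\<in>F. \<Sum>m\<in>F. c n * cnj (c m) * (if n - m = 0 then of_real L else 0)))) {0..L}"
    unfolding eq
    by (intro has_integral_add has_integral_diff has_integral_sum F has_integral_mult_right 1 2 3 wave_has_integral)
  also have "(\<Sum>n\<in>F. \<Sum>m\<in>F. c n * cnj (c m) * (if n - m = 0 then of_real L else 0))
      = (\<Sum>n\<in>F. c n * cnj (c n) * complex_of_real L)"
    using F by (intro sum.cong refl) (simp add: if_distrib[where f = "\<lambda>x. _ * x"] cong: if_cong)
  also have "(\<Sum>n\<in>F. cnj (c n) * (of_real L * c n)) = of_real (L * (\<Sum>n\<in>F. (cmod (c n))\<^sup>2))"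
    unfolding of_real_mult of_real_sum complex_norm_square sum_distrib_left by (intro sum.cong refl) simp
  also have "(\<Sum>n\<in>F. c n * (of_real L * cnj (c n))) = of_real (L * (\<Sum>n\<in>F. (cmod (c n))\<^sup>2))"
    unfolding of_real_mult of_real_sum complex_norm_square sum_distrib_left by (intro sum.cong refl) simp
  also have "(\<Sum>n\<in>F. c n * cnj (c n) * complex_of_real L) = of_real (L * (\<Sum>n\<in>F. (cmod (c n))\<^sup>2))"
    unfolding of_real_mult of_real_sum complex_norm_square sum_distrib_left by (intro sum.cong refl) simp
  finally have i: "((\<lambda>s. of_real ((cmod (f s - p s))\<^sup>2)) has_integral
      complex_of_real (J - L * (\<Sum>n\<in>F. (cmod (c n))\<^sup>2))) {0..L}" by simp
  have "((\<lambda>s. (cmod (f s - p s))\<^sup>2) has_integral (J - L * (\<Sum>n\<in>F. (cmod (c n))\<^sup>2))) {0..L}"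
    using has_integral_linear[OF i bounded_linear_Re] by (simp only: o_def Re_complex_of_real)
  then have "0 \<le> J - L * (\<Sum>n\<in>F. (cmod (c n))\<^sup>2)"
    by (rule has_integral_nonneg) simp
  then show ?thesis using L_pos unfolding J_def c_def by (simp add: field_simps)
qed

text \<open>Bessel makes the squared coefficients summable along any injective choice of
  frequencies, so they tend to zero; this form covers frequencies going to plus and to minus
  infinity.\<close>

lemma riemann_lebesgue:
  assumes f: "continuous_on {0..L} f" and g: "inj (g :: nat \<Rightarrow> int)"
  shows "(\<lambda>n. fc (g n) f) \<longlonglongrightarrow> 0"
proof -
  have "(\<lambda>n. (cmod (fc (g n) f))\<^sup>2) summable_on UNIV"
  proof (rule nonneg_bdd_above_summable_on)
    show "bdd_above (sum (\<lambda>n. (cmod (fc (g n) f))\<^sup>2) ` {F. F \<subseteq> UNIV \<and> finite F})"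
    proof (rule bdd_aboveI2)
      fix F :: "nat set" assume "F \<in> {F. F \<subseteq> UNIV \<and> finite F}"
      then have "finite (g ` F)" by simp
      from bessel[OF f this]
      show "(\<Sum>n\<in>F. (cmod (fc (g n) f))\<^sup>2) \<le> integral {0..L} (\<lambda>s. (cmod (f s))\<^sup>2) / L"
        using sum.reindex[of g F "\<lambda>n. (cmod (fc n f))\<^sup>2"] inj_on_subset[OF g] by simp
    qed
  qed simp
  then have "(\<lambda>n. (cmod (fc (g n) f))\<^sup>2) \<longlonglongrightarrow> 0"
    by (intro summable_LIMSEQ_zero summable_on_imp_summable)
  from tendsto_real_sqrt[OF this] have "(\<lambda>n. cmod (fc (g n) f)) \<longlonglongrightarrow> 0" by simp
  then show ?thesis by (rule tendsto_norm_zero_cancel)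
qed

lemma wave_1_eq_1_iff: "wave 1 s = 1 \<longleftrightarrow> (\<exists>m::int. s = L * of_int m)"
proof
  assume "wave 1 s = 1"
  then obtain n :: int where "2 * pi / L * s = of_int (2 * n) * pi"
    by (auto simp: wave_def cis_conv_exp exp_eq_1)
  then have "s = L * of_int n" using L_pos by (simp add: field_simps)
  then show "\<exists>m::int. s = L * of_int m" by blast
next
  assume "\<exists>m::int. s = L * of_int m"
  then show "wave 1 s = 1" using wave_shift[of 1 0] by auto
qed

lemma difference_quotient_tendsto:
  fixes f :: "real \<Rightarrow> complex"
  assumes "(f has_vector_derivative d) (at 0)"
  shows "((\<lambda>s. (f s - f 0) / of_real s) \<longlongrightarrow> d) (at 0)"
proof -
  have "((\<lambda>s. (1 / norm (s - 0)) *\<^sub>R (f s - (f 0 + (s - 0) *\<^sub>R d))) \<longlongrightarrow> 0) (at 0)"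
    using assms unfolding has_vector_derivative_def has_derivative_within by blast
  then have "((\<lambda>s. norm ((1 / norm (s - 0)) *\<^sub>R (f s - (f 0 + (s - 0) *\<^sub>R d)))) \<longlongrightarrow> 0) (at 0)"
    by (rule tendsto_norm_zero)
  then have "((\<lambda>s. norm ((f s - f 0) / of_real s - d)) \<longlongrightarrow> 0) (at 0)"
  proof (rule Lim_transform_eventually)
    show "\<forall>\<^sub>F s in at 0. norm ((1 / norm (s - 0)) *\<^sub>R (f s - (f 0 + (s - 0) *\<^sub>R d)))
        = norm ((f s - f 0) / of_real s - d)"
    proof (rule eventually_at_topological[THEN iffD2], intro exI[of _ UNIV] conjI ballI impI)
      fix s :: real assume "s \<noteq> 0"
      then have "(f s - f 0) / of_real s - d = (f s - (f 0 + s *\<^sub>R d)) / of_real s"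
        by (simp add: field_simps scaleR_conv_of_real)
      then show "norm ((1 / norm (s - 0)) *\<^sub>R (f s - (f 0 + (s - 0) *\<^sub>R d)))
        = norm ((f s - f 0) / of_real s - d)" by (simp add: norm_divide)
    qed auto
  qed
  then show ?thesis using tendsto_norm_zero_iff LIM_zero_iff by blast
qed

text \<open>Dirichlet's argument: dividing h - h 0 by wave 1 - 1 gives a continuous function q, and the
  symmetric partial sums of the Fourier series of h at 0 telescope to h 0 plus two coefficients of q.\<close>

lemma fourier_inversion_at_0:
  assumes h: "continuous_on UNIV h" and per: "\<And>s m. h (s + L * of_int m) = h s"
    and h': "(h has_vector_derivative h') (at 0)"
    and s: "(\<lambda>n. fc n h) summable_on UNIV"
  shows "((\<lambda>n. fc n h) has_sum h 0) UNIV"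
proof -
  define w where "w = \<i> * complex_of_real (2 * pi / L)"
  have w: "w \<noteq> 0" using L_pos by (simp add: w_def)
  \<comment> \<open>At the multiples of L, the zeros of \<open>wave 1 - 1\<close>, the value is the
    limit of the quotient: numerator and denominator have derivatives h' and w at 0, and periodicity
    carries this to the other zeros.\<close>
  define q where "q s = (if wave 1 s = 1 then h' / w else (h s - h 0) / (wave 1 s - 1))" for s
  have q_per: "q (s + L * of_int m) = q s" for s m
    using wave_shift[of 1 s m] per[of s m] by (simp add: q_def)
  have q_eq: "h s = wave 1 s * q s - q s + h 0" for s
  proof (cases "wave 1 s = 1")
    case True
    then obtain m :: int where "s = L * of_int m" using wave_1_eq_1_iff by blast
    then have "h s = h 0" using per[of 0 m] by simp
    then show ?thesis using True by simp
  next
    case False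
    then have "q s * (wave 1 s - 1) = h s - h 0" by (simp add: q_def)
    then show ?thesis by (simp add: algebra_simps)
  qed
  have ne1: "wave 1 s \<noteq> 1" if "s \<noteq> 0" "\<bar>s\<bar> < L" for s
  proof
    assume "wave 1 s = 1"
    then obtain m :: int where m: "s = L * of_int m" using wave_1_eq_1_iff by blast
    then have "\<bar>of_int m\<bar> < (1::real)" "m \<noteq> 0" using that L_pos by (auto simp: abs_mult)
    then show False by linarith
  qed
  have q0: "isCont q 0"
  proof -
    have "((\<lambda>s. (wave 1 s - wave 1 0) / of_real s) \<longlongrightarrow> w) (at 0)"
      by (rule difference_quotient_tendsto)
        (use wave_deriv[of 1 0 UNIV] in \<open>simp add: w_def\<close>)
    then have "((\<lambda>s. ((h s - h 0) / of_real s) / ((wave 1 s - wave 1 0) / of_real s)) \<longlongrightarrow> h' / w) (at 0)"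
      by (intro tendsto_divide difference_quotient_tendsto[OF h'] w)
    then have "(q \<longlongrightarrow> h' / w) (at 0)"
    proof (rule Lim_transform_eventually)
      show "\<forall>\<^sub>F s in at 0. ((h s - h 0) / of_real s) / ((wave 1 s - wave 1 0) / of_real s) = q s"
      proof (rule eventually_at_topological[THEN iffD2], intro exI[of _ "{-L<..<L}"] conjI ballI impI)
        fix s :: real assume "s \<noteq> 0" "s \<in> {-L<..<L}"
        then show "((h s - h 0) / of_real s) / ((wave 1 s - wave 1 0) / of_real s) = q s"
          using ne1[of s] by (simp add: q_def abs_less_iff)
      qed (use L_pos in auto)
    qed
    moreover have "q 0 = h' / w" by (simp add: q_def)
    ultimately show ?thesis by (simp add: isCont_def)
  qed
  have q: "isCont q s" for s
  proof (cases "wave 1 s = 1")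
    case True
    then obtain m :: int where m: "s = L * of_int m" using wave_1_eq_1_iff by blast
    have "isCont (\<lambda>u. q (u - s)) s"
      by (rule isCont_o2[where g = q]) (use q0 in auto)
    moreover have "q (u - s) = q u" for u using q_per[of u "- m"] m by simp
    ultimately show ?thesis by simp
  next
    case False
    let ?U = "{u. wave 1 u \<noteq> 1}"
    have U: "open ?U" by (intro open_Collect_neq continuous_wave continuous_on_const)
    have "continuous_on ?U (\<lambda>s. (h s - h 0) / (wave 1 s - 1))"
      by (intro continuous_intros continuous_wave continuous_on_subset[OF h]) auto
    then have "continuous_on ?U q"
      by (subst continuous_on_cong[where g = "\<lambda>s. (h s - h 0) / (wave 1 s - 1)"]) (auto simp: q_def)
    then show ?thesis using U False continuous_on_eq_continuous_at by blast
  qed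
  have qc: "continuous_on {0..L} q" using q by (simp add: continuous_at_imp_continuous_on)
  \<comment> \<open>Multiplication by \<open>wave 1\<close> shifts the index of a Fourier
    coefficient by one; hence a difference of neighbouring coefficients of q, plus h 0 coming from
    the constant, which is seen by n = 0 only.\<close>
  have fc_h: "fc n h = fc (n - 1) q - fc n q + (if n = 0 then h 0 else 0)" for n
  proof -
    have "((\<lambda>s. wave (- (n - 1)) s * q s - wave (- n) s * q s + wave (- n) s * h 0) has_integral
        (of_real L * fc (n - 1) q - of_real L * fc n q + (if - n = 0 then of_real L else 0) * h 0)) {0..L}"
      by (intro has_integral_add has_integral_diff fc_has_integral qc has_integral_mult_left wave_has_integral)
    moreover have "wave (- (n - 1)) s * q s - wave (- n) s * q s + wave (- n) s * h 0 = wave (- n) s * h s" for s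
      using wave_add[of "- n" 1 s] by (subst q_eq) (simp add: algebra_simps)
    ultimately have "integral {0..L} (\<lambda>s. wave (- n) s * h s)
        = of_real L * fc (n - 1) q - of_real L * fc n q + (if n = 0 then of_real L else 0) * h 0"
      by (simp add: integral_unique)
    then show ?thesis using L_pos by (simp add: fc_def[of n h] field_simps)
  qed
  have sum: "(\<Sum>n\<in>{- int N..int N}. fc n h) = h 0 + fc (- int N - 1) q - fc (int N) q" for N
  proof (induction N)
    case 0
    then show ?case by (simp add: fc_h)
  next
    case (Suc N)
    have "{- int (Suc N)..int (Suc N)} = insert (- int (Suc N)) (insert (int (Suc N)) {- int N..int N})" by auto
    then have "(\<Sum>n\<in>{- int (Suc N)..int (Suc N)}. fc n h)
        = fc (- int (Suc N)) h + (fc (int (Suc N)) h + (\<Sum>n\<in>{- int N..int N}. fc n h))" by simp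
    moreover have "fc (- int (Suc N)) h = fc (- int (Suc N) - 1) q - fc (- int N - 1) q"
    proof -
      have "- int (Suc N) = - int N - 1" "- int (Suc N) \<noteq> 0" by auto
      then show ?thesis using fc_h[of "- int (Suc N)"] by (simp only: if_False)  simp
    qed
    moreover have "fc (int (Suc N)) h = fc (int N) q - fc (int (Suc N)) q"
      using fc_h[of "int (Suc N)"] by simp
    ultimately show ?case using Suc by (simp only:) simp
  qed
  have "(\<lambda>N. h 0 + fc (- int N - 1) q - fc (int N) q) \<longlonglongrightarrow> h 0 + 0 - 0"
    by (intro tendsto_intros riemann_lebesgue qc) (auto simp: inj_def)
  then have "(\<lambda>N. \<Sum>n\<in>{- int N..int N}. fc n h) \<longlonglongrightarrow> h 0" by (simp add: sum)
  \<comment> \<open>Every finite set of integers lies in some symmetric interval, so the symmetric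
    partial sums converge to the unordered sum, whose existence is the summability
    hypothesis.\<close>
  moreover have "filterlim (\<lambda>N. {- int N..int N}) (finite_subsets_at_top UNIV) sequentially"
    unfolding filterlim_finite_subsets_at_top
  proof (intro allI impI)
    fix X :: "int set" assume "finite X \<and> X \<subseteq> UNIV"
    then have X: "finite X" by simp
    show "\<forall>\<^sub>F N in sequentially. finite {- int N..int N} \<and> X \<subseteq> {- int N..int N} \<and> {- int N..int N} \<subseteq> UNIV"
      unfolding eventually_sequentially
    proof (intro exI[of _ "\<Sum>x\<in>X. nat \<bar>x\<bar>"] allI impI conjI)
      fix N assume N: "(\<Sum>x\<in>X. nat \<bar>x\<bar>) \<le> N"
      show "X \<subseteq> {- int N..int N}"
      proof
        fix x assume "x \<in> X"
        then have "nat \<bar>x\<bar> \<le> (\<Sum>x\<in>X. nat \<bar>x\<bar>)" by (intro member_le_sum X) auto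
        then show "x \<in> {- int N..int N}" using N by auto
      qed
    qed auto
  qed
  then have "(\<lambda>N. \<Sum>n\<in>{- int N..int N}. fc n h) \<longlonglongrightarrow> (\<Sum>\<^sub>\<infinity>n. fc n h)"
    by (rule filterlim_compose[OF infsum_tendsto[OF s]])
  ultimately have "(\<Sum>\<^sub>\<infinity>n. fc n h) = h 0" using LIMSEQ_unique by blast
  then show ?thesis using s has_sum_infsum by metis
qed

subsection \<open>Fourier expansion of smooth periodic functions on the slab\<close>

definition ei :: "3 \<Rightarrow> real \<times> (real^3)" where "ei i = (0, axis i 1)"

definition per :: "(real \<times> (real^3) \<Rightarrow> 'b) \<Rightarrow> bool" where
  "per g \<longleftrightarrow> (\<forall>t\<in>{0..T}. lattice_periodic L (\<lambda>x. g (t, x)))"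

definition SP :: "(real \<times> (real^3) \<Rightarrow> complex) \<Rightarrow> bool" where
  "SP g \<longleftrightarrow> smooth_on g slab \<and> per g"

definition D :: "real \<times> (real^3) \<Rightarrow> (real \<times> (real^3) \<Rightarrow> 'b::real_normed_vector) \<Rightarrow> real \<times> (real^3) \<Rightarrow> 'b" where
  "D v g z = frechet_derivative g (at z within slab) v"

text \<open>The projection of g onto functions that vary like \<open>wave n\<close> in the i-th
  coordinate (see \<open>A_shift\<close>). It is kept as a function of the base point z, so that the
  projections for the three coordinates can be composed.\<close>

definition A :: "3 \<Rightarrow> int \<Rightarrow> (real \<times> (real^3) \<Rightarrow> complex) \<Rightarrow> real \<times> (real^3) \<Rightarrow> complex" where
  "A i n g z = fc n (\<lambda>s. g (z + s *\<^sub>R ei i))"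

lemma thick_slab': "thick slab"
  by (rule thick_slab[OF T_pos])

lemma slab_shift [simp]: "z + s *\<^sub>R ei i \<in> slab \<longleftrightarrow> z \<in> slab"
  by (auto simp: ei_def mem_Times_iff)

lemma per_shift:
  assumes "per g" "z \<in> slab"
  shows "g (z + (0, L *\<^sub>R (\<chi> i. of_int (k $ i)))) = g z"
proof -
  have "g (fst z, snd z + L *\<^sub>R (\<chi> i. of_int (k $ i))) = g (fst z, snd z)"
    using assms unfolding per_def lattice_periodic_def by (auto simp: mem_Times_iff)
  then show ?thesis by (cases z) simp
qed

lemma per_axis:
  assumes "per g" "z \<in> slab"
  shows "g (z + (L * of_int m) *\<^sub>R ei i) = g z"
proof -
  have "(L * of_int m) *\<^sub>R ei i = (0, L *\<^sub>R (\<chi> j. of_int ((axis i m :: int^3) $ j)))"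
    by (auto simp: ei_def axis_def vec_eq_iff)
  then show ?thesis using per_shift[OF assms, of "axis i m"] by (simp only:)
qed

lemma D_works:
  assumes "smooth_on g slab" "z \<in> slab"
  shows "(g has_derivative (\<lambda>v. D v g z)) (at z within slab)"
proof -
  have "Ck_on (Suc 0) g slab" using assms(1) smooth_on_def by blast
  then show ?thesis unfolding D_def using assms(2)
    by (auto simp: differentiable_on_def frechet_derivative_works)
qed

lemma D_eq:
  assumes "(g has_derivative g') (at z within slab)" "z \<in> slab"
  shows "D v g z = g' v"
  unfolding D_def using frechet_derivative_eqI[OF thick_slab' assms(2,1)] by simp

lemma D_smooth: "smooth_on g slab \<Longrightarrow> smooth_on (D v g) slab"
  unfolding D_def[abs_def] smooth_on_def using Ck_on.simps(2) by blast

lemma D_cong: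
  assumes "\<And>z. z \<in> slab \<Longrightarrow> f z = g z" "smooth_on g slab" "z \<in> slab"
  shows "D v f z = D v g z"
  by (rule D_eq[OF _ assms(3)], rule has_derivative_transform[OF assms(3) _ D_works[OF assms(2,3)]])
    (rule assms(1))

lemma D_per:
  assumes "SP g" shows "per (D v g)"
  unfolding per_def lattice_periodic_def
proof (intro ballI allI)
  fix t x and k :: "int^3" assume t: "t \<in> {0..T}"
  let ?s = "(0, L *\<^sub>R (\<chi> i. of_int (k $ i))) :: real \<times> (real^3)"
  have g: "smooth_on g slab" "per g" using assms SP_def by auto
  have z: "(t, x) \<in> slab" "(t, x) + ?s \<in> slab" using t by auto
  have "((\<lambda>z. g (z + ?s)) has_derivative (\<lambda>v. D v g ((t, x) + ?s))) (at (t, x) within slab)"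
  proof (rule has_derivative_in_compose2[where t = slab and g = g and g' = "\<lambda>z v. D v g z"])
    show "(g has_derivative (\<lambda>v. D v g z)) (at z within slab)" if "z \<in> slab" for z
      by (rule D_works[OF g(1) that])
  qed (use z in \<open>auto intro!: derivative_eq_intros simp: mem_Times_iff\<close>)
  then have "(g has_derivative (\<lambda>v. D v g ((t, x) + ?s))) (at (t, x) within slab)"
    by (rule has_derivative_transform[OF z(1), rotated]) (use per_shift[OF g(2)] in auto)
  from D_eq[OF this z(1)] show "D v g (t, x + L *\<^sub>R (\<chi> i. of_int (k $ i))) = D v g (t, x)" by simp
qed

lemma SP_D: "SP g \<Longrightarrow> SP (D v g)"
  using D_smooth D_per SP_def by blast

lemma line_image: "z \<in> slab \<Longrightarrow> (\<lambda>s. z + s *\<^sub>R ei i) ` S \<subseteq> slab"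
  by (rule image_subsetI) (simp only: slab_shift)

lemma continuous_on_line:
  assumes "smooth_on g slab" "z \<in> slab"
  shows "continuous_on S (\<lambda>s. g (z + s *\<^sub>R ei i))"
  by (rule continuous_on_compose2[OF smooth_on_imp_continuous_on[OF assms(1)]])
    (intro continuous_intros, rule line_image[OF assms(2)])

lemma line_derivative:
  assumes "smooth_on g slab" "z \<in> slab"
  shows "((\<lambda>s. g (z + s *\<^sub>R ei i)) has_vector_derivative D (ei i) g (z + s *\<^sub>R ei i)) (at s within S)"
proof -
  have z: "z + s *\<^sub>R ei i \<in> slab" using assms by simp
  have "((\<lambda>s. g (z + s *\<^sub>R ei i)) has_derivative (\<lambda>h. D (h *\<^sub>R ei i) g (z + s *\<^sub>R ei i))) (at s)"
  proof (rule has_derivative_in_compose2[where t = slab and g = g and g' = "\<lambda>z v. D v g z"])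
    show "(g has_derivative (\<lambda>v. D v g z)) (at z within slab)" if "z \<in> slab" for z
      by (rule D_works[OF assms(1) that])
    show "(\<lambda>s. z + s *\<^sub>R ei i) ` UNIV \<subseteq> slab" by (rule line_image[OF assms(2)])
    show "((\<lambda>s. z + s *\<^sub>R ei i) has_derivative (\<lambda>h. h *\<^sub>R ei i)) (at s)"
      by (auto intro!: derivative_eq_intros)
  qed auto
  then have "((\<lambda>s. g (z + s *\<^sub>R ei i)) has_derivative (\<lambda>h. D (h *\<^sub>R ei i) g (z + s *\<^sub>R ei i))) (at s within S)"
    by (rule has_derivative_at_withinI)
  moreover have "D (h *\<^sub>R ei i) g (z + s *\<^sub>R ei i) = h *\<^sub>R D (ei i) g (z + s *\<^sub>R ei i)" for h
    using linear_scale[OF has_derivative_linear[OF D_works[OF assms(1) z]]] .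
  ultimately show ?thesis unfolding has_vector_derivative_def by simp
qed

lemma A_cong: "(\<And>z. z \<in> slab \<Longrightarrow> f z = g z) \<Longrightarrow> z \<in> slab \<Longrightarrow> A i n f z = A i n g z"
  unfolding A_def by simp

lemma A_cmult: "A i n (\<lambda>z. c * g z) z = c * A i n g z"
  unfolding A_def fc_def by (simp add: mult.left_commute[of _ c] integral_mult_right)

lemma fc_bound:
  assumes "continuous_on {0..L} f" "\<And>s. cmod (f s) \<le> M"
  shows "cmod (fc n f) \<le> M"
proof -
  have "cmod (integral {0..L} (\<lambda>s. wave (- n) s * f s)) \<le> M * (L - 0)"
    by (rule integral_bound) (use L_pos assms in \<open>auto intro!: continuous_on_mult continuous_wave simp: norm_mult\<close>)
  then show ?thesis using L_pos by (simp add: fc_def norm_divide field_simps)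
qed

lemma A_bound:
  assumes "smooth_on g slab" "\<And>z. z \<in> slab \<Longrightarrow> cmod (g z) \<le> M" "z \<in> slab"
  shows "cmod (A i n g z) \<le> M"
  unfolding A_def
proof (rule fc_bound)
  show "cmod (g (z + s *\<^sub>R ei i)) \<le> M" for s by (rule assms(2)) (simp only: slab_shift assms(3))
qed (rule continuous_on_line[OF assms(1,3)])

lemma A_has_derivative:
  assumes g: "smooth_on g slab" and z: "z \<in> slab"
  shows "(A i n g has_derivative (\<lambda>v. A i n (D v g) z)) (at z within slab)"
proof -
  define f where "f z s = wave (- n) s * g (z + s *\<^sub>R ei i)" for z s
  \<comment> \<open>\<open>leibniz_rule\<close> expects the derivative of the integrand as a
    continuous function into bounded linear maps. Since the domain is finite-dimensional, continuity
    of \<open>F\<close> may be checked for each fixed direction v.\<close>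
  define F where "F z s = Blinfun (\<lambda>v. wave (- n) s * D v g (z + s *\<^sub>R ei i))" for z s
  have lin: "bounded_linear (\<lambda>v. D v g z)" if "z \<in> slab" for z
    using D_works[OF g that] has_derivative_bounded_linear by blast
  have F: "blinfun_apply (F z s) v = wave (- n) s * D v g (z + s *\<^sub>R ei i)" if "z \<in> slab" for z s v
    unfolding F_def using that
    by (subst bounded_linear_Blinfun_apply)
      (auto intro!: bounded_linear_const_mult lin)
  have fd: "((\<lambda>z. f z s) has_derivative blinfun_apply (F z s)) (at z within slab)" if "z \<in> slab" for z s
  proof -
    have "((\<lambda>z. g (z + s *\<^sub>R ei i)) has_derivative (\<lambda>v. D v g (z + s *\<^sub>R ei i))) (at z within slab)"
    proof (rule has_derivative_in_compose2[where t = slab and g = g and g' = "\<lambda>z v. D v g z"])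
      show "(g has_derivative (\<lambda>v. D v g z)) (at z within slab)" if "z \<in> slab" for z
        by (rule D_works[OF g that])
      show "(\<lambda>z. z + s *\<^sub>R ei i) ` slab \<subseteq> slab"
        by (auto simp: ei_def)
    qed (use that in \<open>auto intro!: derivative_eq_intros\<close>)
    then have "((\<lambda>z. f z s) has_derivative (\<lambda>v. wave (- n) s * D v g (z + s *\<^sub>R ei i))) (at z within slab)"
      unfolding f_def by (rule has_derivative_mult_right)
    then show ?thesis by (rule has_derivative_eq_rhs) (simp add: fun_eq_iff F[OF that])
  qed
  have sh: "continuous_on (slab \<times> {0..L}) (\<lambda>(z, s). z + s *\<^sub>R ei i)"
    unfolding case_prod_unfold by (intro continuous_intros)
  have Fc: "continuous_on (slab \<times> cbox 0 L) (\<lambda>(z, s). F z s)"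
    unfolding case_prod_unfold
  proof (rule continuous_on_blinfun_componentwise)
    fix v :: "real \<times> (real^3)"
    have "continuous_on (slab \<times> cbox 0 L) (\<lambda>p. wave (- n) (snd p) * D v g (fst p + snd p *\<^sub>R ei i))"
    proof (intro continuous_on_mult)
      show "continuous_on (slab \<times> cbox 0 L) (\<lambda>p. wave (- n) (snd p))"
        by (rule continuous_on_compose2[OF continuous_wave[of UNIV]]) (auto intro!: continuous_intros)
      show "continuous_on (slab \<times> cbox 0 L) (\<lambda>p. D v g (fst p + snd p *\<^sub>R ei i))"
        by (rule continuous_on_compose2[OF smooth_on_imp_continuous_on[OF D_smooth[OF g]]])
          (auto intro!: continuous_intros simp: ei_def)
    qed
    then show "continuous_on (slab \<times> cbox 0 L) (\<lambda>p. blinfun_apply (F (fst p) (snd p)) v)"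
      by (subst continuous_on_cong[OF refl F]) auto
  qed
  have cl: "continuous_on S (\<lambda>s. f z s)" if "z \<in> slab" for z S
    unfolding f_def by (intro continuous_on_mult continuous_wave continuous_on_line g that)
  have "((\<lambda>z. integral (cbox 0 L) (f z)) has_derivative blinfun_apply (integral (cbox 0 L) (F z))) (at z within slab)"
  proof (rule leibniz_rule[OF fd _ Fc z])
    show "f z integrable_on cbox 0 L" if "z \<in> slab" for z
      using integrable_continuous_real[OF cl[OF that, of "{0..L}"]] by simp
    show "convex slab" by (intro convex_Times) auto
  qed auto
  then have "((\<lambda>z. integral {0..L} (f z) / of_real L) has_derivative
      (\<lambda>v. blinfun_apply (integral {0..L} (F z)) v / of_real L)) (at z within slab)"
    unfolding box_real by (rule bounded_linear.has_derivative[OF bounded_linear_divide])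
  moreover have "blinfun_apply (integral {0..L} (F z)) v = integral {0..L} (\<lambda>s. wave (- n) s * D v g (z + s *\<^sub>R ei i))" for v
  proof -
    have "continuous_on {0..L} (F z)"
      by (rule continuous_on_compose2[OF Fc, of _ "\<lambda>s. (z, s)", simplified]) (use z in \<open>auto intro!: continuous_intros\<close>)
    then have "blinfun_apply (integral {0..L} (F z)) v = integral {0..L} (\<lambda>s. blinfun_apply (F z s) v)"
      by (intro blinfun_apply_integral integrable_continuous_real)
    then show ?thesis using F[OF z] by simp
  qed
  ultimately show ?thesis by (simp add: A_def[abs_def] fc_def f_def[abs_def])
qed

lemma D_A:
  assumes "smooth_on g slab" "z \<in> slab"
  shows "D v (A i n g) z = A i n (D v g) z"
  by (rule D_eq[OF A_has_derivative[OF assms] assms(2)])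

lemma A_smooth:
  assumes "smooth_on g slab" shows "smooth_on (A i n g) slab"
proof (rule smooth_on_coinduct[OF thick_slab', where P = "\<lambda>h. \<exists>g. smooth_on g slab \<and> h = A i n g"])
  show "\<exists>g'. smooth_on g' slab \<and> A i n g = A i n g'" using assms by blast
  fix f assume "\<exists>g. smooth_on g slab \<and> f = A i n g"
  then obtain g where g: "smooth_on g slab" "f = A i n g" by blast
  show "\<exists>f'. (\<forall>x\<in>slab. (f has_derivative f' x) (at x within slab))
      \<and> (\<forall>v. \<exists>g. smooth_on g slab \<and> (\<lambda>x. f' x v) = A i n g)"
  proof (intro exI[of _ "\<lambda>z v. A i n (D v g) z"] conjI ballI allI)
    show "(f has_derivative (\<lambda>v. A i n (D v g) x)) (at x within slab)" if "x \<in> slab" for x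
      unfolding g(2) by (rule A_has_derivative[OF g(1) that])
    show "\<exists>h. smooth_on h slab \<and> A i n (D v g) = A i n h" for v
      using D_smooth[OF g(1)] by blast
  qed
qed

lemma A_per:
  assumes g: "per g" shows "per (A i n g)"
  unfolding per_def lattice_periodic_def
proof (intro ballI allI)
  fix t x and k :: "int^3"
  assume t: "t \<in> {0..T}"
  have "g ((t, x + L *\<^sub>R (\<chi> i. of_int (k $ i))) + s *\<^sub>R ei i) = g ((t, x) + s *\<^sub>R ei i)" for s
  proof -
    have "(t, x + L *\<^sub>R (\<chi> i. of_int (k $ i))) + s *\<^sub>R ei i
        = (t, x) + s *\<^sub>R ei i + (0, L *\<^sub>R (\<chi> i. of_int (k $ i)))"
      by (simp add: ei_def add_ac)
    moreover have "(t, x) + s *\<^sub>R ei i \<in> slab" using t by (simp only: slab_shift) simp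
    ultimately show ?thesis using per_shift[OF g] by (simp only:)
  qed
  then show "A i n g (t, x + L *\<^sub>R (\<chi> i. of_int (k $ i))) = A i n g (t, x)"
    by (simp add: A_def)
qed

lemma SP_A: "SP g \<Longrightarrow> SP (A i n g)"
  using A_smooth A_per SP_def by blast

text \<open>Integration by parts over one period: the boundary terms cancel by periodicity, and
  differentiating the wave gives the factor.\<close>

lemma A_parts:
  assumes "SP g" "z \<in> slab"
  shows "A i n (D (ei i) g) z = \<i> * of_real (2 * pi / L * of_int n) * A i n g z"
proof -
  define r where "r = 2 * pi / L * of_int n"
  have g: "smooth_on g slab" "per g" using assms SP_def by auto
  define h where "h s = g (z + s *\<^sub>R ei i)" for s
  define h' where "h' s = D (ei i) g (z + s *\<^sub>R ei i)" for s
  have hc: "continuous_on {0..L} h" "continuous_on {0..L} h'"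
    unfolding h_def h'_def
    by (rule continuous_on_line[OF g(1) assms(2)] continuous_on_line[OF D_smooth[OF g(1)] assms(2)])+
  have "((\<lambda>s. wave (- n) s * h' s + - (\<i> * of_real r) * wave (- n) s * h s) has_integral
      (wave (- n) L * h L - wave (- n) 0 * h 0)) {0..L}"
  proof (rule fundamental_theorem_of_calculus)
    show "((\<lambda>s. wave (- n) s * h s) has_vector_derivative
        wave (- n) s * h' s + - (\<i> * of_real r) * wave (- n) s * h s) (at s within {0..L})" for s
      using has_vector_derivative_mult[OF wave_deriv[of "- n"] line_derivative[OF g(1) assms(2), where i = i and s = s]]
      by (simp add: h_def h'_def r_def)
  qed (use L_pos in simp)
  moreover have "wave (- n) L * h L = wave (- n) 0 * h 0"
    using wave_shift[of "- n" 0 1] per_axis[OF g(2) assms(2), of 1 i] by (simp add: h_def)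
  ultimately have 1: "((\<lambda>s. wave (- n) s * h' s + - (\<i> * of_real r) * wave (- n) s * h s) has_integral 0) {0..L}"
    by simp
  have 2: "((\<lambda>s. wave (- n) s * h' s + - (\<i> * of_real r) * (wave (- n) s * h s)) has_integral
      (of_real L * fc n h' + - (\<i> * of_real r) * (of_real L * fc n h))) {0..L}"
    by (intro has_integral_add has_integral_mult_right fc_has_integral hc)
  have "of_real L * fc n h' + - (\<i> * of_real r) * (of_real L * fc n h) = 0"
    by (rule has_integral_unique[OF 2]) (use 1 in \<open>simp add: mult.assoc\<close>)
  then have "of_real L * (fc n h' - \<i> * of_real r * fc n h) = 0" by (simp add: algebra_simps)
  then have "fc n h' = \<i> * of_real r * fc n h" using L_pos by simp
  then show ?thesis by (simp add: A_def h_def[abs_def] h'_def[abs_def] r_def)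
qed

text \<open>By \<open>D_A\<close> and \<open>A_parts\<close> the function satisfies, along axis i,
  the linear equation of \<open>wave n\<close>; hence its product with \<open>wave (- n)\<close> has
  zero derivative and is constant.\<close>

lemma A_shift:
  assumes "SP g" "z \<in> slab"
  shows "A i n g (z + h *\<^sub>R ei i) = wave n h * A i n g z"
proof -
  have g: "smooth_on g slab" using assms SP_def by auto
  define \<phi> where "\<phi> h = wave (- n) h * A i n g (z + h *\<^sub>R ei i)" for h
  have "(\<phi> has_vector_derivative 0) (at s within UNIV)" for s
  proof -
    have "D (ei i) (A i n g) (z + s *\<^sub>R ei i) = \<i> * of_real (2 * pi / L * of_int n) * A i n g (z + s *\<^sub>R ei i)"
      using A_parts[OF assms(1)] D_A[OF g] assms(2) by simp
    then show ?thesis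
      using has_vector_derivative_mult[OF wave_deriv[of "- n"] line_derivative[OF A_smooth[OF g, of i n] assms(2), where i = i and s = s]]
      by (simp add: \<phi>_def[abs_def])
  qed
  then have "\<phi> h = \<phi> 0"
    using has_vector_derivative_zero_constant[of UNIV \<phi>] by (metis UNIV_I convex_UNIV)
  then have "wave n h * wave (- n) h * A i n g (z + h *\<^sub>R ei i) = wave n h * A i n g z"
    by (simp add: \<phi>_def)
  moreover have "wave n h * wave (- n) h = 1" using wave_add[of n "- n" h] by simp
  ultimately show ?thesis by simp
qed

text \<open>Averaging along an axis commutes with translations, so an eigenfunction of a translation
  stays one after further averaging along other axes.\<close>

lemma A_eigen:
  assumes "\<And>z. z \<in> slab \<Longrightarrow> g (z + y) = c * g z" "z \<in> slab"
  shows "A i n g (z + y) = c * A i n g z"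
proof -
  have "g (z + y + s *\<^sub>R ei i) = c * g (z + s *\<^sub>R ei i)" for s
    using assms(1)[of "z + s *\<^sub>R ei i"] assms(2) by (simp add: add_ac)
  then show ?thesis
    unfolding A_def fc_def by (simp add: mult.left_commute[of _ c] integral_mult_right)
qed

section \<open>Fourier coefficients in three variables\<close>

definition proj :: "(real \<times> (real^3) \<Rightarrow> complex) \<Rightarrow> int^3 \<Rightarrow> real \<times> (real^3) \<Rightarrow> complex" where
  "proj g k = A 3 (k $ 3) (A 2 (k $ 2) (A 1 (k $ 1) g))"

text \<open>The projection onto frequency k is a multiple of \<open>mode k\<close> (see
  \<open>proj_eq\<close>), and the mode equals 1 at the origin, so the value there is the
  coefficient.\<close>

definition coef :: "(real \<times> (real^3) \<Rightarrow> complex) \<Rightarrow> fam" where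
  "coef g k t = proj g k (t, 0)"

lemma proj_shift:
  assumes "SP g" "z \<in> slab"
  shows "proj g k (z + h *\<^sub>R ei i) = wave (k $ i) h * proj g k z"
proof -
  have 1: "A 1 n g (z + h *\<^sub>R ei 1) = wave n h * A 1 n g z" if "z \<in> slab" for n z h
    by (rule A_shift[OF assms(1) that])
  have 2: "A 2 n (A 1 m g) (z + h *\<^sub>R ei 2) = wave n h * A 2 n (A 1 m g) z" if "z \<in> slab" for n m z h
    by (rule A_shift[OF SP_A[OF assms(1)] that])
  have 3: "A 3 p (A 2 n (A 1 m g)) (z + h *\<^sub>R ei 3) = wave p h * A 3 p (A 2 n (A 1 m g)) z"
    if "z \<in> slab" for p n m z h
    by (rule A_shift[OF SP_A[OF SP_A[OF assms(1)]] that])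
  consider "i = 1" | "i = 2" | "i = 3" using exhaust_3[of i] by blast
  then show ?thesis
  proof cases
    case i: 1
    show ?thesis unfolding proj_def i
      by (rule A_eigen[OF _ assms(2)], rule A_eigen, rule 1)
  next
    case i: 2
    show ?thesis unfolding proj_def i by (rule A_eigen[OF _ assms(2)], rule 2)
  next
    case i: 3
    show ?thesis unfolding proj_def i by (rule 3[OF assms(2)])
  qed
qed

text \<open>The point x is reached from the origin by one shift along each axis; every shift
  contributes a wave, and the three waves multiply to \<open>mode k x\<close>.\<close>

lemma proj_eq:
  assumes "SP g" "t \<in> {0..T}"
  shows "proj g k (t, x) = coef g k t * mode k x"
proof -
  have z: "(t, 0) \<in> slab" using assms(2) by simp
  have eq: "(t, x) = (t, 0) + (x $ 1) *\<^sub>R ei 1 + (x $ 2) *\<^sub>R ei 2 + (x $ 3) *\<^sub>R ei 3"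
    by (simp add: ei_def vec_eq_iff forall_3 axis_def)
  have "proj g k (t, x) = wave (k $ 3) (x $ 3) * (wave (k $ 2) (x $ 2) * (wave (k $ 1) (x $ 1) * proj g k (t, 0)))"
    unfolding eq by (simp only: proj_shift[OF assms(1)] slab_shift z)
  also have "wave (k $ 3) (x $ 3) * (wave (k $ 2) (x $ 2) * (wave (k $ 1) (x $ 1) * proj g k (t, 0)))
      = coef g k t * (wave (k $ 1) (x $ 1) * wave (k $ 2) (x $ 2) * wave (k $ 3) (x $ 3))"
    by (simp add: coef_def)
  also have "wave (k $ 1) (x $ 1) * wave (k $ 2) (x $ 2) * wave (k $ 3) (x $ 3) = mode k x"
    by (simp add: wave_def mode_def cis_mult xi_def inner_vec_def sum_3)
  finally show ?thesis .
qed

text \<open>The derivative is commuted through the averages along the earlier axes until it meets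
  the average along its own axis, where \<open>A_parts\<close> applies; the later averages are
  linear.\<close>

lemma proj_D_space:
  assumes "SP g" "z \<in> slab"
  shows "proj (D (ei i) g) k z = \<i> * of_real (xi k $ i) * proj g k z"
proof -
  have g: "smooth_on g slab" using assms SP_def by auto
  have c: "\<i> * of_real (2 * pi / L * of_int (k $ j)) = \<i> * complex_of_real (xi k $ j)" for j by (simp add: xi_def)
  have 1: "A 1 (k $ 1) (D (ei 1) g) z = \<i> * of_real (xi k $ 1) * A 1 (k $ 1) g z" if "z \<in> slab" for z
    using A_parts[OF assms(1) that] c by metis
  have 2: "A 2 (k $ 2) (A n m (D (ei 2) g)) z = \<i> * of_real (xi k $ 2) * A 2 (k $ 2) (A n m g) z"
    if z: "z \<in> slab" for z n m
  proof -
    have "A 2 (k $ 2) (A n m (D (ei 2) g)) z = A 2 (k $ 2) (D (ei 2) (A n m g)) z"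
      by (rule A_cong[OF _ z]) (simp add: D_A[OF g])
    then show ?thesis using A_parts[OF SP_A[OF assms(1)] z] c by metis
  qed
  have 3: "A 3 (k $ 3) (A p q (A n m (D (ei 3) g))) z = \<i> * of_real (xi k $ 3) * A 3 (k $ 3) (A p q (A n m g)) z"
    if z: "z \<in> slab" for z n m p q
  proof -
    have "A p q (A n m (D (ei 3) g)) z = D (ei 3) (A p q (A n m g)) z" if z: "z \<in> slab" for z
    proof -
      have "A p q (A n m (D (ei 3) g)) z = A p q (D (ei 3) (A n m g)) z"
        by (rule A_cong[OF _ z]) (simp add: D_A[OF g])
      then show ?thesis using D_A[OF A_smooth[OF g] z] by simp
    qed
    then have "A 3 (k $ 3) (A p q (A n m (D (ei 3) g))) z = A 3 (k $ 3) (D (ei 3) (A p q (A n m g))) z"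
      by (rule A_cong[OF _ z])
    then show ?thesis using A_parts[OF SP_A[OF SP_A[OF assms(1)]] z] c by metis
  qed
  have cm: "A j n f z = c * A j n f' z" if "\<And>z. z \<in> slab \<Longrightarrow> f z = c * f' z" "z \<in> slab" for j n f f' c z
    using A_cong[of f "\<lambda>z. c * f' z" z j n] that A_cmult[of j n c f' z] by simp
  consider "i = 1" | "i = 2" | "i = 3" using exhaust_3[of i] by blast
  then show ?thesis
  proof cases
    case i: 1
    show ?thesis unfolding proj_def i
      by (rule cm[OF _ assms(2)], rule cm, rule 1)
  next
    case i: 2
    show ?thesis unfolding proj_def i by (rule cm[OF _ assms(2)], rule 2)
  next
    case i: 3
    show ?thesis unfolding proj_def i by (rule 3[OF assms(2)])
  qed
qed

lemma proj_D:
  assumes "smooth_on g slab" "z \<in> slab"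
  shows "proj (D v g) k z = D v (proj g k) z"
proof -
  have 2: "A p q (A n m (D v g)) z = D v (A p q (A n m g)) z" if z: "z \<in> slab" for z p q n m
  proof -
    have "A p q (A n m (D v g)) z = A p q (D v (A n m g)) z"
      by (rule A_cong[OF _ z]) (simp add: D_A[OF assms(1)])
    then show ?thesis using D_A[OF A_smooth[OF assms(1)] z] by simp
  qed
  have "A 3 (k $ 3) (A 2 (k $ 2) (A 1 (k $ 1) (D v g))) z = A 3 (k $ 3) (D v (A 2 (k $ 2) (A 1 (k $ 1) g))) z"
    by (rule A_cong[OF 2 assms(2)])
  then show ?thesis unfolding proj_def using D_A[OF A_smooth[OF A_smooth[OF assms(1)]] assms(2)] by simp
qed

lemma SP_bounded:
  assumes "SP g"
  obtains M where "M \<ge> 0" "\<And>z. z \<in> slab \<Longrightarrow> cmod (g z) \<le> M"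
proof -
  let ?K = "{0..T} \<times> cbox (0::real^3) (\<chi> i. L)"
  have g: "smooth_on g slab" "per g" using assms SP_def by auto
  have "compact (g ` ?K)"
    by (intro compact_continuous_image compact_Times compact_cbox compact_Icc
        continuous_on_subset[OF smooth_on_imp_continuous_on[OF g(1)]]) auto
  then obtain M where M: "\<And>z. z \<in> ?K \<Longrightarrow> cmod (g z) \<le> M"
    using compact_imp_bounded bounded_iff by (metis image_eqI)
  have "cmod (g z) \<le> M" if z: "z \<in> slab" for z
  proof -
    \<comment> \<open>The lattice translation that brings the point into the box with sides [0,L],
      where compactness gives the bound.\<close>
    define k :: "int^3" where "k = (\<chi> i. - \<lfloor>snd z $ i / L\<rfloor>)"
    have "z + (0, L *\<^sub>R (\<chi> i. of_int (k $ i))) \<in> ?K"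
    proof -
      have "0 \<le> snd z $ i + L * of_int (k $ i) \<and> snd z $ i + L * of_int (k $ i) \<le> L" for i
      proof -
        have "of_int \<lfloor>snd z $ i / L\<rfloor> \<le> snd z $ i / L" "snd z $ i / L \<le> of_int \<lfloor>snd z $ i / L\<rfloor> + 1"
          by linarith+
        then have "of_int \<lfloor>snd z $ i / L\<rfloor> * L \<le> snd z $ i" "snd z $ i \<le> (of_int \<lfloor>snd z $ i / L\<rfloor> + 1) * L"
          using L_pos by (simp_all only: pos_le_divide_eq pos_divide_le_eq)
        then show ?thesis by (simp add: k_def algebra_simps)
      qed
      then show ?thesis using z by (auto simp: mem_Times_iff mem_box_cart)
    qed
    then show ?thesis using M per_shift[OF g(2) z] by metis
  qed
  moreover have "0 \<le> M"
    using M[of "(0, 0)"] order_trans[OF norm_ge_zero] T_pos L_pos by (auto simp: mem_box_cart)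
  ultimately show thesis using that by blast
qed

lemma coef_bounded:
  assumes "SP g"
  obtains M where "M \<ge> 0" "\<And>k t. t \<in> {0..T} \<Longrightarrow> cmod (coef g k t) \<le> M"
proof -
  obtain M where M: "M \<ge> 0" "\<And>z. z \<in> slab \<Longrightarrow> cmod (g z) \<le> M" using SP_bounded[OF assms] by blast
  have g: "smooth_on g slab" using assms SP_def by auto
  have "cmod (proj g k z) \<le> M" if "z \<in> slab" for k z
    unfolding proj_def by (intro A_bound A_smooth g M that)
  then show thesis by (intro that[of M] M) (auto simp: coef_def)
qed

lemma coef_D_space:
  assumes "SP g" "t \<in> {0..T}"
  shows "coef (D (ei i) g) k t = \<i> * of_real (xi k $ i) * coef g k t"
  unfolding coef_def by (rule proj_D_space) (use assms in auto)

text \<open>Induction on the power, for all g at once: one more factor of the weight is 1 plus the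
  sum of the |k_i|, and |k_i| times a coefficient of g is, up to a constant, a coefficient of the
  i-th derivative of g, to which the induction hypothesis applies.\<close>

lemma coef_rapid:
  assumes "SP g" shows "rapid (coef g)"
  unfolding rapid_def
proof
  fix N
  have "\<exists>C\<ge>0. \<forall>k. \<forall>t\<in>{0..T}. cmod (coef g k t) * wt k ^ N \<le> C" using assms
  proof (induction N arbitrary: g)
    case 0
    then show ?case using coef_bounded[OF 0] by (metis mult.right_neutral power_0)
  next
    case (Suc N)
    obtain C where C: "C \<ge> 0" "\<And>k t. t \<in> {0..T} \<Longrightarrow> cmod (coef g k t) * wt k ^ N \<le> C"
      using Suc.IH[OF Suc.prems] by blast
    have "\<forall>i. \<exists>E\<ge>0. \<forall>k. \<forall>t\<in>{0..T}. cmod (coef (D (ei i) g) k t) * wt k ^ N \<le> E"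
      using Suc.IH[OF SP_D[OF Suc.prems]] by blast
    then obtain E where E: "\<And>i. E i \<ge> 0"
      "\<And>i k t. t \<in> {0..T} \<Longrightarrow> cmod (coef (D (ei i) g) k t) * wt k ^ N \<le> E i" by metis
    show ?case
    proof (intro exI[of _ "C + (\<Sum>i\<in>UNIV. E i * L / (2 * pi))"] conjI allI ballI)
      show "0 \<le> C + (\<Sum>i\<in>UNIV. E i * L / (2 * pi))"
        using C E L_pos by (intro add_nonneg_nonneg sum_nonneg) auto
      fix k t assume t: "t \<in> {0..T}"
      have i: "cmod (coef g k t) * wt k ^ N * \<bar>of_int (k $ i)\<bar> \<le> E i * L / (2 * pi)" for i
      proof -
        have "cmod (coef (D (ei i) g) k t) = 2 * pi / L * \<bar>of_int (k $ i)\<bar> * cmod (coef g k t)"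
          unfolding coef_D_space[OF Suc.prems t] norm_mult norm_ii norm_of_real mult_1
          using L_pos by (simp add: xi_def abs_mult)
        then have "cmod (coef g k t) * wt k ^ N * \<bar>of_int (k $ i)\<bar> * (2 * pi) = cmod (coef (D (ei i) g) k t) * wt k ^ N * L"
          using L_pos by simp
        also have "\<dots> \<le> E i * L" using E(2)[OF t, of i k] L_pos by (intro mult_right_mono) auto
        finally show ?thesis by (simp add: pos_le_divide_eq)
      qed
      have "cmod (coef g k t) * wt k ^ Suc N = cmod (coef g k t) * wt k ^ N
          + (\<Sum>i\<in>UNIV. cmod (coef g k t) * wt k ^ N * \<bar>of_int (k $ i)\<bar>)"
        by (simp add: wt_def[of k] sum_distrib_left distrib_left distrib_right mult_ac sum_distrib_right)
      also have "\<dots> \<le> C + (\<Sum>i\<in>UNIV. E i * L / (2 * pi))"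
        by (intro add_mono sum_mono C t i)
      finally show "cmod (coef g k t) * wt k ^ Suc N \<le> C + (\<Sum>i\<in>UNIV. E i * L / (2 * pi))" .
    qed
  qed
  then show "\<exists>C. \<forall>k. \<forall>t\<in>{0..T}. cmod (coef g k t) \<le> C / wt k ^ N"
    using wt_pos by (metis pos_le_divide_eq zero_less_power)
qed

lemma coef_has_derivative:
  assumes "SP g" "t \<in> {0..T}"
  shows "(coef g k has_vector_derivative coef (D (1, 0) g) k t) (at t within {0..T})"
proof -
  have g: "smooth_on g slab" using assms SP_def by auto
  have p: "smooth_on (proj g k) slab" unfolding proj_def by (intro A_smooth g)
  have "((\<lambda>s. proj g k (s, 0)) has_vector_derivative D (1, 0) (proj g k) (t, 0)) (at t within {0..T})"
    by (rule slab_derivative_time[OF D_works[OF p]]) (use assms in auto)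
  moreover have "D (1, 0) (proj g k) (t, 0) = proj (D (1, 0) g) k (t, 0)"
    using proj_D[OF g] assms(2) by simp
  ultimately show ?thesis by (simp add: coef_def[abs_def])
qed

lemma coef_reg: "SP g \<Longrightarrow> reg j (coef g)"
proof (induction j arbitrary: g)
  case 0
  then show ?case
    using coef_rapid continuous_on_vector_derivative[OF coef_has_derivative[OF 0]] by auto
next
  case (Suc j)
  show ?case
    by (rule reg_SucI[OF coef_rapid[OF Suc.prems] Suc.IH[OF SP_D[OF Suc.prems]] coef_has_derivative[OF Suc.prems]])
qed

lemma coef_sreg: "SP g \<Longrightarrow> sreg (coef g)"
  using coef_reg sreg_def by blast

text \<open>Two integrations by parts give quadratic decay in n, hence the summability that
  \<open>fourier_inversion_at_0\<close> asks for; that lemma is then applied on the line through z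
  along axis i.\<close>

lemma A_has_sum:
  assumes "SP g" "z \<in> slab"
  shows "((\<lambda>n. A i n g z) has_sum g z) UNIV"
proof -
  have g: "smooth_on g slab" "per g" using assms SP_def by auto
  let ?g2 = "D (ei i) (D (ei i) g)"
  obtain M where M: "M \<ge> 0" "\<And>z. z \<in> slab \<Longrightarrow> cmod (g z) \<le> M" using SP_bounded[OF assms(1)] by blast
  obtain M2 where M2: "M2 \<ge> 0" "\<And>z. z \<in> slab \<Longrightarrow> cmod (?g2 z) \<le> M2"
    using SP_bounded[OF SP_D[OF SP_D[OF assms(1)]]] by blast
  define \<alpha> where "\<alpha> = 2 * pi / L"
  have \<alpha>: "\<alpha> > 0" using L_pos by (simp add: \<alpha>_def)
  \<comment> \<open>The bound on g covers small n, the bound on its second derivative large n; the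
    inequality (1 + |n|)^2 \<le> 2 (1 + n^2) merges the two.\<close>
  have b: "cmod (A i n g z) \<le> (2 * (M + M2 / \<alpha>^2)) * (1 / (1 + \<bar>of_int n\<bar>) ^ 2)" for n
  proof -
    have "A i n ?g2 z = \<i> * of_real (\<alpha> * of_int n) * (\<i> * of_real (\<alpha> * of_int n) * A i n g z)"
      using A_parts[OF SP_D[OF assms(1)] assms(2)] A_parts[OF assms] by (simp add: \<alpha>_def)
    then have "cmod (A i n ?g2 z) = (\<alpha> * of_int n)\<^sup>2 * cmod (A i n g z)"
      using \<alpha> by (simp add: norm_mult power2_eq_square abs_mult_self_eq mult_ac abs_mult)
    moreover have "cmod (A i n ?g2 z) \<le> M2" by (intro A_bound D_smooth g M2 assms(2))
    ultimately have 2: "(of_int n)\<^sup>2 * cmod (A i n g z) \<le> M2 / \<alpha>^2"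
      using \<alpha> by (simp add: field_simps power_mult_distrib)
    have 1: "cmod (A i n g z) \<le> M" by (intro A_bound g M assms(2))
    have "(1 + \<bar>of_int n :: real\<bar>)\<^sup>2 \<le> 2 * (1 + (of_int n)\<^sup>2)"
      using sum_squares_ge_zero[of "1 - \<bar>of_int n :: real\<bar>" 0]
      by (simp add: power2_eq_square algebra_simps)
    then have "(1 + \<bar>of_int n :: real\<bar>)\<^sup>2 * cmod (A i n g z) \<le> 2 * (1 + (of_int n)\<^sup>2) * cmod (A i n g z)"
      by (intro mult_right_mono) auto
    also have "\<dots> = 2 * (cmod (A i n g z) + (of_int n)\<^sup>2 * cmod (A i n g z))" by (simp add: algebra_simps)
    also have "\<dots> \<le> 2 * (M + M2 / \<alpha>^2)" using 1 2 by (intro mult_left_mono add_mono) auto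
    finally have "(1 + \<bar>of_int n :: real\<bar>)\<^sup>2 * cmod (A i n g z) \<le> 2 * (M + M2 / \<alpha>^2)" .
    moreover have "0 < (1 + \<bar>of_int n :: real\<bar>)\<^sup>2" by (simp add: add_pos_nonneg)
    ultimately show ?thesis by (simp add: pos_le_divide_eq mult.commute)
  qed
  have s: "(\<lambda>n. A i n g z) summable_on UNIV"
    by (rule norm_summable_imp_summable(2)[OF b])
      (intro summable_on_cmult_right summable_int_inverse_square)
  have "((\<lambda>n. fc n (\<lambda>s. g (z + s *\<^sub>R ei i))) has_sum g (z + 0 *\<^sub>R ei i)) UNIV"
  proof (rule fourier_inversion_at_0)
    show "continuous_on UNIV (\<lambda>s. g (z + s *\<^sub>R ei i))" by (rule continuous_on_line[OF g(1) assms(2)])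
    show "g (z + (s + L * of_int m) *\<^sub>R ei i) = g (z + s *\<^sub>R ei i)" for s m
      using per_axis[OF g(2), of "z + s *\<^sub>R ei i" m i] assms(2) by (simp add: scaleR_add_left add_ac)
    show "((\<lambda>s. g (z + s *\<^sub>R ei i)) has_vector_derivative D (ei i) g (z + 0 *\<^sub>R ei i)) (at 0)"
      by (rule line_derivative[OF g(1) assms(2)])
    show "(\<lambda>n. fc n (\<lambda>s. g (z + s *\<^sub>R ei i))) summable_on UNIV" using s by (simp add: A_def)
  qed
  then show ?thesis by (simp add: A_def)
qed

text \<open>The triple series converges absolutely, so it may be summed one coordinate at a time,
  innermost first; each of the three sums is an instance of \<open>A_has_sum\<close>.\<close>

theorem fourier_inversion:
  assumes "SP g" "z \<in> slab"
  shows "synth (coef g) z = g z"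
proof -
  obtain t x where z: "z = (t, x)" "t \<in> {0..T}" using assms(2) by auto
  define F where "F k = coef g k t * mode k x" for k
  let ?v = "\<lambda>(a, b, c). vector [a, b, c] :: int^3"
  have F: "F (vector [a, b, c]) = A 3 c (A 2 b (A 1 a g)) z" for a b c
    using proj_eq[OF assms(1) z(2), of "vector [a, b, c]" x] by (simp add: F_def proj_def z)
  have "F summable_on UNIV" unfolding F_def by (rule rapid_summable[OF coef_rapid[OF assms(1)] z(2)])
  then have s: "(\<lambda>p. F (?v p)) summable_on UNIV \<times> UNIV \<times> UNIV"
    using summable_on_reindex_bij_betw[OF bij_int3, of F] by blast
  have s2: "(\<lambda>q. F (?v (a, q))) summable_on UNIV \<times> UNIV" for a
    by (rule summable_on_SigmaD1[where f = "\<lambda>a q. F (?v (a, q))" and A = UNIV and x = a])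
      (use s in \<open>auto simp: case_prod_unfold\<close>)
  have "synth (coef g) z = (\<Sum>\<^sub>\<infinity>k. F k)" by (simp add: synth_def F_def z)
  also have "\<dots> = infsum (\<lambda>p. F (?v p)) (UNIV \<times> UNIV \<times> UNIV)"
    by (rule infsum_reindex_bij_betw[OF bij_int3, symmetric])
  also have "\<dots> = (\<Sum>\<^sub>\<infinity>a. infsum (\<lambda>q. F (?v (a, q))) (UNIV \<times> UNIV))"
    by (rule infsum_Sigma_banach[OF s, symmetric])
  also have "\<dots> = (\<Sum>\<^sub>\<infinity>a. \<Sum>\<^sub>\<infinity>b. \<Sum>\<^sub>\<infinity>c. F (?v (a, b, c)))"
    by (intro infsum_cong infsum_Sigma_banach[OF s2, symmetric])
  also have "\<dots> = (\<Sum>\<^sub>\<infinity>a. \<Sum>\<^sub>\<infinity>b. \<Sum>\<^sub>\<infinity>c. A 3 c (A 2 b (A 1 a g)) z)"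
    by (simp add: F)
  also have "\<dots> = (\<Sum>\<^sub>\<infinity>a. \<Sum>\<^sub>\<infinity>b. A 2 b (A 1 a g) z)"
    by (intro infsum_cong infsumI A_has_sum SP_A assms)
  also have "\<dots> = (\<Sum>\<^sub>\<infinity>a. A 1 a g z)"
    by (intro infsum_cong infsumI A_has_sum SP_A assms)
  also have "\<dots> = g z"
    by (intro infsumI A_has_sum assms)
  finally show ?thesis .
qed

lemma fc_cnj: "fc (- n) (\<lambda>s. cnj (f s)) = cnj (fc n f)"
  unfolding fc_def by (simp add: integral_cnj cnj_wave)

lemma A_cnj: "A i (- n) (\<lambda>z. cnj (g z)) z = cnj (A i n g z)"
  unfolding A_def by (rule fc_cnj)

lemma coef_hermitian:
  assumes "\<And>z. cnj (g z) = g z"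
  shows "coef g (- k) t = cnj (coef g k t)"
proof -
  have 1: "A 1 (- n) g = (\<lambda>z. cnj (A 1 n g z))" for n
    using A_cnj[of 1 n g] assms by (simp add: fun_eq_iff)
  have 2: "A 2 (- m) (A 1 (- n) g) = (\<lambda>z. cnj (A 2 m (A 1 n g) z))" for m n
    unfolding 1 by (simp add: fun_eq_iff A_cnj)
  show ?thesis unfolding coef_def proj_def vector_uminus_component 2 by (rule A_cnj)
qed

subsection \<open>The Duhamel integral\<close>

text \<open>The solution of y' = n - c y with y 0 = 0, that is, the response of a heat mode with
  decay rate c. Pulling exp (- c t) out of the integral leaves t only in the upper limit, so the
  derivative follows from the product rule.\<close>

definition duh :: "real \<Rightarrow> (real \<Rightarrow> complex) \<Rightarrow> real \<Rightarrow> complex" where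
  "duh c n t = exp (- c * t) *\<^sub>R integral {0..t} (\<lambda>s. exp (c * s) *\<^sub>R n s)"

lemma duh_cont_sub:
  fixes n :: "real \<Rightarrow> complex"
  assumes "continuous_on {0..T} n" "t \<in> {0..T}"
  shows "continuous_on {0..t} (\<lambda>s. exp (c * s) *\<^sub>R n s)"
  by (intro continuous_intros continuous_on_subset[OF assms(1)]) (use assms in auto)

lemma duh_integrable:
  fixes n :: "real \<Rightarrow> complex"
  assumes "continuous_on {0..T} n" "t \<in> {0..T}"
  shows "(\<lambda>s. exp (c * s) *\<^sub>R n s) integrable_on {0..t}"
  by (rule integrable_continuous_real[OF duh_cont_sub[OF assms]])

lemma duh_0 [simp]: "duh c n 0 = 0"
  by (simp add: duh_def)

lemma duh_has_derivative:
  assumes "continuous_on {0..T} n" "t \<in> {0..T}"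
  shows "(duh c n has_vector_derivative n t - c *\<^sub>R duh c n t) (at t within {0..T})"
proof -
  have "((\<lambda>u. integral {0..u} (\<lambda>s. exp (c * s) *\<^sub>R n s)) has_vector_derivative exp (c * t) *\<^sub>R n t) (at t within {0..T})"
    by (rule integral_has_vector_derivative) (use assms in \<open>auto intro!: continuous_intros\<close>)
  moreover have "((\<lambda>t. exp (- c * t)) has_field_derivative - c * exp (- c * t)) (at t within {0..T})"
    by (auto intro!: derivative_eq_intros)
  ultimately have "(duh c n has_vector_derivative
      exp (- c * t) *\<^sub>R (exp (c * t) *\<^sub>R n t) + (- c * exp (- c * t)) *\<^sub>R integral {0..t} (\<lambda>s. exp (c * s) *\<^sub>R n s))
      (at t within {0..T})"
    unfolding duh_def[abs_def] by (intro has_vector_derivative_scaleR)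
  then show ?thesis by (simp add: duh_def exp_minus field_simps)
qed

text \<open>A source growing like exp (mu s) has a response of the same growth, smaller by the
  factor 1 / (c + mu). This is used with mu > 0 for the contraction and with mu = 0 for the gain of
  decay at nonzero frequencies.\<close>

lemma duh_bound:
  assumes n: "continuous_on {0..T} n" and t: "t \<in> {0..T}" and c: "0 < c + \<mu>" and B: "0 \<le> B"
    and b: "\<And>s. s \<in> {0..t} \<Longrightarrow> cmod (n s) \<le> B * exp (\<mu> * s)"
  shows "cmod (duh c n t) \<le> B * exp (\<mu> * t) / (c + \<mu>)"
proof -
  have i: "((\<lambda>s. B * exp ((c + \<mu>) * s)) has_integral
      (B * exp ((c + \<mu>) * t) / (c + \<mu>) - B * exp ((c + \<mu>) * 0) / (c + \<mu>))) {0..t}"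
  proof (rule fundamental_theorem_of_calculus)
    show "((\<lambda>s. B * exp ((c + \<mu>) * s) / (c + \<mu>)) has_vector_derivative B * exp ((c + \<mu>) * s)) (at s within {0..t})" for s
      unfolding has_real_derivative_iff_has_vector_derivative[symmetric]
      using c by (auto intro!: derivative_eq_intros)
  qed (use t in auto)
  have "cmod (integral {0..t} (\<lambda>s. exp (c * s) *\<^sub>R n s)) \<le> integral {0..t} (\<lambda>s. B * exp ((c + \<mu>) * s))"
  proof (rule Henstock_Kurzweil_Integration.integral_norm_bound_integral)
    show "(\<lambda>s. exp (c * s) *\<^sub>R n s) integrable_on {0..t}" by (rule duh_integrable[OF n t])
    show "(\<lambda>s. B * exp ((c + \<mu>) * s)) integrable_on {0..t}" using i by blast
    fix s assume s: "s \<in> {0..t}"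
    have "cmod (exp (c * s) *\<^sub>R n s) \<le> exp (c * s) * (B * exp (\<mu> * s))"
      using b[OF s] by (simp add: mult_left_mono)
    also have "exp (c * s) * (B * exp (\<mu> * s)) = B * exp ((c + \<mu>) * s)"
      by (simp add: distrib_right exp_add)
    finally show "cmod (exp (c * s) *\<^sub>R n s) \<le> B * exp ((c + \<mu>) * s)" .
  qed
  also have "\<dots> \<le> B * exp ((c + \<mu>) * t) / (c + \<mu>)"
    using integral_unique[OF i] B c by simp
  finally have "exp (- c * t) * cmod (integral {0..t} (\<lambda>s. exp (c * s) *\<^sub>R n s))
      \<le> exp (- c * t) * (B * exp ((c + \<mu>) * t) / (c + \<mu>))" by (intro mult_left_mono) auto
  also have "\<dots> = B * (exp (- c * t) * exp ((c + \<mu>) * t)) / (c + \<mu>)" by simp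
  also have "exp (- c * t) * exp ((c + \<mu>) * t) = exp (\<mu> * t)"
    by (simp add: exp_add[symmetric] algebra_simps)
  finally show ?thesis by (simp add: duh_def)
qed

text \<open>No gain from c, but valid at c = 0; it is used for sources whose decay in k is already
  sufficient.\<close>

lemma duh_bound_T:
  assumes n: "continuous_on {0..T} n" and t: "t \<in> {0..T}" and c: "0 \<le> c"
    and b: "\<And>s. s \<in> {0..t} \<Longrightarrow> cmod (n s) \<le> B"
  shows "cmod (duh c n t) \<le> T * B"
proof -
  have B: "0 \<le> B" using b[of 0] t order_trans[OF norm_ge_zero] by auto
  have "cmod (integral {0..t} (\<lambda>s. exp (c * s) *\<^sub>R n s)) \<le> (exp (c * t) * B) * (t - 0)"
  proof (rule integral_bound)
    fix s assume s: "s \<in> {0..t}"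
    then have "exp (c * s) \<le> exp (c * t)" using c by (auto intro: mult_left_mono)
    then show "cmod (exp (c * s) *\<^sub>R n s) \<le> exp (c * t) * B"
      using b[OF s] by (simp add: mult_mono)
  qed (use t duh_cont_sub[OF n t] in auto)
  then have "exp (- c * t) * cmod (integral {0..t} (\<lambda>s. exp (c * s) *\<^sub>R n s)) \<le> exp (- c * t) * (exp (c * t) * B * t)"
    by (intro mult_left_mono) auto
  also have "\<dots> = t * B" by (simp add: exp_minus)
  also have "\<dots> \<le> T * B" using t B by (intro mult_right_mono) auto
  finally show ?thesis by (simp add: duh_def)
qed

lemma duh_cong: "(\<And>s. s \<in> {0..t} \<Longrightarrow> n s = n' s) \<Longrightarrow> duh c n t = duh c n' t"
  unfolding duh_def by (metis (no_types, lifting) Henstock_Kurzweil_Integration.integral_cong)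

lemma duh_diff:
  assumes "continuous_on {0..T} n" "continuous_on {0..T} n'" "t \<in> {0..T}"
  shows "duh c n t - duh c n' t = duh c (\<lambda>s. n s - n' s) t"
  unfolding duh_def scaleR_right_diff_distrib[symmetric]
  using integral_diff[OF duh_integrable[OF assms(1,3)] duh_integrable[OF assms(2,3)], of c c]
  by (simp add: scaleR_right_diff_distrib)

lemma duh_zero [simp]: "duh c (\<lambda>s. 0) t = 0"
  by (simp add: duh_def)

lemma duh_cnj: "duh c (\<lambda>s. cnj (n s)) t = cnj (duh c n t)"
  unfolding duh_def complex_cnj_scaleR integral_cnj by simp

lemma duh_continuous: "continuous_on {0..T} n \<Longrightarrow> continuous_on {0..T} (duh c n)"
  by (rule continuous_on_vector_derivative[OF duh_has_derivative])

subsection \<open>Rapidly oscillating forces\<close>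

lemma continuous_chirp: "continuous_on S (\<lambda>s. cis (r * s\<^sup>2))"
  by (intro continuous_on_compose2[OF continuous_on_cis[of UNIV "\<lambda>x. x"]] continuous_intros) auto

text \<open>The phase is stationary at s = 0 only. The interval from 0 to \<open>\<delta>\<close>
  contributes at most its length; on the rest, integration by parts gains a factor 1 /
  \<open>\<kappa>\<close>.\<close>

lemma oscillatory_integral_small:
  assumes "\<theta> \<noteq> 0" "\<epsilon> > 0"
  shows "\<exists>\<Lambda>>0. \<forall>\<kappa>\<ge>\<Lambda>. \<forall>t\<in>{0..T}. cmod (integral {0..t} (\<lambda>s. cis (\<theta> * \<kappa> * s\<^sup>2))) \<le> \<epsilon>"
proof -
  define \<delta> where "\<delta> = \<epsilon> / 2"
  have \<delta>: "\<delta> > 0" using assms by (simp add: \<delta>_def)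
  \<comment> \<open>\<open>K\<close> / \<open>\<kappa>\<close> is the sum of the bounds for the two
    boundary terms, together 1 / (|r| \<open>\<delta>\<close>), and for the remaining integral, T /
    (2 |r| \<open>\<delta>\<^sup>2\<close>), where |r| = |\<open>\<theta>\<close>|
    \<open>\<kappa>\<close>.\<close>
  define K where "K = 1 / (\<bar>\<theta>\<bar> * \<delta>) + T / (2 * \<bar>\<theta>\<bar> * \<delta>\<^sup>2)"
  have K: "K > 0" using assms \<delta> T_pos by (simp add: K_def add_pos_pos)
  show ?thesis
  proof (intro exI[of _ "K / \<delta>"] conjI allI impI ballI)
    show "0 < K / \<delta>" using K \<delta> by simp
    fix \<kappa> t assume \<kappa>: "K / \<delta> \<le> \<kappa>" and t: "t \<in> {0..T}"
    have \<kappa>0: "\<kappa> > 0" using \<kappa> K \<delta> divide_pos_pos[OF K \<delta>] by linarith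
    define r where "r = \<theta> * \<kappa>"
    have r: "r \<noteq> 0" "\<bar>r\<bar> = \<bar>\<theta>\<bar> * \<kappa>" using assms \<kappa>0 by (auto simp: r_def abs_mult)
    let ?f = "\<lambda>s. cis (r * s\<^sup>2)"
    have fc: "continuous_on S ?f" for S by (rule continuous_chirp)
    have small: "cmod (integral {0..u} ?f) \<le> \<delta>" if "0 \<le> u" "u \<le> \<delta>" for u
      using integral_bound[OF that(1) fc, of 1] that by simp
    show "cmod (integral {0..t} (\<lambda>s. cis (\<theta> * \<kappa> * s\<^sup>2))) \<le> \<epsilon>"
    proof (cases "t \<le> \<delta>")
      case True
      then show ?thesis using small[of t] t \<delta> by (simp add: r_def \<delta>_def)
    next
      case False
      \<comment> \<open>The integrand divided by the derivative 2 i r s of its exponent: an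
        approximate primitive, whose derivative misses the integrand by a term of order 1 / (r
        s^2).\<close>
      define u where "u s = ?f s / (2 * \<i> * of_real r * of_real s)" for s
      have cd: "(?f has_vector_derivative \<i> * of_real (2 * r * s) * ?f s) (at s within S)" for s S
        by (rule has_vector_derivative_cis) (auto intro!: derivative_eq_intros)
      have "(u has_vector_derivative ?f s - ?f s / (2 * \<i> * of_real r * (of_real s)\<^sup>2)) (at s within {\<delta>..t})"
        if "s \<in> {\<delta>..t}" for s
      proof -
        have s: "s > 0" using that \<delta> by simp
        have "((\<lambda>s. inverse s) has_field_derivative - (inverse s ^ 2)) (at s within {\<delta>..t})"
          using s by (auto intro!: derivative_eq_intros simp: power2_eq_square)
        from has_vector_derivative_scaleR[OF this cd[of s "{\<delta>..t}"]]
        have "((\<lambda>s. inverse s *\<^sub>R ?f s / (2 * \<i> * of_real r)) has_vector_derivative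
           (inverse s *\<^sub>R (\<i> * of_real (2 * r * s) * ?f s) + (- (inverse s ^ 2)) *\<^sub>R ?f s) / (2 * \<i> * of_real r)) (at s within {\<delta>..t})"
          by (rule has_vector_derivative_divide)
        moreover have "(inverse s *\<^sub>R (\<i> * of_real (2 * r * s) * ?f s) + (- (inverse s ^ 2)) *\<^sub>R ?f s) / (2 * \<i> * of_real r)
            = ?f s - ?f s / (2 * \<i> * of_real r * (of_real s)\<^sup>2)"
          using s r by (simp add: field_simps scaleR_conv_of_real power2_eq_square)
        moreover have "(\<lambda>s. inverse s *\<^sub>R ?f s / (2 * \<i> * of_real r)) = u"
          by (simp add: u_def fun_eq_iff scaleR_conv_of_real field_simps)
        ultimately show ?thesis by simp
      qed
      then have "((\<lambda>s. ?f s - ?f s / (2 * \<i> * of_real r * (of_real s)\<^sup>2)) has_integral (u t - u \<delta>)) {\<delta>..t}"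
        using False by (intro fundamental_theorem_of_calculus) auto
      moreover have c2: "continuous_on {\<delta>..t} (\<lambda>s. ?f s / (2 * \<i> * of_real r * (of_real s)\<^sup>2))"
        using r \<delta> by (intro continuous_intros fc) auto
      ultimately have "((\<lambda>s. (?f s - ?f s / (2 * \<i> * of_real r * (of_real s)\<^sup>2)) + ?f s / (2 * \<i> * of_real r * (of_real s)\<^sup>2)) has_integral
          (u t - u \<delta>) + integral {\<delta>..t} (\<lambda>s. ?f s / (2 * \<i> * of_real r * (of_real s)\<^sup>2))) {\<delta>..t}"
        by (intro has_integral_add integrable_integral integrable_continuous_real)
      then have eq: "integral {\<delta>..t} ?f = u t - u \<delta> + integral {\<delta>..t} (\<lambda>s. ?f s / (2 * \<i> * of_real r * (of_real s)\<^sup>2))"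
        by (simp add: integral_unique)
      have ub: "cmod (u s) \<le> 1 / (2 * \<bar>r\<bar> * \<delta>)" if "\<delta> \<le> s" for s
        using that \<delta> r \<kappa>0 by (auto simp: u_def norm_divide norm_mult intro!: divide_left_mono mult_left_mono mult_pos_pos)
      have "cmod (integral {\<delta>..t} (\<lambda>s. ?f s / (2 * \<i> * of_real r * (of_real s)\<^sup>2))) \<le> 1 / (2 * \<bar>r\<bar> * \<delta>\<^sup>2) * (t - \<delta>)"
      proof (rule integral_bound)
        fix s assume s: "s \<in> {\<delta>..t}"
        then have "\<delta>\<^sup>2 \<le> s\<^sup>2" using \<delta> by (intro power_mono) auto
        then show "cmod (?f s / (2 * \<i> * of_real r * (of_real s)\<^sup>2)) \<le> 1 / (2 * \<bar>r\<bar> * \<delta>\<^sup>2)"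
          using s \<delta> r \<kappa>0 by (auto simp: norm_divide norm_mult norm_power intro!: divide_left_mono mult_left_mono mult_pos_pos)
      qed (use False c2 in auto)
      also have "\<dots> \<le> 1 / (2 * \<bar>r\<bar> * \<delta>\<^sup>2) * T"
        using t \<delta> r by (intro mult_left_mono) auto
      finally have "cmod (integral {\<delta>..t} ?f) \<le> 1 / (2 * \<bar>r\<bar> * \<delta>) + 1 / (2 * \<bar>r\<bar> * \<delta>) + T / (2 * \<bar>r\<bar> * \<delta>\<^sup>2)"
        unfolding eq using ub[of t] ub[of \<delta>] False
        by (intro order_trans[OF norm_triangle_ineq] add_mono order_trans[OF norm_triangle_ineq4]) auto
      also have "\<dots> = K / \<kappa>"
        using r \<kappa>0 \<delta> assms by (simp add: K_def field_simps)
      also have "\<dots> \<le> \<delta>" using \<kappa> \<kappa>0 \<delta> by (simp add: field_simps)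
      finally have 2: "cmod (integral {\<delta>..t} ?f) \<le> \<delta>" .
      have "integral {0..\<delta>} ?f + integral {\<delta>..t} ?f = integral {0..t} ?f"
        using False \<delta> by (intro Henstock_Kurzweil_Integration.integral_combine integrable_continuous_real fc) auto
      then have "cmod (integral {0..t} ?f) \<le> \<delta> + \<delta>"
        using norm_triangle_mono[OF small[of \<delta>] 2] \<delta> by simp
      then show ?thesis by (simp add: r_def \<delta>_def)
    qed
  qed
qed

text \<open>Integration by parts replaces the oscillating factor by its primitive \<open>E\<close>,
  uniformly small by \<open>oscillatory_integral_small\<close>, at the cost of one derivative of the
  amplitude. The threshold may depend on c and g, hence on the mode.\<close>

lemma duh_oscillating_small:
  assumes \<theta>: "\<theta> \<noteq> 0" and \<epsilon>: "\<epsilon> > 0" and c: "0 \<le> c"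
    and g: "\<And>t. t \<in> {0..T} \<Longrightarrow> (g has_vector_derivative g' t) (at t within {0..T})"
    and g': "continuous_on {0..T} g'"
  shows "\<exists>\<Lambda>>0. \<forall>\<kappa>\<ge>\<Lambda>. \<forall>t\<in>{0..T}. cmod (duh c (\<lambda>s. cis (\<theta> * \<kappa> * s\<^sup>2) * g s) t) \<le> \<epsilon>"
proof -
  define G where "G s = exp (c * s) *\<^sub>R g s" for s
  define G' where "G' s = exp (c * s) *\<^sub>R g' s + (c * exp (c * s)) *\<^sub>R g s" for s
  have gc: "continuous_on {0..T} g" by (rule continuous_on_vector_derivative[OF g])
  have Gc: "continuous_on {0..T} G" "continuous_on {0..T} G'"
    unfolding G_def G'_def by (intro continuous_intros gc g')+
  have Gd: "(G has_vector_derivative G' t) (at t within {0..T})" if "t \<in> {0..T}" for t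
    unfolding G_def G'_def
    by (rule has_vector_derivative_scaleR[OF _ g[OF that]]) (auto intro!: derivative_eq_intros)
  have bdd: "\<exists>M\<ge>0. \<forall>t\<in>{0..T}. cmod (f t) \<le> M" if "continuous_on {0..T} f" for f :: "real \<Rightarrow> complex"
  proof -
    have "compact (f ` {0..T})" by (intro compact_continuous_image that compact_Icc)
    then obtain M where M: "\<And>t. t \<in> {0..T} \<Longrightarrow> cmod (f t) \<le> M"
      using compact_imp_bounded bounded_iff by (metis image_eqI)
    moreover have "0 \<le> M" using M[of 0] T_pos order_trans[OF norm_ge_zero] by auto
    ultimately show ?thesis by blast
  qed
  obtain M where M: "M \<ge> 0" "\<And>t. t \<in> {0..T} \<Longrightarrow> cmod (G t) \<le> M" using bdd[OF Gc(1)] by blast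
  obtain M' where M': "M' \<ge> 0" "\<And>t. t \<in> {0..T} \<Longrightarrow> cmod (G' t) \<le> M'" using bdd[OF Gc(2)] by blast
  \<comment> \<open>Boundary term and integral are at most M \<open>\<eta>\<close> and M' T
    \<open>\<eta>\<close>, which together must not exceed \<open>\<epsilon>\<close>; the added 1
    keeps the denominator positive.\<close>
  define \<eta> where "\<eta> = \<epsilon> / (M + M' * T + 1)"
  have pos: "M + M' * T + 1 > 0" using M M' T_pos by (simp add: add_nonneg_pos)
  have \<eta>: "\<eta> > 0" using \<epsilon> pos by (simp add: \<eta>_def)
  obtain \<Lambda> where \<Lambda>: "\<Lambda> > 0" "\<And>\<kappa> t. \<kappa> \<ge> \<Lambda> \<Longrightarrow> t \<in> {0..T} \<Longrightarrow>
      cmod (integral {0..t} (\<lambda>s. cis (\<theta> * \<kappa> * s\<^sup>2))) \<le> \<eta>"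
    using oscillatory_integral_small[OF \<theta> \<eta>] by blast
  show ?thesis
  proof (intro exI[of _ \<Lambda>] conjI allI impI ballI \<Lambda>(1))
    fix \<kappa> t assume \<kappa>: "\<kappa> \<ge> \<Lambda>" and t: "t \<in> {0..T}"
    let ?f = "\<lambda>s. cis (\<theta> * \<kappa> * s\<^sup>2)"
    define E where "E u = integral {0..u} ?f" for u
    have E: "cmod (E u) \<le> \<eta>" if "u \<in> {0..T}" for u unfolding E_def by (rule \<Lambda>(2)[OF \<kappa> that])
    have fc: "continuous_on S ?f" for S by (rule continuous_chirp)
    have Ed: "(E has_vector_derivative ?f u) (at u within {0..T})" if "u \<in> {0..T}" for u
      unfolding E_def by (rule integral_has_vector_derivative[OF fc that])
    have Ec: "continuous_on {0..T} E" by (rule continuous_on_vector_derivative[OF Ed])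
    have sub: "{0..t} \<subseteq> {0..T}" using t by auto
    have "((\<lambda>s. G s * ?f s + G' s * E s) has_integral (G t * E t - G 0 * E 0)) {0..t}"
    proof (rule fundamental_theorem_of_calculus)
      show "((\<lambda>s. G s * E s) has_vector_derivative G s * ?f s + G' s * E s) (at s within {0..t})" if "s \<in> {0..t}" for s
        using has_vector_derivative_mult[OF Gd[of s] Ed[of s]] that sub
        by (intro has_vector_derivative_within_subset[OF _ sub]) auto
    qed (use t in auto)
    moreover have i2: "((\<lambda>s. G' s * E s) has_integral integral {0..t} (\<lambda>s. G' s * E s)) {0..t}"
      by (intro integrable_integral integrable_continuous_real continuous_on_mult
          continuous_on_subset[OF Gc(2) sub] continuous_on_subset[OF Ec sub])
    ultimately have "((\<lambda>s. (G s * ?f s + G' s * E s) - G' s * E s) has_integral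
        (G t * E t - G 0 * E 0) - integral {0..t} (\<lambda>s. G' s * E s)) {0..t}"
      by (rule has_integral_diff)
    moreover have "E 0 = 0" by (simp add: E_def)
    ultimately have eq: "integral {0..t} (\<lambda>s. G s * ?f s) = G t * E t - integral {0..t} (\<lambda>s. G' s * E s)"
      by (simp add: integral_unique)
    have "cmod (integral {0..t} (\<lambda>s. G' s * E s)) \<le> (M' * \<eta>) * (t - 0)"
    proof (rule integral_bound)
      show "continuous_on {0..t} (\<lambda>s. G' s * E s)"
        by (intro continuous_on_mult continuous_on_subset[OF Gc(2) sub] continuous_on_subset[OF Ec sub])
      show "cmod (G' s * E s) \<le> M' * \<eta>" if "s \<in> {0..t}" for s
        unfolding norm_mult using that sub M' E by (intro mult_mono) auto
    qed (use t in auto)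
    also have "\<dots> \<le> M' * \<eta> * T" using t M' \<eta> by (intro mult_left_mono) auto
    finally have "cmod (integral {0..t} (\<lambda>s. G s * ?f s)) \<le> M * \<eta> + M' * \<eta> * T"
      unfolding eq using M(1) M(2)[OF t] E[OF t] \<eta>
      by (intro order_trans[OF norm_triangle_ineq4] add_mono) (auto simp: norm_mult intro: mult_mono)
    also have "\<dots> = (M + M' * T) * \<eta>" by (simp add: algebra_simps)
    also have "\<dots> \<le> (M + M' * T + 1) * \<eta>" using \<eta> by (intro mult_right_mono) auto
    also have "\<dots> = \<epsilon>" using pos by (simp add: \<eta>_def)
    finally have b: "cmod (integral {0..t} (\<lambda>s. G s * ?f s)) \<le> \<epsilon>" .
    have "duh c (\<lambda>s. ?f s * g s) t = exp (- c * t) *\<^sub>R integral {0..t} (\<lambda>s. G s * ?f s)"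
      unfolding duh_def by (simp add: G_def mult_ac)
    moreover have "exp (- c * t) \<le> 1" using c t by simp
    ultimately show "cmod (duh c (\<lambda>s. ?f s * g s) t) \<le> \<epsilon>"
      using mult_mono[OF \<open>exp (- c * t) \<le> 1\<close> b] by simp
  qed
qed

text \<open>For modes with wt k at least \<open>R\<close> the extra power in the decay of h (7
  against 6) gives the bound for every \<open>\<kappa>\<close>. Only finitely many modes remain,
  each with its own threshold, and the sum of these thresholds serves them all. The mode k = 0 has
  no oscillation, hence the hypothesis on \<open>h 0\<close>.\<close>

lemma linear_response_small:
  assumes h: "sreg h" and h0: "\<And>t. h 0 t = 0" and \<omega>: "\<And>k. k \<noteq> 0 \<Longrightarrow> xi k \<bullet> \<omega> \<noteq> 0" and \<epsilon>: "\<epsilon> > 0"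
  shows "\<exists>\<Lambda>>0. \<forall>\<kappa>\<ge>\<Lambda>. \<forall>k. \<forall>t\<in>{0..T}.
    cmod (duh ((norm (xi k))\<^sup>2) (\<lambda>s. cis ((xi k \<bullet> \<omega>) * \<kappa> * s\<^sup>2) * h k s) t) \<le> \<epsilon> / wt k ^ 6"
proof -
  have hr: "reg j h" for j using h sreg_def by blast
  obtain C where C: "C \<ge> 0" "\<And>k t. t \<in> {0..T} \<Longrightarrow> cmod (h k t) \<le> C / wt k ^ 7"
    using rapidE[OF reg_rapid[OF hr[of 0]]] by blast
  define R where "R = T * C / \<epsilon> + 1"
  have "\<exists>\<Lambda>>0. \<forall>\<kappa>\<ge>\<Lambda>. \<forall>t\<in>{0..T}.
    cmod (duh ((norm (xi k))\<^sup>2) (\<lambda>s. cis ((xi k \<bullet> \<omega>) * \<kappa> * s\<^sup>2) * h k s) t) \<le> \<epsilon> / wt k ^ 6" for k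
  proof (cases "k = 0")
    case True
    then show ?thesis using h0 \<epsilon> wt_pos[of 0] by (intro exI[of _ 1]) (auto simp: less_imp_le)
  next
    case False
    show ?thesis
    proof (rule duh_oscillating_small[OF \<omega>[OF False], where g' = "td h k"])
      show "0 < \<epsilon> / wt k ^ 6" using \<epsilon> wt_pos[of k] by simp
      show "(h k has_vector_derivative td h k t) (at t within {0..T})" if "t \<in> {0..T}" for t
        using hr[of "Suc 0"] that by simp
      show "continuous_on {0..T} (td h k)"
        using hr[of "Suc 0"] by simp
    qed simp
  qed
  then have "\<forall>k. \<exists>\<Lambda>. \<Lambda> > 0 \<and> (\<forall>\<kappa>\<ge>\<Lambda>. \<forall>t\<in>{0..T}.
    cmod (duh ((norm (xi k))\<^sup>2) (\<lambda>s. cis ((xi k \<bullet> \<omega>) * \<kappa> * s\<^sup>2) * h k s) t) \<le> \<epsilon> / wt k ^ 6)"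
    by blast
  from choice[OF this] obtain \<Lambda> where L: "\<forall>k. \<Lambda> k > 0 \<and> (\<forall>\<kappa>\<ge>\<Lambda> k. \<forall>t\<in>{0..T}.
    cmod (duh ((norm (xi k))\<^sup>2) (\<lambda>s. cis ((xi k \<bullet> \<omega>) * \<kappa> * s\<^sup>2) * h k s) t) \<le> \<epsilon> / wt k ^ 6)" ..
  have \<Lambda>: "\<Lambda> k > 0" "\<kappa> \<ge> \<Lambda> k \<Longrightarrow> t \<in> {0..T} \<Longrightarrow>
    cmod (duh ((norm (xi k))\<^sup>2) (\<lambda>s. cis ((xi k \<bullet> \<omega>) * \<kappa> * s\<^sup>2) * h k s) t) \<le> \<epsilon> / wt k ^ 6" for k \<kappa> t
    using L by blast+
  define K where "K = {k. wt k < R}"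
  have K: "finite K" unfolding K_def by (rule finite_wt_less)
  show ?thesis
  proof (intro exI[of _ "(\<Sum>k\<in>K. \<Lambda> k) + 1"] conjI allI impI ballI)
    show "0 < (\<Sum>k\<in>K. \<Lambda> k) + 1" using \<Lambda>(1) by (intro add_nonneg_pos sum_nonneg) (auto simp: less_imp_le)
    fix \<kappa> k t assume \<kappa>: "(\<Sum>k\<in>K. \<Lambda> k) + 1 \<le> \<kappa>" and t: "t \<in> {0..T}"
    show "cmod (duh ((norm (xi k))\<^sup>2) (\<lambda>s. cis ((xi k \<bullet> \<omega>) * \<kappa> * s\<^sup>2) * h k s) t) \<le> \<epsilon> / wt k ^ 6"
    proof (cases "k \<in> K")
      case True
      have "\<Lambda> k \<le> (\<Sum>k\<in>K. \<Lambda> k)" using \<Lambda>(1) by (intro member_le_sum True K) (auto simp: less_imp_le)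
      then show ?thesis using \<Lambda>(2)[of k \<kappa> t] \<kappa> t by simp
    next
      case False
      then have k: "T * C / \<epsilon> + 1 \<le> wt k" by (simp add: K_def R_def not_less)
      have "cmod (duh ((norm (xi k))\<^sup>2) (\<lambda>s. cis ((xi k \<bullet> \<omega>) * \<kappa> * s\<^sup>2) * h k s) t) \<le> T * (C / wt k ^ 7)"
      proof (rule duh_bound_T[OF _ t])
        show "continuous_on {0..T} (\<lambda>s. cis ((xi k \<bullet> \<omega>) * \<kappa> * s\<^sup>2) * h k s)"
          by (intro continuous_on_mult continuous_chirp reg_continuous[OF hr])
        show "cmod (cis ((xi k \<bullet> \<omega>) * \<kappa> * s\<^sup>2) * h k s) \<le> C / wt k ^ 7" if "s \<in> {0..t}" for s
          using C(2)[of s k] that t by (simp add: norm_mult)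
      qed simp
      also have "\<dots> = (T * C / wt k) / wt k ^ 6" by (simp add: eval_nat_numeral)
      also have "\<dots> \<le> \<epsilon> / wt k ^ 6"
      proof (rule divide_right_mono)
        have "T * C / \<epsilon> \<le> wt k" using k by simp
        then have "T * C \<le> wt k * \<epsilon>" using \<epsilon> by (simp add: pos_divide_le_eq)
        then show "T * C / wt k \<le> \<epsilon>" using wt_pos[of k] by (simp add: pos_divide_le_eq mult.commute)
      qed (use wt_pos[of k] in simp)
      finally show ?thesis .
    qed
  qed
qed

text \<open>Each nonzero frequency excludes a plane; countably many planes form a null set and
  cannot fill the space.\<close>

lemma exists_nonresonant: "\<exists>\<omega>. \<forall>k. k \<noteq> 0 \<longrightarrow> xi k \<bullet> \<omega> \<noteq> 0"
proof (rule ccontr)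
  assume "\<not> ?thesis"
  then have "UNIV = (\<Union>k\<in>{k. k \<noteq> 0}. {\<omega>. xi k \<bullet> \<omega> = 0})" by auto
  moreover have "negligible (\<Union>k\<in>{k. k \<noteq> 0}. {\<omega>. xi k \<bullet> \<omega> = 0})"
  proof (rule negligible_countable_Union)
    show "countable ((\<lambda>k. {\<omega>. xi k \<bullet> \<omega> = 0}) ` {k. k \<noteq> 0})" by auto
    fix S assume "S \<in> (\<lambda>k. {\<omega>. xi k \<bullet> \<omega> = 0}) ` {k. k \<noteq> 0}"
    then show "negligible S" using xi_eq_0_iff by (auto intro: negligible_hyperplane)
  qed
  ultimately show False using non_negligible_UNIV by metis
qed

end

subsection \<open>Perturbing a smooth flow\<close>

text \<open>The integer lattice is discrete, so continuity in the pair (k, t) is just continuity in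
  t for each k. This makes families of coefficients elements of a space of bounded continuous
  functions with the supremum norm.\<close>

lemma continuous_on_discrete_Times:
  fixes f :: "(int^'n) \<times> real \<Rightarrow> 'b::topological_space"
  assumes "\<And>k. continuous_on UNIV (\<lambda>t. f (k, t))"
  shows "continuous_on UNIV f"
proof -
  have op: "open {k :: int^'n}" for k
    unfolding open_vec_def
  proof (intro ballI exI[of _ "\<lambda>i. {k $ i}"] conjI allI impI)
    show "open {k $ i}" for i by (rule open_discrete)
    show "y \<in> {k}" if "\<forall>i. y $ i \<in> {k $ i}" for y using that by (simp add: vec_eq_iff)
  qed auto
  have "continuous_on ({k} \<times> UNIV) f" for k
  proof -
    have "continuous_on ({k} \<times> UNIV) (\<lambda>p. f (k, snd p))"
      by (rule continuous_on_compose2[OF assms[of k]]) (auto intro!: continuous_intros)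
    then show ?thesis by (rule continuous_on_eq) auto
  qed
  then have "continuous_on (\<Union>k\<in>UNIV. {k} \<times> UNIV) f"
    by (intro continuous_on_open_UN open_Times op) auto
  moreover have "(\<Union>k\<in>UNIV. {k} \<times> UNIV) = (UNIV :: ((int^'n) \<times> real) set)" by auto
  ultimately show ?thesis by simp
qed

text \<open>A Cauchy sequence in the supremum distance converges uniformly, and uniform limits stay
  bounded and continuous. \<open>Banach_fix\<close> asks for completeness of the set on which the
  map acts.\<close>

lemma complete_bcontfun:
  fixes S :: "('a::topological_space, 'b::complete_space) bcontfun set"
  assumes "closed S" shows "complete S"
proof (rule completeI)
  fix f assume f: "\<forall>n. f n \<in> S" "Cauchy f"
  then obtain g where "uniform_limit UNIV f g sequentially"
    using uniformly_convergent_eq_cauchy[of "\<lambda>_. True" f]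
    unfolding Cauchy_def uniform_limit_sequentially_iff
    by (metis dist_fun_lt_imp_dist_val_lt)
  from uniform_limit_bcontfunE[OF this sequentially_bot]
  obtain l where "f \<longlonglongrightarrow> l" by metis
  then show "\<exists>l\<in>S. f \<longlonglongrightarrow> l"
    using assms f(1) closed_sequentially by blast
qed

lemma norm_vec3_le:
  fixes x :: "complex^3"
  assumes "\<And>i. cmod (x $ i) \<le> b" shows "norm x \<le> 3 * b"
proof -
  have "norm x \<le> (\<Sum>i\<in>UNIV. norm (x $ i))" unfolding norm_vec_def by (rule L2_set_le_sum) auto
  also have "\<dots> \<le> (\<Sum>i\<in>(UNIV::3 set). b)" by (rule sum_mono) (rule assms)
  finally show ?thesis by simp
qed

type_synonym bfam = "((int^3) \<times> real, complex^3) bcontfun"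

text \<open>M is kept as an abstract symbol of first order; it will be minus i times the j-th
  frequency component times the Leray symbol. The conjugation hypotheses keep the physical fields
  real.\<close>

locale perturbation = torus +
  fixes v :: "3 \<Rightarrow> fam" and M :: "3 \<Rightarrow> 3 \<Rightarrow> 3 \<Rightarrow> int^3 \<Rightarrow> complex" and C :: real
  assumes v: "sreg (v j)" and v_cnj: "v j (- k) t = cnj (v j k t)"
    and M: "cmod (M i j l k) \<le> C * norm (xi k)" and M_cnj: "M i j l (- k) = cnj (M i j l k)"
    and C: "0 \<le> C"
begin

text \<open>The terms of a quadratic nonlinearity at a + w that involve w. The pure a term is
  missing because the base flow already solves its own equation.\<close>

definition nl :: "(3 \<Rightarrow> int^3 \<Rightarrow> complex) \<Rightarrow> (3 \<Rightarrow> int^3 \<Rightarrow> complex) \<Rightarrow> 3 \<Rightarrow> int^3 \<Rightarrow> complex" where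
  "nl a w i k = (\<Sum>j\<in>UNIV. \<Sum>l\<in>UNIV. M i j l k *
     (conv (a j) (w l) k + conv (w j) (a l) k + conv (w j) (w l) k))"

text \<open>Local Lipschitz bound from bilinearity: 9 counts the pairs (j, l), and 2 V + 2 R the
  four differences of products, two with a factor a and two with w or w'. One factor norm (xi k) is
  lost, to be regained by the heat flow.\<close>

lemma nl_diff:
  assumes N: "6 \<le> N" and a: "\<And>j m. cmod (a j m) \<le> V / wt m ^ N"
    and w: "\<And>j m. cmod (w j m) \<le> R / wt m ^ N" and w': "\<And>j m. cmod (w' j m) \<le> R / wt m ^ N"
    and d: "\<And>j m. cmod (w j m - w' j m) \<le> d / wt m ^ N"
  shows "cmod (nl a w i k - nl a w' i k) \<le> norm (xi k) * (9 * C * conv_const N * (2 * V + 2 * R) * d / wt k ^ N)"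
proof -
  let ?c = "\<lambda>x y. conv_const N * x * y / wt k ^ N"
  have tm: "cmod (M i j l k * (conv (a j) (w l) k + conv (w j) (a l) k + conv (w j) (w l) k)
      - M i j l k * (conv (a j) (w' l) k + conv (w' j) (a l) k + conv (w' j) (w' l) k))
      \<le> C * norm (xi k) * (conv_const N * (2 * V + 2 * R) * d / wt k ^ N)" for j l
  proof -
    have s: "(\<lambda>m. p m * q (k - m)) summable_on UNIV"
      if "\<And>m. cmod (p m) \<le> P / wt m ^ N" "\<And>m. cmod (q m) \<le> Q / wt m ^ N" for p q P Q
      by (rule conv_bound(3)[OF N that])
    have 1: "conv (w l) (a j) k - conv (w' l) (a j) k = conv (\<lambda>m. w l m - w' l m) (a j) k" for j l
      by (rule conv_diff_left[symmetric]) (rule s[OF w a] s[OF w' a])+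
    have 2: "conv (w j) (w l) k - conv (w' j) (w l) k = conv (\<lambda>m. w j m - w' j m) (w l) k"
      by (rule conv_diff_left[symmetric]) (rule s[OF w w] s[OF w' w])+
    have 3: "conv (w l) (w' j) k - conv (w' l) (w' j) k = conv (\<lambda>m. w l m - w' l m) (w' j) k"
      by (rule conv_diff_left[symmetric]) (rule s[OF w w'] s[OF w' w'])+
    have b1: "cmod (conv (\<lambda>m. w l m - w' l m) (a j) k) \<le> ?c d V" for j l by (rule conv_bound(4)[OF N d a])
    have b2: "cmod (conv (\<lambda>m. w j m - w' j m) (w l) k) \<le> ?c d R" by (rule conv_bound(4)[OF N d w])
    have b3: "cmod (conv (\<lambda>m. w l m - w' l m) (w' j) k) \<le> ?c d R" by (rule conv_bound(4)[OF N d w'])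
    \<comment> \<open>The quadratic difference telescopes through the product of w' and w; commuting
      the factors puts the difference w - w' always on the left, the only side covered by
      \<open>conv_diff_left\<close>.\<close>
    have eq: "M i j l k * (conv (a j) (w l) k + conv (w j) (a l) k + conv (w j) (w l) k)
      - M i j l k * (conv (a j) (w' l) k + conv (w' j) (a l) k + conv (w' j) (w' l) k)
      = M i j l k * (conv (\<lambda>m. w l m - w' l m) (a j) k + conv (\<lambda>m. w j m - w' j m) (a l) k
        + (conv (\<lambda>m. w j m - w' j m) (w l) k + conv (\<lambda>m. w l m - w' l m) (w' j) k))"
      unfolding 1[symmetric] 2[symmetric] 3[symmetric]
      unfolding conv_commute[of "a j" "w l"] conv_commute[of "a j" "w' l"] conv_commute[of "w' l" "w' j"] conv_commute[of "w l" "w' j"]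
      by (simp add: algebra_simps)
    have "cmod (conv (\<lambda>m. w l m - w' l m) (a j) k + conv (\<lambda>m. w j m - w' j m) (a l) k
        + (conv (\<lambda>m. w j m - w' j m) (w l) k + conv (\<lambda>m. w l m - w' l m) (w' j) k))
        \<le> (?c d V + ?c d V) + (?c d R + ?c d R)"
      by (intro norm_triangle_mono b1 b2 b3)
    also have "\<dots> = conv_const N * (2 * V + 2 * R) * d / wt k ^ N"
      by (simp add: algebra_simps add_divide_distrib)
    finally show ?thesis unfolding eq norm_mult
      using C by (intro mult_mono M) auto
  qed
  have "cmod (nl a w i k - nl a w' i k) \<le> (\<Sum>j\<in>(UNIV::3 set). \<Sum>l\<in>(UNIV::3 set).
      C * norm (xi k) * (conv_const N * (2 * V + 2 * R) * d / wt k ^ N))"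
    unfolding nl_def sum_subtractf[symmetric]
    by (intro order_trans[OF norm_sum] sum_mono tm)
  then show ?thesis by (simp add: mult_ac)
qed

lemma nl_zero: "nl a (\<lambda>j m. 0) i k = 0"
  by (simp add: nl_def conv_def)

lemma nl_bound:
  assumes "6 \<le> N" "\<And>j m. cmod (a j m) \<le> V / wt m ^ N" "\<And>j m. cmod (w j m) \<le> R / wt m ^ N"
  shows "cmod (nl a w i k) \<le> norm (xi k) * (9 * C * conv_const N * (2 * V + 2 * R) * R / wt k ^ N)"
proof -
  have "0 \<le> R" by (rule bound_nonneg[OF assms(3)])
  then show ?thesis
    using nl_diff[OF assms(1,2,3), where w' = "\<lambda>j m. 0" and d = R and i = i and k = k] assms(3) wt_pos
    by (simp add: nl_zero less_imp_le)
qed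

lemma nl_continuous:
  assumes w: "\<And>j m t. t \<in> {0..T} \<Longrightarrow> cmod (w j m t) \<le> R / wt m ^ 6" "\<And>j m. continuous_on {0..T} (w j m)"
  shows "continuous_on {0..T} (\<lambda>t. nl (\<lambda>j m. v j m t) (\<lambda>j m. w j m t) i k)"
proof -
  have vr: "reg j (v i)" for i j using v sreg_def by blast
  obtain V where "V \<ge> 0" and V: "\<And>j m t. t \<in> {0..T} \<Longrightarrow> cmod (v j m t) \<le> V / wt m ^ 6"
    by (rule rapid_familyE[where a = v and N = 6, OF reg_rapid[OF vr[of 0]]]) (rule that)
  have vc: "continuous_on {0..T} (v j m)" for j m by (rule reg_continuous[OF vr])
  have "continuous_on {0..T} (\<lambda>t. conv (\<lambda>m. v j m t) (\<lambda>m. w l m t) k)"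
    "continuous_on {0..T} (\<lambda>t. conv (\<lambda>m. w j m t) (\<lambda>m. v l m t) k)"
    "continuous_on {0..T} (\<lambda>t. conv (\<lambda>m. w j m t) (\<lambda>m. w l m t) k)" for j l
    by (rule continuous_on_conv[OF V vc w(1) w(2)] continuous_on_conv[OF w(1) w(2) V vc]
        continuous_on_conv[OF w(1) w(2) w(1) w(2)]; assumption)+
  then show ?thesis unfolding nl_def
    by (intro continuous_on_sum continuous_on_mult continuous_on_const continuous_on_add)
qed

lemma nl_cnj:
  assumes "\<And>j m. w j (- m) = cnj (w j m)" "\<And>j m. a j (- m) = cnj (a j m)"
  shows "nl a w i (- k) = cnj (nl a w i k)"
proof -
  have c': "conv (w j) (w l) (- k) = cnj (conv (w j) (w l) k)" "conv (a j) (w l) (- k) = cnj (conv (a j) (w l) k)"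
    "conv (w j) (a l) (- k) = cnj (conv (w j) (a l) k)" for j l
    by (rule conv_hermitian; rule assms)+
  show ?thesis unfolding nl_def cnj_sum complex_cnj_mult complex_cnj_add c' M_cnj ..
qed

definition wz :: "real \<Rightarrow> (bfam) \<Rightarrow> 3 \<Rightarrow> fam" where
  "wz \<mu> z j k t = (exp (\<mu> * t) / wt k ^ 6) *\<^sub>R (apply_bcontfun z (k, t) $ j)"

text \<open>The unknown is rescaled by wt k ^ 6 and by exp (- mu t); the latter weight makes the terms that are
  linear in the unknown contractive on all of [0,T] once mu is large.\<close>

lemma contraction_fixed_point:
  "\<exists>\<epsilon>>0. \<forall>W. (\<forall>i k. continuous_on {0..T} (W i k)) \<longrightarrow> (\<forall>i k t. W i (- k) t = cnj (W i k t)) \<longrightarrow>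
     (\<forall>i k. \<forall>t\<in>{0..T}. cmod (W i k t) \<le> \<epsilon> / wt k ^ 6) \<longrightarrow>
     (\<exists>w B. (\<forall>i k. continuous_on {0..T} (w i k)) \<and> (\<forall>i k t. w i (- k) t = cnj (w i k t)) \<and>
        (\<forall>i k. \<forall>t\<in>{0..T}. cmod (w i k t) \<le> B / wt k ^ 6) \<and>
        (\<forall>i k. \<forall>t\<in>{0..T}. w i k t = W i k t +
           duh ((norm (xi k))\<^sup>2) (\<lambda>s. nl (\<lambda>j m. v j m s) (\<lambda>j m. w j m s) i k) t))"
proof -
  have vr: "reg j (v i)" for i j using v sreg_def by blast
  obtain V where V_nn: "V \<ge> 0" and V: "\<And>j m t. t \<in> {0..T} \<Longrightarrow> cmod (v j m t) \<le> V / wt m ^ 6"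
    by (rule rapid_familyE[where a = v and N = 6, OF reg_rapid[OF vr[of 0]]]) (rule that)
  \<comment> \<open>The Lipschitz constant of \<open>nl_diff\<close> with N = 6 and R = 1, the
    latter being the size of the perturbations allowed below.\<close>
  define Q where "Q = 9 * C * conv_const 6 * (2 * V + 2)"
  have Q: "Q \<ge> 0" unfolding Q_def using C V_nn conv_const_nonneg by (intro mult_nonneg_nonneg) auto
  \<comment> \<open>Since x / (x^2 + \<open>\<nu>\<close>^2) is at most 1 / \<open>\<nu>\<close>,
    this value with \<open>\<mu>\<close> = \<open>\<nu>\<close>^2 makes the Lipschitz constant of
    each component at most 1/6; the norm of three components then contracts by 1/2.\<close>
  define \<nu> where "\<nu> = 6 * Q + 1"
  have \<nu>: "\<nu> > 0" using Q by (simp add: \<nu>_def)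
  define \<mu> where "\<mu> = \<nu>\<^sup>2"
  have \<mu>: "\<mu> > 0" using \<nu> by (simp add: \<mu>_def)
  \<comment> \<open>The radius of the ball for the rescaled unknown: undoing the weight exp (mu t)
    on [0,T] gives coefficients of size at most 1, as assumed in \<open>Q\<close>.\<close>
  define \<delta> where "\<delta> = exp (- \<mu> * T)"
  have \<delta>: "\<delta> > 0" by (simp add: \<delta>_def)
  \<comment> \<open>Hermitian symmetry is part of the set, so that the fixed point represents a real
    field. It survives limits because evaluation at a point is continuous in the supremum
    distance.\<close>
  define S where "S = {z :: bfam. norm z \<le> \<delta> \<and>
      (\<forall>k t i. apply_bcontfun z (- k, t) $ i = cnj (apply_bcontfun z (k, t) $ i))}"
  have ap: "cmod (apply_bcontfun z p $ i) \<le> norm z" for z :: "bfam" and p i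
    using Finite_Cartesian_Product.norm_nth_le[of "apply_bcontfun z p" i] norm_bounded[of z p] by linarith
  have wz_diff: "cmod (wz \<mu> z j m t - wz \<mu> y j m t) \<le> norm (z - y) * exp (\<mu> * t) / wt m ^ 6" for z y j m t
  proof -
    have "wz \<mu> z j m t - wz \<mu> y j m t = (exp (\<mu> * t) / wt m ^ 6) *\<^sub>R (apply_bcontfun (z - y) (m, t) $ j)"
      by (simp add: wz_def scaleR_diff_right)
    then show ?thesis using ap[of "z - y" "(m, t)" j] wt_pos[of m]
      by (simp add: divide_right_mono mult_left_mono mult.commute[of _ "exp _"])
  qed
  have wz0: "wz \<mu> 0 j m t = 0" for j m t by (simp add: wz_def)
  have wz_bound: "cmod (wz \<mu> z j m t) \<le> 1 / wt m ^ 6" if "norm z \<le> \<delta>" "t \<in> {0..T}" for z j m t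
  proof -
    have "norm z * exp (\<mu> * t) \<le> \<delta> * exp (\<mu> * T)"
      using that \<mu> \<delta> by (intro mult_mono) auto
    also have "\<dots> = 1" by (simp add: \<delta>_def exp_minus)
    finally have "norm z * exp (\<mu> * t) / wt m ^ 6 \<le> 1 / wt m ^ 6"
      using wt_pos[of m] by (intro divide_right_mono) auto
    then show ?thesis using wz_diff[of z j m t 0] by (simp add: wz0)
  qed
  have wz_cont: "continuous_on U (wz \<mu> z j k)" for z j k U
    unfolding wz_def
    by (intro continuous_intros continuous_on_component
        continuous_on_compose2[OF continuous_on_apply_bcontfun[of UNIV z]]) (use wt_pos[of k] in auto)
  define n where "n z i k s = nl (\<lambda>j m. v j m s) (\<lambda>j m. wz \<mu> z j m s) i k" for z i k s
  have n_cont: "continuous_on {0..T} (n z i k)" if "norm z \<le> \<delta>" for z i k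
    unfolding n_def by (rule nl_continuous[where R = 1]) (use wz_bound[OF that] wz_cont in auto)
  have n_diff: "cmod (n z i k s - n y i k s) \<le> norm (xi k) * Q * norm (z - y) / wt k ^ 6 * exp (\<mu> * s)"
    if "norm z \<le> \<delta>" "norm y \<le> \<delta>" "s \<in> {0..T}" for z y i k s
    using nl_diff[of 6 "\<lambda>j m. v j m s" V "\<lambda>j m. wz \<mu> z j m s" 1 "\<lambda>j m. wz \<mu> y j m s" "norm (z - y) * exp (\<mu> * s)" i k]
      V[OF that(3)] wz_bound[OF that(1,3)] wz_bound[OF that(2,3)] wz_diff[of z _ _ s y]
    by (simp add: n_def Q_def mult_ac)
  have duh_diff_bound: "cmod (duh ((norm (xi k))\<^sup>2) (n z i k) t - duh ((norm (xi k))\<^sup>2) (n y i k) t)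
      \<le> norm (z - y) / 6 * exp (\<mu> * t) / wt k ^ 6"
    if zy: "norm z \<le> \<delta>" "norm y \<le> \<delta>" and t: "t \<in> {0..T}" for z y i k t
  proof -
    have "cmod (duh ((norm (xi k))\<^sup>2) (n z i k) t - duh ((norm (xi k))\<^sup>2) (n y i k) t)
        = cmod (duh ((norm (xi k))\<^sup>2) (\<lambda>s. n z i k s - n y i k s) t)"
      using duh_diff[OF n_cont[OF zy(1)] n_cont[OF zy(2)] t] by simp
    also have "\<dots> \<le> norm (xi k) * Q * norm (z - y) / wt k ^ 6 * exp (\<mu> * t) / ((norm (xi k))\<^sup>2 + \<mu>)"
    proof (rule duh_bound[OF _ t])
      show "continuous_on {0..T} (\<lambda>s. n z i k s - n y i k s)"
        by (intro continuous_on_diff n_cont zy)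
      show "0 < (norm (xi k))\<^sup>2 + \<mu>" using \<mu> by (simp add: add_nonneg_pos)
      show "0 \<le> norm (xi k) * Q * norm (z - y) / wt k ^ 6" using Q wt_pos[of k] by simp
      show "cmod (n z i k s - n y i k s) \<le> norm (xi k) * Q * norm (z - y) / wt k ^ 6 * exp (\<mu> * s)"
        if "s \<in> {0..t}" for s using n_diff[OF zy] that t by auto
    qed
    also have "\<dots> = (norm (xi k) / ((norm (xi k))\<^sup>2 + \<mu>) * Q) * (norm (z - y) * exp (\<mu> * t) / wt k ^ 6)" by (simp add: mult_ac)
    also have "\<dots> \<le> (1 / 6) * (norm (z - y) * exp (\<mu> * t) / wt k ^ 6)"
    proof (rule mult_right_mono)
      have "norm (xi k) * \<nu> \<le> (norm (xi k))\<^sup>2 + \<mu>"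
        using sum_squares_bound[of "norm (xi k)" \<nu>] \<nu> by (simp add: \<mu>_def mult.assoc) (smt (verit) mult_nonneg_nonneg norm_ge_zero)
      then have "norm (xi k) / ((norm (xi k))\<^sup>2 + \<mu>) \<le> 1 / \<nu>"
        using \<mu> \<nu> by (simp add: pos_divide_le_eq pos_le_divide_eq add_nonneg_pos)
      then have "norm (xi k) / ((norm (xi k))\<^sup>2 + \<mu>) * Q \<le> 1 / \<nu> * Q" using Q by (rule mult_right_mono)
      also have "\<dots> \<le> 1 / 6" using Q \<nu> by (simp add: \<nu>_def field_simps)
      finally show "norm (xi k) / ((norm (xi k))\<^sup>2 + \<mu>) * Q \<le> 1 / 6" .
    qed (use wt_pos[of k] in simp)
    finally show ?thesis by simp
  qed
  show ?thesis
  \<comment> \<open>With components of size \<open>\<delta>\<close> / 6 the image of 0 has norm at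
    most \<open>\<delta>\<close> / 2, and a contraction by 1/2 then maps the ball of radius
    \<open>\<delta>\<close> into itself.\<close>
  proof (intro exI[of _ "\<delta> / 6"] conjI allI impI)
    show "0 < \<delta> / 6" using \<delta> by simp
    fix W :: "3 \<Rightarrow> fam"
    assume Wc: "\<forall>i k. continuous_on {0..T} (W i k)" and W_cnj: "\<forall>i k t. W i (- k) t = cnj (W i k t)"
      and W: "\<forall>i k. \<forall>t\<in>{0..T}. cmod (W i k t) \<le> \<delta> / 6 / wt k ^ 6"
    \<comment> \<open>Members of \<open>bfam\<close> are defined for all real times; clamping time
      to [0,T] extends the integral equation to a bounded continuous function there.\<close>
    define cl where "cl t = max 0 (min T t)" for t
    have cl: "cl t \<in> {0..T}" "t \<in> {0..T} \<Longrightarrow> cl t = t" for t using T_pos by (auto simp: cl_def)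
    have clc: "continuous_on UNIV cl" unfolding cl_def by (intro continuous_intros)
    define G where "G z i k t = W i k t + duh ((norm (xi k))\<^sup>2) (n z i k) t" for z i k t
    \<comment> \<open>The right-hand side of the integral equation in the rescaled unknown: the
      factors are the inverse of those in \<open>wz\<close>.\<close>
    define \<Phi>0 where "\<Phi>0 z p = (\<chi> i. (wt (fst p) ^ 6 * exp (- \<mu> * cl (snd p))) *\<^sub>R G z i (fst p) (cl (snd p)))" for z p
    have n0: "n 0 i k = (\<lambda>s. 0)" for i k by (simp add: n_def wz0 nl_zero fun_eq_iff)
    have \<Phi>0_diff: "norm (\<Phi>0 z p - \<Phi>0 y p) \<le> norm (z - y) / 2" if zy: "norm z \<le> \<delta>" "norm y \<le> \<delta>" for z y p
    proof -
      obtain k t where p: "p = (k, t)" by (cases p)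
      have "cmod ((\<Phi>0 z p - \<Phi>0 y p) $ i) \<le> norm (z - y) / 6" for i
      proof -
        have "(\<Phi>0 z p - \<Phi>0 y p) $ i = (wt k ^ 6 * exp (- \<mu> * cl t)) *\<^sub>R
            (duh ((norm (xi k))\<^sup>2) (n z i k) (cl t) - duh ((norm (xi k))\<^sup>2) (n y i k) (cl t))"
          by (simp add: \<Phi>0_def G_def p scaleR_diff_right[symmetric])
        then have "cmod ((\<Phi>0 z p - \<Phi>0 y p) $ i) = wt k ^ 6 * exp (- \<mu> * cl t) *
            cmod (duh ((norm (xi k))\<^sup>2) (n z i k) (cl t) - duh ((norm (xi k))\<^sup>2) (n y i k) (cl t))"
          using wt_pos[of k] by simp
        also have "\<dots> \<le> wt k ^ 6 * exp (- \<mu> * cl t) * (norm (z - y) / 6 * exp (\<mu> * cl t) / wt k ^ 6)"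
          using wt_pos[of k] by (intro mult_left_mono duh_diff_bound zy cl) auto
        also have "\<dots> = norm (z - y) / 6" using wt_pos[of k] by (simp add: exp_minus)
        finally show ?thesis .
      qed
      from norm_vec3_le[OF this] show ?thesis by simp
    qed
    have \<Phi>0_0: "norm (\<Phi>0 0 p) \<le> \<delta> / 2" for p
    proof -
      obtain k t where p: "p = (k, t)" by (cases p)
      have "cmod (\<Phi>0 0 p $ i) \<le> \<delta> / 6" for i
      proof -
        have "cmod (\<Phi>0 0 p $ i) = exp (- \<mu> * cl t) * (wt k ^ 6 * cmod (W i k (cl t)))"
          using wt_pos[of k] by (simp add: \<Phi>0_def G_def p n0)
        also have "\<dots> \<le> 1 * (wt k ^ 6 * (\<delta> / 6 / wt k ^ 6))"
          using W cl[of t] \<mu> wt_pos[of k] by (intro mult_mono) auto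
        finally show ?thesis using wt_pos[of k] by simp
      qed
      from norm_vec3_le[OF this] show ?thesis by simp
    qed
    have \<Phi>0_bound: "norm (\<Phi>0 z p) \<le> \<delta>" if "norm z \<le> \<delta>" for z p
    proof -
      have "norm (\<Phi>0 z p) \<le> norm (\<Phi>0 z p - \<Phi>0 0 p) + norm (\<Phi>0 0 p)"
        using norm_triangle_sub[of "\<Phi>0 z p" "\<Phi>0 0 p"] by simp
      also have "\<dots> \<le> norm z / 2 + \<delta> / 2" using \<Phi>0_diff[OF that, of 0 p] \<Phi>0_0[of p] \<delta> by simp
      finally show ?thesis using that by simp
    qed
    have G_cont: "continuous_on {0..T} (G z i k)" if "norm z \<le> \<delta>" for z i k
      unfolding G_def using Wc by (intro continuous_on_add duh_continuous n_cont that) auto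
    have \<Phi>0_cont: "continuous_on UNIV (\<Phi>0 z)" if "norm z \<le> \<delta>" for z
    proof (rule continuous_on_discrete_Times)
      fix k
      have "continuous_on UNIV (\<lambda>t. (wt k ^ 6 * exp (- \<mu> * cl t)) *\<^sub>R G z i k (cl t))" for i
        by (intro continuous_intros clc continuous_on_compose2[OF G_cont[OF that] clc]) (use cl in auto)
      then show "continuous_on UNIV (\<lambda>t. \<Phi>0 z (k, t))"
        unfolding \<Phi>0_def fst_conv snd_conv by (intro continuous_on_vec_lambda)
    qed
    define \<Phi> where "\<Phi> z = Bcontfun (\<Phi>0 z)" for z
    have \<Phi>: "apply_bcontfun (\<Phi> z) = \<Phi>0 z" if "norm z \<le> \<delta>" for z
      unfolding \<Phi>_def
      by (rule Bcontfun_inverse) (rule bcontfun_normI[OF \<Phi>0_cont[OF that] \<Phi>0_bound[OF that]])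
    have "\<exists>!z. z \<in> S \<and> \<Phi> z = z"
    proof (rule Banach_fix[where c = "1/2"])
      have evc: "continuous_on UNIV (\<lambda>z :: bfam. apply_bcontfun z p)" for p
        unfolding continuous_on_iff
        by (metis dist_bounded dist_commute le_less_trans)
      have "closed {z :: bfam.
          apply_bcontfun z (- k, t) $ i = cnj (apply_bcontfun z (k, t) $ i)}" for k t i
        by (intro closed_Collect_eq continuous_on_component evc continuous_on_cnj)
      then have "closed {z :: bfam.
          \<forall>k t i. apply_bcontfun z (- k, t) $ i = cnj (apply_bcontfun z (k, t) $ i)}"
        by (intro closed_Collect_all)
      moreover have "closed {z :: bfam. norm z \<le> \<delta>}"
        by (intro closed_Collect_le continuous_intros)
      ultimately have "closed S" unfolding S_def by (intro closed_Collect_conj)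
      then show "complete S" by (rule complete_bcontfun)
      show "S \<noteq> {}" using \<delta> by (auto simp: S_def intro!: exI[of _ 0])
      show "\<Phi> ` S \<subseteq> S"
      proof
        fix y assume "y \<in> \<Phi> ` S"
        then obtain z where z: "norm z \<le> \<delta>" "y = \<Phi> z"
          and zc: "\<And>k t i. apply_bcontfun z (- k, t) $ i = cnj (apply_bcontfun z (k, t) $ i)"
          by (auto simp: S_def)
        have "n z i (- k) = (\<lambda>s. cnj (n z i k s))" for i k
          unfolding n_def by (rule ext, rule nl_cnj) (simp_all add: wz_def zc v_cnj)
        then have "G z i (- k) t = cnj (G z i k t)" for i k t
          unfolding G_def using W_cnj duh_cnj by (simp add: xi_uminus)
        then have "apply_bcontfun y (- k, t) $ i = cnj (apply_bcontfun y (k, t) $ i)" for k t i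
          by (simp add: z(2) \<Phi>[OF z(1)] \<Phi>0_def)
        moreover have "norm y \<le> \<delta>"
          by (rule norm_bound) (simp add: z(2) \<Phi>[OF z(1)] \<Phi>0_bound[OF z(1)])
        ultimately show "y \<in> S" by (simp add: S_def)
      qed
      show "dist (\<Phi> x) (\<Phi> y) \<le> 1/2 * dist x y" if "x \<in> S" "y \<in> S" for x y
      proof (rule dist_bound)
        show "dist (apply_bcontfun (\<Phi> x) p) (apply_bcontfun (\<Phi> y) p) \<le> 1/2 * dist x y" for p
          using \<Phi>0_diff[of x y p] that by (simp add: S_def \<Phi> dist_norm)
      qed
    qed auto
    then obtain z where z: "norm z \<le> \<delta>" "\<Phi> z = z"
      and zc: "\<And>k t i. apply_bcontfun z (- k, t) $ i = cnj (apply_bcontfun z (k, t) $ i)"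
      by (auto simp: S_def)
    show "\<exists>w B. (\<forall>i k. continuous_on {0..T} (w i k)) \<and> (\<forall>i k t. w i (- k) t = cnj (w i k t)) \<and>
        (\<forall>i k. \<forall>t\<in>{0..T}. cmod (w i k t) \<le> B / wt k ^ 6) \<and>
        (\<forall>i k. \<forall>t\<in>{0..T}. w i k t = W i k t +
           duh ((norm (xi k))\<^sup>2) (\<lambda>s. nl (\<lambda>j m. v j m s) (\<lambda>j m. w j m s) i k) t)"
    proof (intro exI[of _ "wz \<mu> z"] exI[of _ 1] conjI allI ballI wz_cont wz_bound z(1))
      show "wz \<mu> z i (- k) t = cnj (wz \<mu> z i k t)" for i k t by (simp add: wz_def zc)
      fix i k t assume t: "t \<in> {0..T}"
      have "apply_bcontfun z (k, t) $ i = \<Phi>0 z (k, t) $ i" using \<Phi>[OF z(1)] z(2) by simp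
      also have "\<dots> = (wt k ^ 6 * exp (- \<mu> * t)) *\<^sub>R G z i k t" by (simp add: \<Phi>0_def cl(2)[OF t])
      finally have "wz \<mu> z i k t = (exp (\<mu> * t) / wt k ^ 6 * (wt k ^ 6 * exp (- \<mu> * t))) *\<^sub>R G z i k t"
        by (simp add: wz_def)
      also have "exp (\<mu> * t) / wt k ^ 6 * (wt k ^ 6 * exp (- \<mu> * t)) = 1"
        using wt_pos[of k] by (simp add: exp_minus)
      finally show "wz \<mu> z i k t = W i k t +
           duh ((norm (xi k))\<^sup>2) (\<lambda>s. nl (\<lambda>j m. v j m s) (\<lambda>j m. wz \<mu> z j m s) i k) t"
        by (simp add: G_def n_def[abs_def])
    qed
  qed
qed

lemma polyb_M: "polyb (M i j l)"
  unfolding polyb_def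
proof (intro exI[of _ "C * (2 * pi / L)"] exI[of _ 1] allI)
  fix k
  have "cmod (M i j l k) \<le> C * (2 * pi / L * wt k)"
    using order_trans[OF M mult_left_mono[OF norm_xi_le C]] .
  then show "cmod (M i j l k) \<le> C * (2 * pi / L) * wt k ^ 1" by simp
qed

lemma reg_nl:
  assumes "\<And>i. reg j (w i)"
  shows "reg j (\<lambda>k t. nl (\<lambda>j m. v j m t) (\<lambda>j m. w j m t) i k)"
proof -
  have vr: "reg j (v i)" for i using v sreg_def by blast
  show ?thesis unfolding nl_def
    by (intro reg_sum reg_mult polyb_M reg_add reg_conv vr assms)
qed

lemma duh_rapid:
  assumes "sreg g" shows "rapid (\<lambda>k. duh ((norm (xi k))\<^sup>2) (g k))"
  unfolding rapid_def
proof
  fix N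
  have g: "reg 0 g" using assms sreg_def by blast
  obtain B where B: "B \<ge> 0" "\<And>k t. t \<in> {0..T} \<Longrightarrow> cmod (g k t) \<le> B / wt k ^ N"
    using rapidE[OF reg_rapid[OF g]] by blast
  have "cmod (duh ((norm (xi k))\<^sup>2) (g k) t) \<le> T * (B / wt k ^ N)" if t: "t \<in> {0..T}" for k t
    by (rule duh_bound_T[OF reg_continuous[OF g] t]) (use B(2) t in auto)
  then show "\<exists>B. \<forall>k. \<forall>t\<in>{0..T}. cmod (duh ((norm (xi k))\<^sup>2) (g k) t) \<le> B / wt k ^ N"
    by (intro exI[of _ "T * B"]) simp
qed

text \<open>The heat kernel gains two derivatives and the nonlinearity loses one, so each pass through the
  integral equation improves the decay by one power of wt.\<close>

lemma solution_rapid: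
  assumes g: "\<And>i. sreg (g i)"
    and wc: "\<And>i k. continuous_on {0..T} (w i k)"
    and wb: "\<And>i k t. t \<in> {0..T} \<Longrightarrow> cmod (w i k t) \<le> B / wt k ^ 6"
    and w: "\<And>i k t. t \<in> {0..T} \<Longrightarrow> w i k t = duh ((norm (xi k))\<^sup>2) (g i k) t
       + duh ((norm (xi k))\<^sup>2) (\<lambda>s. nl (\<lambda>j m. v j m s) (\<lambda>j m. w j m s) i k) t"
  shows "rapid (w i)"
proof -
  have vr: "reg j (v i)" for i j using v sreg_def by blast
  have *: "\<exists>B. \<forall>i k t. t \<in> {0..T} \<longrightarrow> cmod (w i k t) \<le> B / wt k ^ N" if "6 \<le> N" for N
    using that
  proof (induction N rule: dec_induct)
    case base
    then show ?case using wb by blast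
  next
    case (step N)
    then obtain R where R: "\<And>i k t. t \<in> {0..T} \<Longrightarrow> cmod (w i k t) \<le> R / wt k ^ N" by blast
    have R0: "R \<ge> 0" by (rule bound_nonneg[OF R[of 0]]) (use T_pos in simp)
    obtain V where V_nn: "V \<ge> 0" and V: "\<And>j m t. t \<in> {0..T} \<Longrightarrow> cmod (v j m t) \<le> V / wt m ^ N"
      by (rule rapid_familyE[where a = v and N = N, OF reg_rapid[OF vr[of 0]]]) (rule that)
    define Q where "Q = 9 * C * conv_const N * (2 * V + 2 * R) * R"
    have Q: "Q \<ge> 0" unfolding Q_def using C V_nn R0 conv_const_nonneg by (intro mult_nonneg_nonneg) auto
    let ?n = "\<lambda>i k s. nl (\<lambda>j m. v j m s) (\<lambda>j m. w j m s) i k"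
    have n_cont: "continuous_on {0..T} (?n i k)" for i k
      by (rule nl_continuous[OF wb wc])
    have n_b: "cmod (?n i k s) \<le> norm (xi k) * (Q / wt k ^ N)" if "s \<in> {0..T}" for i k s
      unfolding Q_def by (rule nl_bound[OF step.hyps(1)]) (use V R that in auto)
    obtain E where "E \<ge> 0" and E: "\<And>i k t. t \<in> {0..T} \<Longrightarrow> cmod (duh ((norm (xi k))\<^sup>2) (g i k) t) \<le> E / wt k ^ Suc N"
      by (rule rapid_familyE[where a = "\<lambda>i k. duh ((norm (xi k))\<^sup>2) (g i k)" and N = "Suc N", OF duh_rapid[OF g]]) (rule that)
    define F where "F = Q * (6 * L / (2 * pi))"
    have F: "F \<ge> 0" using Q L_pos by (simp add: F_def)
    \<comment> \<open>At k = 0 the nonlinearity vanishes because its bound contains norm (xi 0) = 0.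
      Elsewhere \<open>duh_bound\<close> with mu = 0 turns norm (xi k) into 1 / norm (xi k), at most
      a constant over wt k by \<open>norm_xi_ge\<close>.\<close>
    have n_duh: "cmod (duh ((norm (xi k))\<^sup>2) (?n i k) t) \<le> F / wt k ^ Suc N" if t: "t \<in> {0..T}" for i k t
    proof (cases "k = 0")
      case True
      have "duh ((norm (xi k))\<^sup>2) (?n i k) t = duh ((norm (xi k))\<^sup>2) (\<lambda>s. 0) t"
        by (rule duh_cong) (use n_b[of _ i k] t True in auto)
      then show ?thesis using F wt_pos[of k] by simp
    next
      case False
      have x: "norm (xi k) > 0" using False xi_eq_0_iff by simp
      have "cmod (duh ((norm (xi k))\<^sup>2) (?n i k) t) \<le> norm (xi k) * (Q / wt k ^ N) * exp (0 * t) / ((norm (xi k))\<^sup>2 + 0)"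
        by (rule duh_bound[OF n_cont t]) (use n_b t x Q wt_pos[of k] in auto)
      also have "\<dots> = Q / wt k ^ N * (1 / norm (xi k))" using x by (simp add: power2_eq_square)
      also have "\<dots> \<le> Q / wt k ^ N * ((6 * L / (2 * pi)) / wt k)"
      proof (rule mult_left_mono)
        show "1 / norm (xi k) \<le> (6 * L / (2 * pi)) / wt k"
          using norm_xi_ge[OF False] x wt_pos[of k] L_pos by (simp add: field_simps)
      qed (use Q wt_pos[of k] in simp)
      also have "\<dots> = F / wt k ^ Suc N" by (simp add: F_def)
      finally show ?thesis .
    qed
    have "cmod (w i k t) \<le> (E + F) / wt k ^ Suc N" if t: "t \<in> {0..T}" for i k t
    proof -
      have "cmod (w i k t) \<le> E / wt k ^ Suc N + F / wt k ^ Suc N"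
        unfolding w[OF t] by (intro norm_triangle_mono E n_duh t)
      then show ?thesis by (simp add: add_divide_distrib)
    qed
    then show ?case by blast
  qed
  show ?thesis unfolding rapid_def
  proof
    fix N
    \<comment> \<open>The bootstrap starts at exponent 6, so smaller exponents are reached through N
      + 6.\<close>
    obtain B' where B': "\<And>i k t. t \<in> {0..T} \<Longrightarrow> cmod (w i k t) \<le> B' / wt k ^ (N + 6)" using *[of "N + 6"] by auto
    have "cmod (w i k t) \<le> \<bar>B'\<bar> / wt k ^ N" if "t \<in> {0..T}" for k t
    proof -
      have "B' / wt k ^ (N + 6) \<le> \<bar>B'\<bar> / wt k ^ (N + 6)" using wt_pos[of k] by (intro divide_right_mono) auto
      also have "\<dots> \<le> \<bar>B'\<bar> / wt k ^ N"
        using wt_ge_1[of k] wt_pos[of k] by (intro divide_left_mono power_increasing) auto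
      finally show ?thesis using B'[OF that, of i k] by linarith
    qed
    then show "\<exists>C. \<forall>k. \<forall>t\<in>{0..T}. cmod (w i k t) \<le> C / wt k ^ N" by blast
  qed
qed

text \<open>The order of quantifiers matters: \<open>\<epsilon>\<close> is fixed before the source
  g, so the oscillation of g may be tuned to it afterwards. Only the response to g is assumed
  small.\<close>

theorem perturbed_solution:
  "\<exists>\<epsilon>>0. \<forall>g. (\<forall>i. sreg (g i)) \<longrightarrow> (\<forall>i k t. g i (- k) t = cnj (g i k t)) \<longrightarrow>
     (\<forall>i k. \<forall>t\<in>{0..T}. cmod (duh ((norm (xi k))\<^sup>2) (g i k) t) \<le> \<epsilon> / wt k ^ 6) \<longrightarrow>
     (\<exists>w. (\<forall>i. sreg (w i)) \<and> (\<forall>i k t. w i (- k) t = cnj (w i k t)) \<and> (\<forall>i k. w i k 0 = 0) \<and>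
        (\<forall>i k. \<forall>t\<in>{0..T}. (w i k has_vector_derivative g i k t
            + nl (\<lambda>j m. v j m t) (\<lambda>j m. w j m t) i k - of_real ((norm (xi k))\<^sup>2) * w i k t) (at t within {0..T})))"
proof -
  obtain \<epsilon> where \<epsilon>: "\<epsilon> > 0" and ex: "\<And>W :: 3 \<Rightarrow> fam.
     (\<forall>i k. continuous_on {0..T} (W i k)) \<Longrightarrow> (\<forall>i k t. W i (- k) t = cnj (W i k t)) \<Longrightarrow>
     (\<forall>i k. \<forall>t\<in>{0..T}. cmod (W i k t) \<le> \<epsilon> / wt k ^ 6) \<Longrightarrow>
     (\<exists>w B. (\<forall>i k. continuous_on {0..T} (w i k)) \<and> (\<forall>i k t. w i (- k) t = cnj (w i k t)) \<and>
        (\<forall>i k. \<forall>t\<in>{0..T}. cmod (w i k t) \<le> B / wt k ^ 6) \<and>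
        (\<forall>i k. \<forall>t\<in>{0..T}. w i k t = W i k t +
           duh ((norm (xi k))\<^sup>2) (\<lambda>s. nl (\<lambda>j m. v j m s) (\<lambda>j m. w j m s) i k) t))"
    using contraction_fixed_point by blast
  show ?thesis
  proof (intro exI[of _ \<epsilon>] conjI allI impI \<epsilon>)
    fix g :: "3 \<Rightarrow> fam"
    assume g: "\<forall>i. sreg (g i)" and gc: "\<forall>i k t. g i (- k) t = cnj (g i k t)"
      and small: "\<forall>i k. \<forall>t\<in>{0..T}. cmod (duh ((norm (xi k))\<^sup>2) (g i k) t) \<le> \<epsilon> / wt k ^ 6"
    have gr: "reg j (g i)" for i j using g sreg_def by blast
    have g_cont: "continuous_on {0..T} (g i k)" for i k by (rule reg_continuous[OF gr])
    have "duh ((norm (xi (- k)))\<^sup>2) (g i (- k)) t = cnj (duh ((norm (xi k))\<^sup>2) (g i k) t)" for i k t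
    proof -
      have "g i (- k) = (\<lambda>s. cnj (g i k s))" using gc by auto
      then show ?thesis by (simp add: xi_uminus duh_cnj)
    qed
    then have "\<exists>w B. (\<forall>i k. continuous_on {0..T} (w i k)) \<and> (\<forall>i k t. w i (- k) t = cnj (w i k t)) \<and>
        (\<forall>i k. \<forall>t\<in>{0..T}. cmod (w i k t) \<le> B / wt k ^ 6) \<and>
        (\<forall>i k. \<forall>t\<in>{0..T}. w i k t = duh ((norm (xi k))\<^sup>2) (g i k) t +
           duh ((norm (xi k))\<^sup>2) (\<lambda>s. nl (\<lambda>j m. v j m s) (\<lambda>j m. w j m s) i k) t)"
      using small by (intro ex) (auto intro!: duh_continuous g_cont)
    then obtain w B where ww: "\<forall>i k. continuous_on {0..T} (w i k)" "\<forall>i k t. w i (- k) t = cnj (w i k t)"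
        "\<forall>i k. \<forall>t\<in>{0..T}. cmod (w i k t) \<le> B / wt k ^ 6"
        "\<forall>i k. \<forall>t\<in>{0..T}. w i k t = duh ((norm (xi k))\<^sup>2) (g i k) t +
           duh ((norm (xi k))\<^sup>2) (\<lambda>s. nl (\<lambda>j m. v j m s) (\<lambda>j m. w j m s) i k) t"
      by (elim exE conjE) (rule that)
    have w_cont: "continuous_on {0..T} (w i k)" for i k using ww(1) by blast
    have w_cnj: "w i (- k) t = cnj (w i k t)" for i k t using ww(2) by blast
    have wb: "cmod (w i k t) \<le> B / wt k ^ 6" if "t \<in> {0..T}" for i k t using ww(3) that by blast
    have w: "w i k t = duh ((norm (xi k))\<^sup>2) (g i k) t +
           duh ((norm (xi k))\<^sup>2) (\<lambda>s. nl (\<lambda>j m. v j m s) (\<lambda>j m. w j m s) i k) t"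
      if "t \<in> {0..T}" for i k t using ww(4) that by blast
    have rap: "rapid (w i)" for i
      by (rule solution_rapid[where g = g and B = B]) (use g w_cont wb w in auto)
    let ?n = "\<lambda>i k s. nl (\<lambda>j m. v j m s) (\<lambda>j m. w j m s) i k"
    have n_cont: "continuous_on {0..T} (?n i k)" for i k by (rule nl_continuous[OF wb w_cont])
    have d: "(w i k has_vector_derivative g i k t + ?n i k t - of_real ((norm (xi k))\<^sup>2) * w i k t) (at t within {0..T})"
      if t: "t \<in> {0..T}" for i k t
    proof -
      let ?c = "(norm (xi k))\<^sup>2"
      have "((\<lambda>t. duh ?c (g i k) t + duh ?c (?n i k) t) has_vector_derivative
          (g i k t - ?c *\<^sub>R duh ?c (g i k) t) + (?n i k t - ?c *\<^sub>R duh ?c (?n i k) t)) (at t within {0..T})"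
        by (intro has_vector_derivative_add duh_has_derivative g_cont n_cont t)
      then have "(w i k has_vector_derivative
          (g i k t - ?c *\<^sub>R duh ?c (g i k) t) + (?n i k t - ?c *\<^sub>R duh ?c (?n i k) t)) (at t within {0..T})"
        by (rule has_vector_derivative_transform[OF t, rotated]) (rule w)
      moreover have "(g i k t - ?c *\<^sub>R duh ?c (g i k) t) + (?n i k t - ?c *\<^sub>R duh ?c (?n i k) t)
          = g i k t + ?n i k t - of_real ?c * w i k t"
        unfolding w[OF t] scaleR_conv_of_real by (simp add: algebra_simps)
      ultimately show ?thesis by simp
    qed
    \<comment> \<open>The equation expresses the time derivative of w by g, the nonlinearity and a
      multiplier applied to w, all as regular in time as w itself; so each round adds one
      derivative.\<close>
    have "reg j (w i)" for i j
    proof (induction j arbitrary: i)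
      case 0
      show ?case using rap w_cont by simp
    next
      case (Suc j)
      have "reg j (\<lambda>k t. (g i k t + ?n i k t) + - of_real ((norm (xi k))\<^sup>2) * w i k t)"
        by (intro reg_add gr reg_nl reg_mult polyb_heat Suc)
      then show ?case using d by (intro reg_SucI[OF rap]) auto
    qed
    then have sr: "\<forall>i. sreg (w i)" by (simp add: sreg_def)
    have w0: "w i k 0 = 0" for i k using w[of 0 i k] T_pos by simp
    show "\<exists>w. (\<forall>i. sreg (w i)) \<and> (\<forall>i k t. w i (- k) t = cnj (w i k t)) \<and> (\<forall>i k. w i k 0 = 0) \<and>
        (\<forall>i k. \<forall>t\<in>{0..T}. (w i k has_vector_derivative g i k t
            + nl (\<lambda>j m. v j m t) (\<lambda>j m. w j m t) i k - of_real ((norm (xi k))\<^sup>2) * w i k t) (at t within {0..T}))"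
      using sr w_cnj w0 d by blast
  qed
qed

end

subsection \<open>The Navier-Stokes system on the slab\<close>

context torus
begin

lemma partial_deriv_eq_D:
  assumes "smooth_on (case_prod g) slab" "t \<in> {0..T}"
  shows "partial_deriv i (g t) x = D (ei i) (case_prod g) (t, x)"
proof -
  have "((\<lambda>x. case_prod g (t, x)) has_derivative (\<lambda>h. D (0, h) (case_prod g) (t, x))) (at x)"
    by (rule slab_derivative_space[OF D_works[OF assms(1)] assms(2)]) (use assms(2) in simp)
  then have "frechet_derivative (g t) (at x) = (\<lambda>h. D (0, h) (case_prod g) (t, x))"
    by (simp add: frechet_derivative_at[symmetric])
  then show ?thesis by (simp add: partial_deriv_def ei_def)
qed

lemma time_deriv_eq_D:
  fixes g :: "real \<Rightarrow> real^3 \<Rightarrow> real^3"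
  assumes "smooth_on (case_prod g) slab" "t \<in> {0..T}"
  shows "time_deriv T g t x = D (1, 0) (case_prod g) (t, x)"
proof -
  have "((\<lambda>s. case_prod g (s, x)) has_vector_derivative D (1, 0) (case_prod g) (t, x)) (at t within {0..T})"
    by (rule slab_derivative_time[OF D_works[OF assms(1)]]) (use assms(2) in simp)
  from vector_derivative_within_closed_interval[OF T_pos assms(2) this]
  show ?thesis by (simp add: time_deriv_def)
qed

lemma partial_deriv2_eq_D:
  assumes "smooth_on (case_prod g) slab" "t \<in> {0..T}"
  shows "partial_deriv i (partial_deriv i (g t)) x = D (ei i) (D (ei i) (case_prod g)) (t, x)"
proof -
  let ?h = "\<lambda>t x. D (ei i) (case_prod g) (t, x)"
  have h: "case_prod ?h = D (ei i) (case_prod g)" by (simp add: fun_eq_iff)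
  have "partial_deriv i (g t) = ?h t" using partial_deriv_eq_D[OF assms] by (simp add: fun_eq_iff)
  then show ?thesis
    using partial_deriv_eq_D[of ?h t i x] D_smooth[OF assms(1)] assms(2) by (simp add: h)
qed

definition ns_eq :: "(real \<times> (real^3) \<Rightarrow> real^3) \<Rightarrow> (real \<times> (real^3) \<Rightarrow> real) \<Rightarrow> (real \<times> (real^3) \<Rightarrow> real^3) \<Rightarrow> bool" where
  "ns_eq U P F \<longleftrightarrow> (\<forall>z\<in>slab. D (1, 0) U z + (\<Sum>i\<in>UNIV. U z $ i *\<^sub>R D (ei i) U z)
     = (\<Sum>i\<in>UNIV. D (ei i) (D (ei i) U) z) - (\<chi> i. D (ei i) P z) + F z)"

definition div_free :: "(real \<times> (real^3) \<Rightarrow> real^3) \<Rightarrow> bool" where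
  "div_free U \<longleftrightarrow> (\<forall>z\<in>slab. (\<Sum>i\<in>UNIV. D (ei i) U z $ i) = 0)"

text \<open>Replaces the fixed-time derivatives of the problem by derivatives relative to the slab,
  the only ones for which the calculus below is set up.\<close>

lemma solution_iff:
  "smooth_periodic_solution L u p u0 f T \<longleftrightarrow>
     smooth_periodic_data L u0 f T \<and> smooth_on (case_prod u) slab \<and> smooth_on (case_prod p) slab \<and>
     ns_eq (case_prod u) (case_prod p) (case_prod f) \<and> div_free (case_prod u) \<and>
     (\<forall>x. u 0 x = u0 x) \<and> per (case_prod u)"
proof (cases "smooth_on (case_prod u) slab \<and> smooth_on (case_prod p) slab")
  case True
  then have u: "smooth_on (case_prod u) slab" and p: "smooth_on (case_prod p) slab" by auto
  have "ns_eq (case_prod u) (case_prod p) (case_prod f) \<longleftrightarrow> (\<forall>t\<in>{0..T}. \<forall>x.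
        time_deriv T u t x + advection (u t) (u t) x = laplacian (u t) x - grad (p t) x + f t x)"
    unfolding ns_eq_def advection_def laplacian_def grad_def
    by (auto simp: partial_deriv_eq_D[OF u] partial_deriv_eq_D[OF p] partial_deriv2_eq_D[OF u] time_deriv_eq_D[OF u])
  moreover have "div_free (case_prod u) \<longleftrightarrow> (\<forall>t\<in>{0..T}. \<forall>x. divergence (u t) x = 0)"
    unfolding div_free_def divergence_def by (auto simp: partial_deriv_eq_D[OF u])
  moreover have "per (case_prod u) \<longleftrightarrow> (\<forall>t\<in>{0..T}. lattice_periodic L (u t))"
    by (simp add: per_def)
  ultimately show ?thesis
    unfolding smooth_periodic_solution_def spacetime_smooth_def by auto
next
  case False
  then show ?thesis unfolding smooth_periodic_solution_def spacetime_smooth_def by auto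
qed

section \<open>Calculus rules for derivatives on the slab\<close>

lemma D_linear:
  assumes "smooth_on g slab" "z \<in> slab"
  shows "D (v + w) g z = D v g z + D w g z" "D (c *\<^sub>R v) g z = c *\<^sub>R D v g z"
  using linear_add[OF has_derivative_linear[OF D_works[OF assms]], of v w]
    linear_scale[OF has_derivative_linear[OF D_works[OF assms]], of c v] by blast+

lemma D_space:
  assumes "smooth_on g slab" "z \<in> slab"
  shows "D (0, h) g z = (\<Sum>i\<in>UNIV. h $ i *\<^sub>R D (ei i) g z)"
proof -
  have "(0, h) = (\<Sum>i\<in>UNIV. h $ i *\<^sub>R ei i)"
    by (simp add: sum_3 ei_def vec_eq_iff forall_3 axis_def)
  then show ?thesis by (simp only: sum_3 D_linear[OF assms])
qed

lemma D_add:
  assumes "smooth_on f slab" "smooth_on g slab" "z \<in> slab"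
  shows "D v (\<lambda>z. f z + g z) z = D v f z + D v g z"
  by (rule D_eq[OF has_derivative_add[OF D_works D_works] assms(3)]) (use assms in auto)

lemma D_bounded_linear:
  assumes "bounded_linear h" "smooth_on g slab" "z \<in> slab"
  shows "D v (\<lambda>z. h (g z)) z = h (D v g z)"
  by (rule D_eq[OF bounded_linear.has_derivative[OF assms(1) D_works[OF assms(2,3)]] assms(3)])

lemma D_mult:
  fixes f g :: "real \<times> (real^3) \<Rightarrow> complex"
  assumes "smooth_on f slab" "smooth_on g slab" "z \<in> slab"
  shows "D v (\<lambda>z. f z * g z) z = f z * D v g z + D v f z * g z"
  by (rule D_eq[OF has_derivative_mult[OF D_works D_works] assms(3)]) (use assms in auto)

lemma bounded_linear_of_real_nth: "bounded_linear (\<lambda>x::real^'n. complex_of_real (x $ i))"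
  by (rule bounded_linear_compose[OF bounded_linear_of_real bounded_linear_vec_nth])

lemma D_space_eq:
  assumes "smooth_on g slab" "z \<in> slab"
    and "((\<lambda>s. g (z + s *\<^sub>R ei i)) has_vector_derivative d) (at 0)"
  shows "D (ei i) g z = d"
  using vector_derivative_unique_at[OF _ assms(3)] line_derivative[OF assms(1,2), of i 0 UNIV] by simp

subsection \<open>Accelerated frames\<close>

text \<open>Maps (t, x) to the coordinates of the frame that moves along X(t) = kappa t^2 omega. It
  fixes the initial time slice, as X(0) = 0.\<close>

definition shear :: "real \<Rightarrow> real^3 \<Rightarrow> real \<times> (real^3) \<Rightarrow> real \<times> (real^3)" where
  "shear \<kappa> \<omega> z = (fst z, snd z - (\<kappa> * (fst z)\<^sup>2) *\<^sub>R \<omega>)"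

lemma shear_slab [simp]: "shear \<kappa> \<omega> z \<in> slab \<longleftrightarrow> z \<in> slab"
  by (simp add: shear_def mem_Times_iff)

lemma shear_image: "shear \<kappa> \<omega> ` slab \<subseteq> slab"
  by (rule image_subsetI) (simp only: shear_slab)

lemma smooth_fst: "smooth_on (fst :: real \<times> (real^3) \<Rightarrow> real) slab"
  by (rule smooth_on_linear[OF thick_slab' bounded_linear_fst])

lemma smooth_snd: "smooth_on (snd :: real \<times> (real^3) \<Rightarrow> real^3) slab"
  by (rule smooth_on_linear[OF thick_slab' bounded_linear_snd])

lemma smooth_shear: "smooth_on (shear \<kappa> \<omega>) slab"
proof -
  have "smooth_on (\<lambda>z. snd z - fst z *\<^sub>R (fst z *\<^sub>R (\<kappa> *\<^sub>R \<omega>))) slab"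
    by (intro smooth_on_diff smooth_on_scaleR smooth_fst smooth_snd smooth_on_const thick_slab')
  then have 2: "smooth_on (\<lambda>z. snd z - (\<kappa> * (fst z)\<^sup>2) *\<^sub>R \<omega>) slab"
    by (simp add: power2_eq_square mult_ac)
  have l1: "bounded_linear (\<lambda>t::real. (t, 0::real^3))" and l2: "bounded_linear (\<lambda>x::real^3. (0::real, x))"
    by (intro bounded_linear_Pair bounded_linear_ident bounded_linear_zero)+
  have "smooth_on (\<lambda>z. (fst z, 0) + (0, snd z - (\<kappa> * (fst z)\<^sup>2) *\<^sub>R \<omega>)) slab"
    by (intro smooth_on_add thick_slab' smooth_on_bounded_linear[OF thick_slab' l1 smooth_fst]
        smooth_on_bounded_linear[OF thick_slab' l2 2])
  then show ?thesis by (simp add: shear_def[abs_def])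
qed

lemma smooth_on_shear: "smooth_on g slab \<Longrightarrow> smooth_on (\<lambda>z. g (shear \<kappa> \<omega> z)) slab"
  by (rule smooth_on_compose[OF thick_slab' shear_image smooth_shear])

lemma D_shear:
  assumes "smooth_on g slab" "z \<in> slab"
  shows "D v (\<lambda>z. g (shear \<kappa> \<omega> z)) z = D (fst v, snd v - (2 * \<kappa> * fst z * fst v) *\<^sub>R \<omega>) g (shear \<kappa> \<omega> z)"
proof (rule D_eq[OF _ assms(2)])
  show "((\<lambda>z. g (shear \<kappa> \<omega> z)) has_derivative
      (\<lambda>v. D (fst v, snd v - (2 * \<kappa> * fst z * fst v) *\<^sub>R \<omega>) g (shear \<kappa> \<omega> z))) (at z within slab)"
  proof (rule has_derivative_in_compose2[where t = slab and g = g and g' = "\<lambda>z v. D v g z"])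
    show "(g has_derivative (\<lambda>v. D v g z)) (at z within slab)" if "z \<in> slab" for z
      by (rule D_works[OF assms(1) that])
    show "(shear \<kappa> \<omega> has_derivative (\<lambda>v. (fst v, snd v - (2 * \<kappa> * fst z * fst v) *\<^sub>R \<omega>))) (at z within slab)"
      unfolding shear_def[abs_def]
      by (auto intro!: derivative_eq_intros simp: mult_ac)
  qed (use assms(2) shear_image in auto)
qed

lemma D_shear_space:
  assumes "smooth_on g slab" "z \<in> slab"
  shows "D (ei i) (\<lambda>z. g (shear \<kappa> \<omega> z)) z = D (ei i) g (shear \<kappa> \<omega> z)"
  using D_shear[OF assms, of "ei i"] by (simp add: ei_def)

text \<open>The chain rule adds transport by minus the frame velocity X'(t); in
  \<open>accelerated_frame\<close> this cancels against advection by the same velocity.\<close>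

lemma D_shear_time:
  assumes "smooth_on g slab" "z \<in> slab"
  shows "D (1, 0) (\<lambda>z. g (shear \<kappa> \<omega> z)) z = D (1, 0) g (shear \<kappa> \<omega> z)
     - (\<Sum>i\<in>UNIV. (2 * \<kappa> * fst z * \<omega> $ i) *\<^sub>R D (ei i) g (shear \<kappa> \<omega> z))"
proof -
  have z: "shear \<kappa> \<omega> z \<in> slab" using assms(2) by (simp only: shear_slab)
  have "D (1, 0) (\<lambda>z. g (shear \<kappa> \<omega> z)) z = D ((1, 0) + (0, - ((2 * \<kappa> * fst z) *\<^sub>R \<omega>))) g (shear \<kappa> \<omega> z)"
    using D_shear[OF assms, of "(1, 0)"] by simp
  also have "\<dots> = D (1, 0) g (shear \<kappa> \<omega> z) + D (0, - ((2 * \<kappa> * fst z) *\<^sub>R \<omega>)) g (shear \<kappa> \<omega> z)"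
    by (rule D_linear[OF assms(1) z])
  finally show ?thesis by (simp add: D_space[OF assms(1) z] sum_negf)
qed

text \<open>The inertial force of the accelerated frame and the spatial mean c of the force are constant in
  space, hence gradients of linear functions; this is where a non-periodic pressure is used.\<close>

lemma accelerated_frame:
  assumes U: "smooth_on U slab" "div_free U" "per U" and P: "smooth_on P slab" and ns: "ns_eq U P F"
    and c: "smooth_on (\<lambda>z. c (fst z)) slab"
    and F: "\<And>z. z \<in> slab \<Longrightarrow> F (shear \<kappa> \<omega> z) = f z - c (fst z)"
  shows "\<exists>u p. smooth_on u slab \<and> div_free u \<and> per u \<and> smooth_on p slab \<and> ns_eq u p f \<and> (\<forall>x. u (0, x) = U (0, x))"
proof -
  \<comment> \<open>The frame velocity X'(t), which must be added to the velocity seen in the moving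
    frame; it vanishes at t = 0.\<close>
  define b where "b z = (2 * \<kappa> * fst z) *\<^sub>R \<omega>" for z :: "real \<times> (real^3)"
  define u where "u z = U (shear \<kappa> \<omega> z) + b z" for z
  \<comment> \<open>Linear in x with gradient c - X''(t): it accounts for the mean c that is missing
    from F and for the inertial term X'' = 2 kappa omega.\<close>
  define l where "l z = (c (fst z) - (2 * \<kappa>) *\<^sub>R \<omega>) \<bullet> snd z" for z
  define p where "p z = P (shear \<kappa> \<omega> z) + l z" for z
  have bl: "bounded_linear b"
    unfolding b_def[abs_def]
    by (intro bounded_linear_scaleR_const bounded_linear_const_mult bounded_linear_fst)
  have b: "smooth_on b slab" by (rule smooth_on_linear[OF thick_slab' bl])
  have Db: "D v b z = b v" if "z \<in> slab" for v z
    by (rule D_eq[OF bounded_linear_imp_has_derivative[OF bl] that])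
  have Us: "smooth_on (\<lambda>z. U (shear \<kappa> \<omega> z)) slab" by (rule smooth_on_shear[OF U(1)])
  have Ps: "smooth_on (\<lambda>z. P (shear \<kappa> \<omega> z)) slab" by (rule smooth_on_shear[OF P])
  have u: "smooth_on u slab" unfolding u_def[abs_def] by (rule smooth_on_add[OF thick_slab' Us b])
  have l: "smooth_on l slab"
  proof -
    have "smooth_on (\<lambda>z. \<Sum>i\<in>UNIV. ((c (fst z) - (2 * \<kappa>) *\<^sub>R \<omega>) $ i) *\<^sub>R (snd z $ i)) slab"
      by (intro smooth_on_sum smooth_on_scaleR thick_slab' smooth_snd smooth_on_diff smooth_on_const c
          smooth_on_bounded_linear[OF thick_slab' bounded_linear_vec_nth])
    then show ?thesis by (simp add: l_def[abs_def] inner_vec_def)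
  qed
  have Dl: "D (ei i) l z = (c (fst z) - (2 * \<kappa>) *\<^sub>R \<omega>) $ i" if z: "z \<in> slab" for i z
  proof (rule D_space_eq[OF l z])
    have "(\<lambda>s. l (z + s *\<^sub>R ei i)) = (\<lambda>s. l z + s *\<^sub>R ((c (fst z) - (2 * \<kappa>) *\<^sub>R \<omega>) $ i))"
      by (simp add: fun_eq_iff l_def ei_def inner_add_right inner_axis)
    then show "((\<lambda>s. l (z + s *\<^sub>R ei i)) has_vector_derivative (c (fst z) - (2 * \<kappa>) *\<^sub>R \<omega>) $ i) (at 0)"
      by (auto intro!: derivative_eq_intros)
  qed
  have p: "smooth_on p slab" unfolding p_def[abs_def] by (rule smooth_on_add[OF thick_slab' Ps l])
  have Du: "D (ei i) u z = D (ei i) U (shear \<kappa> \<omega> z)" if z: "z \<in> slab" for i z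
    unfolding u_def[abs_def] D_add[OF Us b z] D_shear_space[OF U(1) z] Db[OF z]
    by (simp add: b_def ei_def)
  have DDu: "D (ei i) (D (ei i) u) z = D (ei i) (D (ei i) U) (shear \<kappa> \<omega> z)" if z: "z \<in> slab" for i z
  proof -
    have "D (ei i) (D (ei i) u) z = D (ei i) (\<lambda>z. D (ei i) U (shear \<kappa> \<omega> z)) z"
      by (rule D_cong[OF Du smooth_on_shear[OF D_smooth[OF U(1)]] z])
    also have "\<dots> = D (ei i) (D (ei i) U) (shear \<kappa> \<omega> z)"
      by (rule D_shear_space[OF D_smooth[OF U(1)] z])
    finally show ?thesis .
  qed
  have Dp: "D (ei i) p z = D (ei i) P (shear \<kappa> \<omega> z) + (c (fst z) - (2 * \<kappa>) *\<^sub>R \<omega>) $ i" if z: "z \<in> slab" for i z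
    unfolding p_def[abs_def] D_add[OF Ps l z] D_shear_space[OF P z] Dl[OF z] ..
  have Dtu: "D (1, 0) u z = D (1, 0) U (shear \<kappa> \<omega> z)
     - (\<Sum>i\<in>UNIV. b z $ i *\<^sub>R D (ei i) U (shear \<kappa> \<omega> z)) + (2 * \<kappa>) *\<^sub>R \<omega>" if z: "z \<in> slab" for z
    unfolding u_def[abs_def] D_add[OF Us b z] D_shear_time[OF U(1) z] Db[OF z]
    by (simp add: b_def)
  have "ns_eq u p f"
    unfolding ns_eq_def
  proof
    fix z assume z: "z \<in> slab"
    let ?z = "shear \<kappa> \<omega> z"
    have z': "?z \<in> slab" using z by (simp only: shear_slab)
    have e: "D (1, 0) U ?z + (\<Sum>i\<in>UNIV. U ?z $ i *\<^sub>R D (ei i) U ?z)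
       = (\<Sum>i\<in>UNIV. D (ei i) (D (ei i) U) ?z) - (\<chi> i. D (ei i) P ?z) + (f z - c (fst z))"
      using bspec[OF ns[unfolded ns_eq_def] z'] unfolding F[OF z] .
    have a: "(\<Sum>i\<in>UNIV. u z $ i *\<^sub>R D (ei i) u z) = (\<Sum>i\<in>UNIV. U ?z $ i *\<^sub>R D (ei i) U ?z)
        + (\<Sum>i\<in>UNIV. b z $ i *\<^sub>R D (ei i) U ?z)"
      by (simp add: Du[OF z] u_def scaleR_add_left sum.distrib)
    have g: "(\<chi> i. D (ei i) p z) = (\<chi> i. D (ei i) P ?z) + (c (fst z) - (2 * \<kappa>) *\<^sub>R \<omega>)"
      by (simp add: Dp[OF z] vec_eq_iff)
    \<comment> \<open>The transport term in \<open>Dtu\<close> and the advection by b in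
      \<open>a\<close> cancel; the acceleration 2 kappa omega is what remains.\<close>
    have "D (1, 0) u z + (\<Sum>i\<in>UNIV. u z $ i *\<^sub>R D (ei i) u z)
        = (D (1, 0) U ?z + (\<Sum>i\<in>UNIV. U ?z $ i *\<^sub>R D (ei i) U ?z)) + (2 * \<kappa>) *\<^sub>R \<omega>"
      unfolding Dtu[OF z] a by simp
    also have "\<dots> = (\<Sum>i\<in>UNIV. D (ei i) (D (ei i) u) z) - (\<chi> i. D (ei i) p z) + f z"
      unfolding e g DDu[OF z] by simp
    finally show "D (1, 0) u z + (\<Sum>i\<in>UNIV. u z $ i *\<^sub>R D (ei i) u z)
        = (\<Sum>i\<in>UNIV. D (ei i) (D (ei i) u) z) - (\<chi> i. D (ei i) p z) + f z" .
  qed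
  moreover have "div_free u"
    unfolding div_free_def
  proof
    fix z assume z: "z \<in> slab"
    then have "shear \<kappa> \<omega> z \<in> slab" by (simp only: shear_slab)
    from bspec[OF U(2)[unfolded div_free_def] this]
    show "(\<Sum>i\<in>UNIV. D (ei i) u z $ i) = 0" by (simp only: Du[OF z])
  qed
  moreover have "per u"
    unfolding per_def lattice_periodic_def
  proof (intro ballI allI)
    fix t x and k :: "int^3" assume t: "t \<in> {0..T}"
    let ?s = "(0, L *\<^sub>R (\<chi> i. of_int (k $ i))) :: real \<times> (real^3)"
    have "shear \<kappa> \<omega> (t, x + L *\<^sub>R (\<chi> i. of_int (k $ i))) = shear \<kappa> \<omega> (t, x) + ?s"
      by (simp add: shear_def)
    moreover have "U (shear \<kappa> \<omega> (t, x) + ?s) = U (shear \<kappa> \<omega> (t, x))"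
      by (rule per_shift[OF U(3)]) (use t in simp)
    ultimately show "u (t, x + L *\<^sub>R (\<chi> i. of_int (k $ i))) = u (t, x)" by (simp add: u_def b_def)
  qed
  moreover have "u (0, x) = U (0, x)" for x by (simp add: u_def b_def shear_def)
  ultimately show ?thesis using u p by blast
qed

subsection \<open>Forced solutions near a homogeneous one\<close>

text \<open>The symbol of the Leray projection onto divergence-free fields. At k = 0 the quotient is
  0, so constant fields are left alone.\<close>

definition leray :: "3 \<Rightarrow> 3 \<Rightarrow> int^3 \<Rightarrow> complex" where
  "leray i l k = of_real ((if i = l then 1 else 0) - xi k $ i * xi k $ l / (norm (xi k))\<^sup>2)"

lemma norm_leray_le: "cmod (leray i l k) \<le> 2"
proof -
  have "\<bar>xi k $ i\<bar> * \<bar>xi k $ l\<bar> \<le> norm (xi k) * norm (xi k)"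
    by (intro mult_mono component_le_norm_cart) auto
  then have "\<bar>xi k $ i * xi k $ l / (norm (xi k))\<^sup>2\<bar> \<le> 1"
    by (cases "xi k = 0") (simp_all add: abs_mult power2_eq_square divide_le_eq_1)
  moreover have "\<bar>(if i = l then 1 else 0) - y\<bar> \<le> 2" if "\<bar>y\<bar> \<le> 1" for y :: real
    using that by auto
  ultimately show ?thesis unfolding leray_def norm_of_real by blast
qed

lemma leray_uminus: "leray i l (- k) = leray i l k"
  by (simp add: leray_def xi_uminus)

lemma leray_cnj: "cnj (leray i l k) = leray i l k"
  by (simp add: leray_def)

lemma norm_xi_sum: "(\<Sum>i\<in>UNIV. of_real (xi k $ i) * of_real (xi k $ i)) = complex_of_real ((norm (xi k))\<^sup>2)"
  by (simp add: power2_norm_eq_inner inner_vec_def flip: of_real_mult of_real_sum)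

lemma leray_apply:
  "(\<Sum>l\<in>UNIV. leray i l k * n l)
    = n i - of_real (xi k $ i) * (\<Sum>l\<in>UNIV. of_real (xi k $ l) * n l) / of_real ((norm (xi k))\<^sup>2)"
proof -
  have "leray i l k * n l = (if i = l then n l else 0)
      - of_real (xi k $ i) * (of_real (xi k $ l) * n l) / of_real ((norm (xi k))\<^sup>2)" for l
    by (simp add: leray_def left_diff_distrib)
  then show ?thesis
    by (simp add: sum_subtractf sum_distrib_left sum_divide_distrib)
qed

lemma xi_leray: "(\<Sum>i\<in>UNIV. of_real (xi k $ i) * (\<Sum>l\<in>UNIV. leray i l k * n l)) = 0"
proof (cases "k = 0")
  case True
  then show ?thesis by simp
next
  case False
  then have x: "complex_of_real ((norm (xi k))\<^sup>2) \<noteq> 0" using xi_eq_0_iff by simp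
  have "(\<Sum>i\<in>UNIV. of_real (xi k $ i) * (\<Sum>l\<in>UNIV. leray i l k * n l))
      = (\<Sum>i\<in>UNIV. of_real (xi k $ i) * n i)
        - (\<Sum>i\<in>UNIV. of_real (xi k $ i) * of_real (xi k $ i)) * (\<Sum>l\<in>UNIV. of_real (xi k $ l) * n l) / of_real ((norm (xi k))\<^sup>2)"
    unfolding leray_apply by (simp add: right_diff_distrib sum_subtractf sum_distrib_right sum_divide_distrib mult.assoc)
  then show ?thesis using x unfolding norm_xi_sum by simp
qed

section \<open>Closure properties of smooth coefficient families\<close>

lemma polyb_bounded: "(\<And>k. cmod (m k) \<le> b) \<Longrightarrow> polyb m"
  unfolding polyb_def by (intro exI[of _ b] exI[of _ 0]) auto

lemma sreg_add: "sreg a \<Longrightarrow> sreg b \<Longrightarrow> sreg (\<lambda>k t. a k t + b k t)"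
  by (simp add: sreg_def reg_add)

lemma sreg_mult: "polyb m \<Longrightarrow> sreg a \<Longrightarrow> sreg (\<lambda>k t. m k * a k t)"
  by (simp add: sreg_def reg_mult)

lemma sreg_sum: "(\<And>i. i \<in> I \<Longrightarrow> sreg (a i)) \<Longrightarrow> sreg (\<lambda>k t. \<Sum>i\<in>I. a i k t)"
  by (simp add: sreg_def reg_sum)

lemma sreg_conv: "sreg a \<Longrightarrow> sreg b \<Longrightarrow> sreg (\<lambda>k t. conv (\<lambda>m. a m t) (\<lambda>m. b m t) k)"
  by (simp add: sreg_def reg_conv)

lemma sreg_td: "sreg a \<Longrightarrow> sreg (td a)"
  unfolding sreg_def using reg.simps(2) by blast

lemma sreg_rapid: "sreg a \<Longrightarrow> rapid a"
  unfolding sreg_def using reg_rapid by blast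

lemma sreg_diff: 
  assumes "sreg a" "sreg b" shows "sreg (\<lambda>k t. a k t - b k t)"
  using sreg_add[OF assms(1) sreg_mult[OF polyb_const[of "-1"] assms(2)]] by simp

lemma polyb_ixi: "polyb (\<lambda>k. \<i> * of_real (xi k $ i))"
  by (intro polyb_mult polyb_const polyb_xi_nth)

text \<open>Each time derivative of the phase costs a factor t, bounded on [0,T], and a factor xi k
  \<bullet> omega, of polynomial growth and so absorbed by rapid decay.\<close>

lemma sreg_phase:
  assumes "sreg a"
  shows "sreg (\<lambda>k t. cis ((xi k \<bullet> \<omega>) * \<kappa> * t\<^sup>2) * a k t)"
proof -
  let ?p = "\<lambda>k t. cis ((xi k \<bullet> \<omega>) * \<kappa> * t\<^sup>2)"
  have r: "rapid (\<lambda>k t. ?p k t * a k t)" if "rapid a" for a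
    by (rule rapid_le[OF that, of _ 1]) (auto simp: norm_mult)
  have pd: "(?p k has_vector_derivative (2 * \<i> * of_real \<kappa> * of_real (xi k \<bullet> \<omega>)) * (of_real t * ?p k t)) (at t within S)" for k t S
  proof -
    have "((\<lambda>t. (xi k \<bullet> \<omega>) * \<kappa> * t\<^sup>2) has_real_derivative (xi k \<bullet> \<omega>) * \<kappa> * (2 * t)) (at t within S)"
      by (auto intro!: derivative_eq_intros)
    from has_vector_derivative_cis[OF this] show ?thesis by (simp add: mult_ac)
  qed
  have "reg j (\<lambda>k t. ?p k t * a k t)" if "sreg a" for j a
    using that
  proof (induction j arbitrary: a)
    case 0
    have "continuous_on {0..T} (\<lambda>t. ?p k t * a k t)" for k
      by (intro continuous_on_mult continuous_on_vector_derivative[OF pd] reg_continuous[of 0])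
        (use 0 in \<open>simp only: sreg_def\<close>)
    then show ?case using r[OF sreg_rapid[OF 0]] by simp
  next
    case (Suc j)
    show ?case
    proof (rule reg_SucI[OF r[OF sreg_rapid[OF Suc.prems]]])
      \<comment> \<open>The frequency factor is put into the amplitude and the induction hypothesis
        is applied to this new family; therefore the induction runs over all amplitudes.\<close>
      have "sreg (\<lambda>k t. (2 * \<i> * of_real \<kappa> * of_real (xi k \<bullet> \<omega>)) * a k t)"
        by (intro sreg_mult polyb_mult polyb_const polyb_xi Suc.prems)
      from Suc.IH[OF this] Suc.IH[OF sreg_td[OF Suc.prems]]
      show "reg j (\<lambda>k t. ?p k t * td a k t + of_real t * (?p k t * ((2 * \<i> * of_real \<kappa> * of_real (xi k \<bullet> \<omega>)) * a k t)))"
        by (intro reg_add reg_time)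
      fix k t assume t: "t \<in> {0..T}"
      have "(a k has_vector_derivative td a k t) (at t within {0..T})"
        using Suc.prems t unfolding sreg_def using reg.simps(2)[of 0 a] by blast
      from has_vector_derivative_mult[OF pd this]
      show "((\<lambda>t. ?p k t * a k t) has_vector_derivative
          ?p k t * td a k t + of_real t * (?p k t * ((2 * \<i> * of_real \<kappa> * of_real (xi k \<bullet> \<omega>)) * a k t))) (at t within {0..T})"
        by (simp add: mult_ac)
    qed
  qed
  then show ?thesis using assms by (simp add: sreg_def)
qed

text \<open>Multiplying by the integrating factor exp (c t) makes s constant. It is applied to the
  divergence of w, each mode of which solves a homogeneous heat equation with zero initial
  value.\<close>

lemma divergence_mode_zero:
  assumes "\<And>t. t \<in> {0..T} \<Longrightarrow> (s has_vector_derivative - of_real c * s t) (at t within {0..T})"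
    and "s 0 = (0::complex)" and t: "t \<in> {0..T}"
  shows "s t = 0"
proof -
  have "((\<lambda>t. exp (c * t) *\<^sub>R s t) has_vector_derivative 0) (at t within {0..T})" if "t \<in> {0..T}" for t
  proof -
    have "((\<lambda>t. exp (c * t)) has_field_derivative c * exp (c * t)) (at t within {0..T})"
      by (auto intro!: derivative_eq_intros)
    from has_vector_derivative_scaleR[OF this assms(1)[OF that]] show ?thesis
      by (simp add: scaleR_conv_of_real mult_ac)
  qed
  then obtain d where "\<And>t. t \<in> {0..T} \<Longrightarrow> exp (c * t) *\<^sub>R s t = d"
    using has_vector_derivative_zero_constant[of "{0..T}" "\<lambda>t. exp (c * t) *\<^sub>R s t"] by (metis convex_real_interval(5))
  from this[OF t] this[of 0] show ?thesis using assms(2) T_pos by simp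
qed

text \<open>The coefficients of (v + w)_j (v + w)_i - v_j v_i, the momentum flux added by the
  perturbation.\<close>

definition flux :: "fam \<Rightarrow> fam \<Rightarrow> fam \<Rightarrow> fam \<Rightarrow> fam" where
  "flux vj wj vi wi k t = conv (\<lambda>m. vj m t) (\<lambda>m. wi m t) k + conv (\<lambda>m. wj m t) (\<lambda>m. vi m t) k
     + conv (\<lambda>m. wj m t) (\<lambda>m. wi m t) k"

lemma sreg_flux: "sreg a \<Longrightarrow> sreg b \<Longrightarrow> sreg c \<Longrightarrow> sreg d \<Longrightarrow> sreg (flux a b c d)"
  unfolding flux_def[abs_def] by (intro sreg_add sreg_conv)

text \<open>The system for w is solved in its Leray-projected form, where the pressure is absent; q
  is then recovered as the gradient part that the projection removed. F is the force without its
  mean, seen from the moving frame.\<close>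

lemma forced_coefficients:
  fixes v f :: "3 \<Rightarrow> fam"
  assumes v: "\<And>j. sreg (v j)" "\<And>j k t. v j (- k) t = cnj (v j k t)"
    and f: "\<And>j. sreg (f j)" "\<And>j k t. f j (- k) t = cnj (f j k t)"
  shows "\<exists>\<kappa> \<omega> w q F. (\<forall>i. sreg (w i)) \<and> (\<forall>i k t. w i (- k) t = cnj (w i k t)) \<and> (\<forall>i k. w i k 0 = 0) \<and>
    sreg q \<and> (\<forall>k t. q (- k) t = cnj (q k t)) \<and>
    (\<forall>i. sreg (F i)) \<and> (\<forall>i k t. F i (- k) t = cnj (F i k t)) \<and>
    (\<forall>i k t. F i k t = (if k = 0 then 0 else cis ((xi k \<bullet> \<omega>) * \<kappa> * t\<^sup>2) * f i k t)) \<and>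
    (\<forall>i k. \<forall>t\<in>{0..T}. td (w i) k t + (\<Sum>j\<in>UNIV. \<i> * of_real (xi k $ j) * flux (v j) (w j) (v i) (w i) k t)
        + \<i> * of_real (xi k $ i) * q k t = F i k t - of_real ((norm (xi k))\<^sup>2) * w i k t) \<and>
    (\<forall>k. \<forall>t\<in>{0..T}. (\<Sum>i\<in>UNIV. of_real (xi k $ i) * w i k t) = 0)"
proof -
  \<comment> \<open>The symbol of minus the Leray projection after a derivative in direction j: the
    convective term in divergence form. Its bound 2 norm (xi k) gives the constant C = 2 of the
    locale.\<close>
  define M where "M i j l k = - \<i> * of_real (xi k $ j) * leray i l k" for i j l k
  interpret perturbation L T v M 2
  proof
    show "cmod (M i j l k) \<le> 2 * norm (xi k)" for i j l k
    proof -
      have "cmod (M i j l k) = \<bar>xi k $ j\<bar> * cmod (leray i l k)" by (simp add: M_def norm_mult)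
      also have "\<dots> \<le> norm (xi k) * 2" by (intro mult_mono component_le_norm_cart norm_leray_le) auto
      finally show ?thesis by simp
    qed
    show "M i j l (- k) = cnj (M i j l k)" for i j l k
      by (simp add: M_def leray_uminus leray_cnj xi_uminus)
  qed (use v in auto)
  obtain \<epsilon> where \<epsilon>: "\<epsilon> > 0" and ex: "\<And>g :: 3 \<Rightarrow> fam. (\<forall>i. sreg (g i)) \<Longrightarrow> (\<forall>i k t. g i (- k) t = cnj (g i k t)) \<Longrightarrow>
     (\<forall>i k. \<forall>t\<in>{0..T}. cmod (duh ((norm (xi k))\<^sup>2) (g i k) t) \<le> \<epsilon> / wt k ^ 6) \<Longrightarrow>
     (\<exists>w. (\<forall>i. sreg (w i)) \<and> (\<forall>i k t. w i (- k) t = cnj (w i k t)) \<and> (\<forall>i k. w i k 0 = 0) \<and>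
        (\<forall>i k. \<forall>t\<in>{0..T}. (w i k has_vector_derivative g i k t
            + nl (\<lambda>j m. v j m t) (\<lambda>j m. w j m t) i k - of_real ((norm (xi k))\<^sup>2) * w i k t) (at t within {0..T})))"
    using perturbed_solution by blast
  obtain \<omega> where \<omega>: "\<And>k. k \<noteq> 0 \<Longrightarrow> xi k \<bullet> \<omega> \<noteq> 0" using exists_nonresonant by blast
  \<comment> \<open>The mean is removed because its phase is constantly 1; it is returned through
    the pressure in \<open>accelerated_frame\<close>.\<close>
  define h where "h i k t = (if k = 0 then 0 else 1) * f i k t" for i k t
  have h: "sreg (h i)" for i
    unfolding h_def[abs_def] by (intro sreg_mult f polyb_bounded[where b = 1]) auto
  define H where "H i k t = (\<Sum>l\<in>UNIV. leray i l k * h l k t)" for i k t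
  have H: "sreg (H i)" for i
    unfolding H_def[abs_def] by (intro sreg_sum sreg_mult h polyb_bounded[OF norm_leray_le])
  have "\<exists>\<Lambda>>0. \<forall>\<kappa>\<ge>\<Lambda>. \<forall>k. \<forall>t\<in>{0..T}.
    cmod (duh ((norm (xi k))\<^sup>2) (\<lambda>s. cis ((xi k \<bullet> \<omega>) * \<kappa> * s\<^sup>2) * H i k s) t) \<le> \<epsilon> / wt k ^ 6" for i
    by (rule linear_response_small[OF H _ \<omega> \<epsilon>]) (simp add: H_def h_def)
  then have "\<forall>i. \<exists>\<Lambda>. \<Lambda> > 0 \<and> (\<forall>\<kappa>\<ge>\<Lambda>. \<forall>k. \<forall>t\<in>{0..T}.
    cmod (duh ((norm (xi k))\<^sup>2) (\<lambda>s. cis ((xi k \<bullet> \<omega>) * \<kappa> * s\<^sup>2) * H i k s) t) \<le> \<epsilon> / wt k ^ 6)"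
    by blast
  from choice[OF this] obtain \<Lambda> where L: "\<forall>i. \<Lambda> i > 0 \<and> (\<forall>\<kappa>\<ge>\<Lambda> i. \<forall>k. \<forall>t\<in>{0..T}.
    cmod (duh ((norm (xi k))\<^sup>2) (\<lambda>s. cis ((xi k \<bullet> \<omega>) * \<kappa> * s\<^sup>2) * H i k s) t) \<le> \<epsilon> / wt k ^ 6)" ..
  have \<Lambda>: "\<Lambda> i > 0" "\<kappa> \<ge> \<Lambda> i \<Longrightarrow> t \<in> {0..T} \<Longrightarrow>
    cmod (duh ((norm (xi k))\<^sup>2) (\<lambda>s. cis ((xi k \<bullet> \<omega>) * \<kappa> * s\<^sup>2) * H i k s) t) \<le> \<epsilon> / wt k ^ 6" for i \<kappa> k t
    using L by blast+
  define \<kappa> where "\<kappa> = (\<Sum>i\<in>UNIV. \<Lambda> i)"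
  have \<kappa>: "\<kappa> \<ge> \<Lambda> i" for i unfolding \<kappa>_def using \<Lambda>(1) by (intro member_le_sum) (auto simp: less_imp_le)
  \<comment> \<open>Translating a function by X(t) multiplies its k-th coefficient by cis (xi k
    \<bullet> X(t)), so these are the coefficients of the mean-free force at the points y +
    X(t).\<close>
  define F where "F i k t = cis ((xi k \<bullet> \<omega>) * \<kappa> * t\<^sup>2) * h i k t" for i k t
  have F: "sreg (F i)" for i unfolding F_def[abs_def] by (rule sreg_phase[OF h])
  have F_cnj: "F i (- k) t = cnj (F i k t)" for i k t
    by (simp add: F_def h_def f xi_uminus cis_cnj)
  define g where "g i k t = cis ((xi k \<bullet> \<omega>) * \<kappa> * t\<^sup>2) * H i k t" for i k t
  have gF: "g i k t = (\<Sum>l\<in>UNIV. leray i l k * F l k t)" for i k t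
    unfolding g_def H_def F_def sum_distrib_left by (simp add: mult_ac)
  have g: "sreg (g i)" for i unfolding g_def[abs_def] by (rule sreg_phase[OF H])
  have g_cnj: "g i (- k) t = cnj (g i k t)" for i k t
    by (simp add: gF F_cnj leray_uminus leray_cnj)
  have "\<exists>w. (\<forall>i. sreg (w i)) \<and> (\<forall>i k t. w i (- k) t = cnj (w i k t)) \<and> (\<forall>i k. w i k 0 = 0) \<and>
        (\<forall>i k. \<forall>t\<in>{0..T}. (w i k has_vector_derivative g i k t
            + nl (\<lambda>j m. v j m t) (\<lambda>j m. w j m t) i k - of_real ((norm (xi k))\<^sup>2) * w i k t) (at t within {0..T}))"
  proof (rule ex)
    show "\<forall>i k. \<forall>t\<in>{0..T}. cmod (duh ((norm (xi k))\<^sup>2) (g i k) t) \<le> \<epsilon> / wt k ^ 6"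
      using \<Lambda>(2)[OF \<kappa>] by (simp add: g_def[abs_def])
  qed (use g g_cnj in auto)
  then obtain w where ww: "\<forall>i. sreg (w i)" "\<forall>i k t. w i (- k) t = cnj (w i k t)" "\<forall>i k. w i k 0 = 0"
      "\<forall>i k. \<forall>t\<in>{0..T}. (w i k has_vector_derivative g i k t
            + nl (\<lambda>j m. v j m t) (\<lambda>j m. w j m t) i k - of_real ((norm (xi k))\<^sup>2) * w i k t) (at t within {0..T})"
    by (elim exE conjE) (rule that)
  have w: "sreg (w i)" "w i (- k) t = cnj (w i k t)" "w i k 0 = 0" for i k t using ww by blast+
  have wd: "(w i k has_vector_derivative g i k t
      + nl (\<lambda>j m. v j m t) (\<lambda>j m. w j m t) i k - of_real ((norm (xi k))\<^sup>2) * w i k t) (at t within {0..T})"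
    if "t \<in> {0..T}" for i k t using ww(4) that by blast
  define N where "N i k t = F i k t - (\<Sum>j\<in>UNIV. \<i> * of_real (xi k $ j) * flux (v j) (w j) (v i) (w i) k t)" for i k t
  have N: "sreg (N i)" for i
    unfolding N_def[abs_def] by (intro sreg_diff F sreg_sum sreg_mult polyb_ixi sreg_flux v w)
  have flux_cnj: "flux (v j) (w j) (v i) (w i) (- k) t = cnj (flux (v j) (w j) (v i) (w i) k t)" for i j k t
  proof -
    have c': "conv (\<lambda>m. v j m t) (\<lambda>m. w i m t) (- k) = cnj (conv (\<lambda>m. v j m t) (\<lambda>m. w i m t) k)"
      "conv (\<lambda>m. w j m t) (\<lambda>m. v i m t) (- k) = cnj (conv (\<lambda>m. w j m t) (\<lambda>m. v i m t) k)"
      "conv (\<lambda>m. w j m t) (\<lambda>m. w i m t) (- k) = cnj (conv (\<lambda>m. w j m t) (\<lambda>m. w i m t) k)"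
      by (rule conv_hermitian; rule assms(2) w(2))+
    show ?thesis unfolding flux_def complex_cnj_add c' ..
  qed
  have N_cnj: "N i (- k) t = cnj (N i k t)" for i k t
    by (simp add: N_def F_cnj flux_cnj xi_uminus)
  \<comment> \<open>The pressure solves i xi q = xi (xi \<bullet> N) / norm (xi)^2, whence this
    multiplier; it gains one power of wt for k other than 0 and vanishes at k = 0.\<close>
  define m where "m l k = - \<i> * of_real (xi k $ l / (norm (xi k))\<^sup>2)" for l k
  have m: "polyb (m l)" for l
  proof (rule polyb_bounded)
    fix k
    show "cmod (m l k) \<le> 6 * L / (2 * pi)"
    proof (cases "k = 0")
      case True
      then show ?thesis using L_pos by (simp add: m_def)
    next
      case False
      then have x: "norm (xi k) > 0" using xi_eq_0_iff by simp
      have "cmod (m l k) = \<bar>xi k $ l\<bar> / (norm (xi k))\<^sup>2"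
        unfolding m_def norm_mult norm_minus_cancel norm_ii norm_of_real by simp
      also have "\<dots> \<le> norm (xi k) / (norm (xi k))\<^sup>2" by (intro divide_right_mono component_le_norm_cart) auto
      also have "\<dots> = 1 / norm (xi k)" using x by (simp add: power2_eq_square)
      also have "\<dots> \<le> 6 * L / (2 * pi)"
      proof -
        have "2 * pi / L * 1 \<le> 2 * pi / L * wt k" using L_pos wt_ge_1[of k] by (intro mult_left_mono) auto
        then have "2 * pi / L \<le> 6 * norm (xi k)" using norm_xi_ge[OF False] by linarith
        then show ?thesis using x L_pos by (simp add: field_simps)
      qed
      finally show ?thesis .
    qed
  qed
  define q where "q k t = (\<Sum>l\<in>UNIV. m l k * N l k t)" for k t
  have q: "sreg q" unfolding q_def[abs_def] by (intro sreg_sum sreg_mult m N)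
  have q_cnj: "q (- k) t = cnj (q k t)" for k t
    by (simp add: q_def N_cnj m_def xi_uminus)
  \<comment> \<open>After exchanging the sums over j and l, the projected source and the
    nonlinearity combine to the Leray projection of the single vector \<open>N\<close>.\<close>
  have nl: "g i k t + nl (\<lambda>j m. v j m t) (\<lambda>j m. w j m t) i k = (\<Sum>l\<in>UNIV. leray i l k * N l k t)" for i k t
  proof -
    have "nl (\<lambda>j m. v j m t) (\<lambda>j m. w j m t) i k
        = (\<Sum>j\<in>UNIV. \<Sum>l\<in>UNIV. M i j l k * flux (v j) (w j) (v l) (w l) k t)"
      by (simp add: nl_def flux_def)
    also have "\<dots> = (\<Sum>l\<in>UNIV. \<Sum>j\<in>UNIV. M i j l k * flux (v j) (w j) (v l) (w l) k t)"
      by (rule sum.swap)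
    also have "\<dots> = - (\<Sum>l\<in>UNIV. leray i l k * (\<Sum>j\<in>UNIV. \<i> * of_real (xi k $ j) * flux (v j) (w j) (v l) (w l) k t))"
      by (simp add: M_def sum_distrib_left sum_negf mult_ac)
    finally show ?thesis
      by (simp add: gF N_def right_diff_distrib sum_subtractf)
  qed
  have xq: "\<i> * of_real (xi k $ i) * q k t
      = of_real (xi k $ i) * (\<Sum>l\<in>UNIV. of_real (xi k $ l) * N l k t) / of_real ((norm (xi k))\<^sup>2)" for i k t
  proof -
    have "\<i> * (m l k * n) = of_real (xi k $ l) * n / of_real ((norm (xi k))\<^sup>2)" for l n
      by (simp add: m_def mult.assoc)
    then have iq: "\<i> * q k t = (\<Sum>l\<in>UNIV. of_real (xi k $ l) * N l k t) / of_real ((norm (xi k))\<^sup>2)"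
      by (simp add: q_def sum_distrib_left sum_divide_distrib)
    have "\<i> * of_real (xi k $ i) * q k t = of_real (xi k $ i) * (\<i> * q k t)" by (simp add: mult_ac)
    then show ?thesis by (simp only: iq times_divide_eq_right)
  qed
  have eq: "td (w i) k t + (\<Sum>j\<in>UNIV. \<i> * of_real (xi k $ j) * flux (v j) (w j) (v i) (w i) k t)
        + \<i> * of_real (xi k $ i) * q k t = F i k t - of_real ((norm (xi k))\<^sup>2) * w i k t"
    if t: "t \<in> {0..T}" for i k t
  proof -
    have "(w i k has_vector_derivative N i k t - \<i> * of_real (xi k $ i) * q k t - of_real ((norm (xi k))\<^sup>2) * w i k t)
        (at t within {0..T})"
      using wd[OF t, of i k] unfolding nl leray_apply xq .
    then have "td (w i) k t = N i k t - \<i> * of_real (xi k $ i) * q k t - of_real ((norm (xi k))\<^sup>2) * w i k t"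
      by (rule td_eq) (rule t)
    then show ?thesis by (simp add: N_def)
  qed
  \<comment> \<open>Pairing with xi annihilates everything that is Leray-projected, so only the
    decay term is left in the equation for the divergence.\<close>
  have div: "(\<Sum>i\<in>UNIV. of_real (xi k $ i) * w i k t) = 0" if t: "t \<in> {0..T}" for k t
  proof (rule divergence_mode_zero[OF _ _ t, where s = "\<lambda>t. \<Sum>i\<in>UNIV. of_real (xi k $ i) * w i k t"])
    fix t assume t: "t \<in> {0..T}"
    have "((\<lambda>t. \<Sum>i\<in>UNIV. of_real (xi k $ i) * w i k t) has_vector_derivative
        (\<Sum>i\<in>UNIV. of_real (xi k $ i) * ((\<Sum>l\<in>UNIV. leray i l k * N l k t) - of_real ((norm (xi k))\<^sup>2) * w i k t)))
        (at t within {0..T})"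
      using wd[OF t] unfolding nl by (intro has_vector_derivative_sum has_vector_derivative_mult_right)
    moreover have "(\<Sum>i\<in>UNIV. of_real (xi k $ i) * ((\<Sum>l\<in>UNIV. leray i l k * N l k t) - of_real ((norm (xi k))\<^sup>2) * w i k t))
        = - of_real ((norm (xi k))\<^sup>2) * (\<Sum>i\<in>UNIV. of_real (xi k $ i) * w i k t)"
      using xi_leray[of k "\<lambda>l. N l k t"]
      by (simp add: right_diff_distrib sum_subtractf sum_distrib_left sum_negf mult_ac)
    ultimately show "((\<lambda>t. \<Sum>i\<in>UNIV. of_real (xi k $ i) * w i k t) has_vector_derivative
        - of_real ((norm (xi k))\<^sup>2) * (\<Sum>i\<in>UNIV. of_real (xi k $ i) * w i k t)) (at t within {0..T})"
      by simp
  qed (simp add: w)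
  have Ff: "F i k t = (if k = 0 then 0 else cis ((xi k \<bullet> \<omega>) * \<kappa> * t\<^sup>2) * f i k t)" for i k t
    by (simp add: F_def h_def)
  show ?thesis
    by (rule exI[of _ \<kappa>], rule exI[of _ \<omega>], rule exI[of _ w], rule exI[of _ q], rule exI[of _ F])
      (use w q q_cnj F F_cnj Ff eq div in blast)
qed

section \<open>From coefficient equations back to functions\<close>

lemma synth_D_space:
  assumes "sreg a" "z \<in> slab"
  shows "D (ei i) (synth a) z = synth (\<lambda>k t. \<i> * of_real (xi k $ i) * a k t) z"
proof -
  have "D (ei i) (synth a) z = synth (dfam a (ei i)) z"
    by (rule D_eq[OF synth_has_derivative[OF _ assms(2)] assms(2)]) (use assms(1) sreg_def in blast)
  moreover have "dfam a (ei i) = (\<lambda>k t. \<i> * of_real (xi k $ i) * a k t)"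
    by (simp add: fun_eq_iff dfam_def ei_def inner_axis)
  ultimately show ?thesis by simp
qed

lemma synth_D_time:
  assumes "sreg a" "z \<in> slab"
  shows "D (1, 0) (synth a) z = synth (td a) z"
proof -
  have "D (1, 0) (synth a) z = synth (dfam a (1, 0)) z"
    by (rule D_eq[OF synth_has_derivative[OF _ assms(2)] assms(2)]) (use assms(1) sreg_def in blast)
  moreover have "dfam a (1, 0) = td a"
    by (simp add: fun_eq_iff dfam_def)
  ultimately show ?thesis by simp
qed

lemma synth_sum:
  assumes "finite I" "\<And>i. i \<in> I \<Longrightarrow> sreg (a i)" "fst z \<in> {0..T}"
  shows "synth (\<lambda>k t. \<Sum>i\<in>I. a i k t) z = (\<Sum>i\<in>I. synth (a i) z)"
  using assms(1,2)
proof (induction I rule: finite_induct)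
  case empty
  then show ?case by (simp add: synth_def)
next
  case (insert i I)
  then show ?case using synth_add[of "a i" "\<lambda>k t. \<Sum>i\<in>I. a i k t" z] assms(3)
    by (simp add: sreg_rapid sreg_sum)
qed

lemma synth_cong: "(\<And>k. a k (fst z) = b k (fst z)) \<Longrightarrow> synth a z = synth b z"
  by (simp add: synth_def)

lemma mode_period: "mode k (x + L *\<^sub>R (\<chi> i. of_int (n $ i))) = mode k x"
proof -
  have "xi k \<bullet> (L *\<^sub>R (\<chi> i. of_int (n $ i))) = 2 * pi * of_int (\<Sum>i\<in>UNIV. k $ i * n $ i)"
    using L_pos by (simp add: xi_def inner_vec_def sum_3 algebra_simps)
  then have "mode k (x + L *\<^sub>R (\<chi> i. of_int (n $ i))) = mode k x * cis (2 * pi * of_int (\<Sum>i\<in>UNIV. k $ i * n $ i))"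
    by (simp only: mode_def inner_add_right cis_mult)
  also have "cis (2 * pi * of_int (\<Sum>i\<in>UNIV. k $ i * n $ i)) = 1" by (rule cis_multiple_2pi) (rule Ints_of_int)
  finally show ?thesis by simp
qed

lemma synth_period: "synth a (t, x + L *\<^sub>R (\<chi> i. of_int (n $ i))) = synth a (t, x)"
  by (simp add: synth_def mode_period)

lemma smooth_complex_nth: "smooth_on V slab \<Longrightarrow> smooth_on (\<lambda>z. complex_of_real (V z $ j)) slab"
  by (rule smooth_on_bounded_linear[OF thick_slab' bounded_linear_of_real_nth])

lemma SP_complex_nth:
  assumes "smooth_on V slab" "per V"
  shows "SP (\<lambda>z. complex_of_real (V z $ j))"
  using assms smooth_complex_nth by (simp add: SP_def per_def lattice_periodic_def)

lemma synth_flux: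
  assumes "sreg a" "sreg b" "sreg c" "sreg d" "z \<in> slab"
  shows "synth (flux a b c d) z = synth a z * synth d z + synth b z * synth c z + synth b z * synth d z"
proof -
  have t: "fst z \<in> {0..T}" using assms(5) by auto
  note s = sreg_conv[OF assms(1,4)] sreg_conv[OF assms(2,3)] sreg_conv[OF assms(2,4)]
  show ?thesis
    unfolding flux_def[abs_def]
    by (simp only: synth_add[OF sreg_rapid[OF sreg_add[OF s(1,2)]] sreg_rapid[OF s(3)] t]
        synth_add[OF sreg_rapid[OF s(1)] sreg_rapid[OF s(2)] t]
        synth_conv[OF sreg_rapid[OF assms(1)] sreg_rapid[OF assms(4)] t]
        synth_conv[OF sreg_rapid[OF assms(2)] sreg_rapid[OF assms(3)] t]
        synth_conv[OF sreg_rapid[OF assms(2)] sreg_rapid[OF assms(4)] t])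
qed

text \<open>Summing the coefficient equation turns convolutions into products and frequency factors
  into derivatives. The nonlinearity appears as a divergence of products; expanding it by the
  product rule, the two divergence conditions leave the advective form.\<close>

lemma momentum_equation:
  assumes v: "\<And>j. sreg (v j)" and w: "\<And>j. sreg (w j)" and q: "sreg q" and F: "sreg (F i)" and z: "z \<in> slab"
    and Vc: "\<And>j z. z \<in> slab \<Longrightarrow> synth (v j) z = Vc j z" and Vs: "\<And>j. smooth_on (Vc j) slab"
    and divV: "(\<Sum>j\<in>UNIV. D (ei j) (Vc j) z) = 0"
    and divW: "(\<Sum>j\<in>UNIV. D (ei j) (synth (w j)) z) = 0"
    and eq: "\<And>k t. t \<in> {0..T} \<Longrightarrow> td (w i) k t + (\<Sum>j\<in>UNIV. \<i> * of_real (xi k $ j) * flux (v j) (w j) (v i) (w i) k t)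
        + \<i> * of_real (xi k $ i) * q k t = F i k t - of_real ((norm (xi k))\<^sup>2) * w i k t"
  shows "D (1, 0) (synth (w i)) z + (\<Sum>j\<in>UNIV. Vc j z * D (ei j) (synth (w i)) z
      + synth (w j) z * D (ei j) (Vc i) z + synth (w j) z * D (ei j) (synth (w i)) z)
    = (\<Sum>j\<in>UNIV. D (ei j) (D (ei j) (synth (w i))) z) - D (ei i) (synth q) z + synth (F i) z"
proof -
  have t: "fst z \<in> {0..T}" using z by auto
  have ws: "smooth_on (synth (w j)) slab" for j by (rule synth_smooth[OF w])
  have sx: "sreg (\<lambda>k t. \<i> * of_real (xi k $ j) * a k t)" if "sreg a" for j a
    by (rule sreg_mult[OF polyb_ixi that])
  have s1: "sreg (\<lambda>k t. \<Sum>j\<in>UNIV. \<i> * of_real (xi k $ j) * flux (v j) (w j) (v i) (w i) k t)"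
    by (intro sreg_sum sx sreg_flux v w)
  have fl: "synth (\<lambda>k t. \<i> * of_real (xi k $ j) * flux (v j) (w j) (v i) (w i) k t) z
      = Vc j z * D (ei j) (synth (w i)) z + D (ei j) (Vc j) z * synth (w i) z
      + (synth (w j) z * D (ei j) (Vc i) z + D (ei j) (synth (w j)) z * Vc i z)
      + (synth (w j) z * D (ei j) (synth (w i)) z + D (ei j) (synth (w j)) z * synth (w i) z)" for j
  proof -
    \<comment> \<open>Smoothness of products is available for real scalars only, so the first
      complex factor is split into real and imaginary part.\<close>
    have sm: "smooth_on (\<lambda>z. f z * g z) slab" if "smooth_on f slab" "smooth_on g slab"
      for f g :: "real \<times> (real^3) \<Rightarrow> complex"
    proof -
      have f: "smooth_on (\<lambda>z. Re (f z)) slab" "smooth_on (\<lambda>z. Im (f z)) slab"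
        by (rule smooth_on_bounded_linear[OF thick_slab' bounded_linear_Re that(1)]
            smooth_on_bounded_linear[OF thick_slab' bounded_linear_Im that(1)])+
      have "smooth_on (\<lambda>z. Re (f z) *\<^sub>R g z + Im (f z) *\<^sub>R (\<i> * g z)) slab"
        by (intro smooth_on_add smooth_on_scaleR f that thick_slab'
            smooth_on_bounded_linear[OF thick_slab' bounded_linear_mult_right])
      moreover have "Re (f z) *\<^sub>R g z + Im (f z) *\<^sub>R (\<i> * g z) = f z * g z" for z
        by (simp add: complex_eq_iff algebra_simps)
      ultimately show ?thesis by simp
    qed
    have "synth (\<lambda>k t. \<i> * of_real (xi k $ j) * flux (v j) (w j) (v i) (w i) k t) z
        = D (ei j) (synth (flux (v j) (w j) (v i) (w i))) z"
      by (rule synth_D_space[OF sreg_flux[OF v w v w] z, symmetric])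
    also have "\<dots> = D (ei j) (\<lambda>z. Vc j z * synth (w i) z + synth (w j) z * Vc i z + synth (w j) z * synth (w i) z) z"
    proof (rule D_cong[OF _ _ z])
      show "synth (flux (v j) (w j) (v i) (w i)) z = Vc j z * synth (w i) z + synth (w j) z * Vc i z + synth (w j) z * synth (w i) z"
        if "z \<in> slab" for z
        unfolding synth_flux[OF v w v w that] Vc[OF that] ..
    qed (intro smooth_on_add sm Vs ws thick_slab')
    finally show ?thesis
      by (simp only: D_add[OF smooth_on_add[OF thick_slab' sm[OF Vs ws] sm[OF ws Vs]] sm[OF ws ws] z]
          D_add[OF sm[OF Vs ws] sm[OF ws Vs] z] D_mult[OF Vs ws z] D_mult[OF ws Vs z] D_mult[OF ws ws z])
  qed
  have lap: "synth (\<lambda>k t. - of_real ((norm (xi k))\<^sup>2) * w i k t) z = (\<Sum>j\<in>UNIV. D (ei j) (D (ei j) (synth (w i))) z)"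
  proof -
    have "D (ei j) (D (ei j) (synth (w i))) z = synth (\<lambda>k t. \<i> * of_real (xi k $ j) * (\<i> * of_real (xi k $ j) * w i k t)) z" for j
    proof -
      have "D (ei j) (D (ei j) (synth (w i))) z = D (ei j) (synth (\<lambda>k t. \<i> * of_real (xi k $ j) * w i k t)) z"
        by (rule D_cong[OF synth_D_space[OF w] synth_smooth[OF sx[OF w]] z])
      then show ?thesis using synth_D_space[OF sx[OF w] z] by simp
    qed
    then have "(\<Sum>j\<in>UNIV. D (ei j) (D (ei j) (synth (w i))) z)
        = synth (\<lambda>k t. \<Sum>j\<in>UNIV. \<i> * of_real (xi k $ j) * (\<i> * of_real (xi k $ j) * w i k t)) z"
      using synth_sum[of UNIV "\<lambda>j k t. \<i> * of_real (xi k $ j) * (\<i> * of_real (xi k $ j) * w i k t)" z] sx[OF sx[OF w]] t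
      by simp
    also have "\<dots> = synth (\<lambda>k t. - of_real ((norm (xi k))\<^sup>2) * w i k t) z"
    proof (rule synth_cong)
      fix k
      have "(\<Sum>j\<in>UNIV. \<i> * of_real (xi k $ j) * (\<i> * of_real (xi k $ j) * w i k (fst z)))
          = - (\<Sum>j\<in>UNIV. of_real (xi k $ j) * of_real (xi k $ j)) * w i k (fst z)"
        by (simp add: sum_3 algebra_simps)
      then show "(\<Sum>j\<in>UNIV. \<i> * of_real (xi k $ j) * (\<i> * of_real (xi k $ j) * w i k (fst z)))
          = - of_real ((norm (xi k))\<^sup>2) * w i k (fst z)"
        unfolding norm_xi_sum .
    qed
    finally show ?thesis by simp
  qed
  have "synth (\<lambda>k t. td (w i) k t + (\<Sum>j\<in>UNIV. \<i> * of_real (xi k $ j) * flux (v j) (w j) (v i) (w i) k t)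
        + \<i> * of_real (xi k $ i) * q k t) z = synth (\<lambda>k t. F i k t + - of_real ((norm (xi k))\<^sup>2) * w i k t) z"
    by (rule synth_cong) (use eq[OF t] in simp)
  then have "synth (td (w i)) z + (\<Sum>j\<in>UNIV. synth (\<lambda>k t. \<i> * of_real (xi k $ j) * flux (v j) (w j) (v i) (w i) k t) z)
        + synth (\<lambda>k t. \<i> * of_real (xi k $ i) * q k t) z
      = synth (F i) z + synth (\<lambda>k t. - of_real ((norm (xi k))\<^sup>2) * w i k t) z"
    by (simp only: synth_add[OF sreg_rapid[OF sreg_add[OF sreg_td[OF w] s1]] sreg_rapid[OF sx[OF q]] t]
        synth_add[OF sreg_rapid[OF sreg_td[OF w]] sreg_rapid[OF s1] t]
        synth_add[OF sreg_rapid[OF F] sreg_rapid[OF sreg_mult[OF polyb_heat w]] t]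
        synth_sum[OF finite_class.finite_UNIV sx[OF sreg_flux[OF v w v w]] t])
  then have *: "D (1, 0) (synth (w i)) z + (\<Sum>j\<in>UNIV. Vc j z * D (ei j) (synth (w i)) z + D (ei j) (Vc j) z * synth (w i) z
      + (synth (w j) z * D (ei j) (Vc i) z + D (ei j) (synth (w j)) z * Vc i z)
      + (synth (w j) z * D (ei j) (synth (w i)) z + D (ei j) (synth (w j)) z * synth (w i) z))
      + D (ei i) (synth q) z = synth (F i) z + (\<Sum>j\<in>UNIV. D (ei j) (D (ei j) (synth (w i))) z)"
    unfolding fl lap synth_D_time[OF w z, symmetric] synth_D_space[OF q z, symmetric] .
  have "(\<Sum>j\<in>UNIV. Vc j z * D (ei j) (synth (w i)) z + D (ei j) (Vc j) z * synth (w i) z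
      + (synth (w j) z * D (ei j) (Vc i) z + D (ei j) (synth (w j)) z * Vc i z)
      + (synth (w j) z * D (ei j) (synth (w i)) z + D (ei j) (synth (w j)) z * synth (w i) z))
      = (\<Sum>j\<in>UNIV. Vc j z * D (ei j) (synth (w i)) z
      + synth (w j) z * D (ei j) (Vc i) z + synth (w j) z * D (ei j) (synth (w i)) z)
      + (\<Sum>j\<in>UNIV. D (ei j) (Vc j) z) * synth (w i) z
      + (\<Sum>j\<in>UNIV. D (ei j) (synth (w j)) z) * (Vc i z + synth (w i) z)"
    by (simp add: sum.distrib sum_distrib_right sum_distrib_left algebra_simps)
  with * show ?thesis unfolding divV divW by (simp add: algebra_simps)
qed

text \<open>Adding the equation of w to that of V gives the moving-frame system for V + W with
  pressure P + Q. P is passed through as it is, since it need not have a Fourier series.\<close>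

lemma perturbed_flow:
  assumes V: "smooth_on V slab" "div_free V" "per V" and P: "smooth_on P slab" and ns: "ns_eq V P (\<lambda>z. 0)"
    and f: "smooth_on f slab" "per f"
  shows "\<exists>\<kappa> \<omega> U Q F c. smooth_on U slab \<and> div_free U \<and> per U \<and> smooth_on Q slab \<and> ns_eq U Q F \<and>
    smooth_on (\<lambda>z. c (fst z)) slab \<and> (\<forall>z\<in>slab. F (shear \<kappa> \<omega> z) = f z - c (fst z)) \<and>
    (\<forall>x. U (0, x) = V (0, x))"
proof -
  define Vc where "Vc j z = complex_of_real (V z $ j)" for j z
  define fc' where "fc' j z = complex_of_real (f z $ j)" for j z
  have SV: "SP (Vc j)" for j unfolding Vc_def by (rule SP_complex_nth[OF V(1,3)])
  have Sf: "SP (fc' j)" for j unfolding fc'_def by (rule SP_complex_nth[OF f])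
  have Vs: "smooth_on (Vc j) slab" for j using SV SP_def by blast
  define v where "v j = coef (Vc j)" for j
  define fh where "fh j = coef (fc' j)" for j
  have v: "sreg (v j)" "v j (- k) t = cnj (v j k t)" for j k t
    unfolding v_def by (rule coef_sreg[OF SV], rule coef_hermitian) (simp add: Vc_def)
  have fh: "sreg (fh j)" "fh j (- k) t = cnj (fh j k t)" for j k t
    unfolding fh_def by (rule coef_sreg[OF Sf], rule coef_hermitian) (simp add: fc'_def)
  have v_synth: "synth (v j) z = Vc j z" if "z \<in> slab" for j z
    unfolding v_def by (rule fourier_inversion[OF SV that])
  have f_synth: "synth (fh j) z = fc' j z" if "z \<in> slab" for j z
    unfolding fh_def by (rule fourier_inversion[OF Sf that])
  obtain \<kappa> \<omega> w q F where ww: "\<forall>i. sreg (w i)" "\<forall>i k t. w i (- k) t = cnj (w i k t)" "\<forall>i k. w i k 0 = 0"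
      "sreg q" "\<forall>k t. q (- k) t = cnj (q k t)"
      "\<forall>i. sreg (F i)" "\<forall>i k t. F i (- k) t = cnj (F i k t)"
      "\<forall>i k t. F i k t = (if k = 0 then 0 else cis ((xi k \<bullet> \<omega>) * \<kappa> * t\<^sup>2) * fh i k t)"
      "\<forall>i k. \<forall>t\<in>{0..T}. td (w i) k t + (\<Sum>j\<in>UNIV. \<i> * of_real (xi k $ j) * flux (v j) (w j) (v i) (w i) k t)
        + \<i> * of_real (xi k $ i) * q k t = F i k t - of_real ((norm (xi k))\<^sup>2) * w i k t"
      "\<forall>k. \<forall>t\<in>{0..T}. (\<Sum>i\<in>UNIV. of_real (xi k $ i) * w i k t) = 0"
    using forced_coefficients[of v fh, OF v fh] by (elim exE conjE) (rule that)
  have w: "sreg (w i)" for i using ww(1) by blast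
  have Fs: "sreg (F i)" for i using ww(6) by blast
  define W where "W z = (\<chi> i. Re (synth (w i) z))" for z
  define Q where "Q z = Re (synth q z)" for z
  define G where "G z = (\<chi> i. Re (synth (F i) z))" for z
  have real: "synth a z = of_real (Re (synth a z))" if "\<forall>k t. a (- k) t = cnj (a k t)" for a z
    using synth_real[of a z] that by (simp add: complex_is_Real_iff complex_eq_iff)
  have Wc: "synth (w i) = (\<lambda>z. of_real (W z $ i))" for i
    using real[of "w i"] ww(2) by (simp add: W_def fun_eq_iff)
  have Qc: "synth q = (\<lambda>z. of_real (Q z))"
    using real[of q] ww(5) by (simp add: Q_def fun_eq_iff)
  have Gc: "synth (F i) = (\<lambda>z. of_real (G z $ i))" for i
    using real[of "F i"] ww(7) by (simp add: G_def fun_eq_iff)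
  have Ws: "smooth_on W slab"
  proof (rule smooth_on_vec[OF thick_slab'])
    show "smooth_on (\<lambda>z. W z $ i) slab" for i
      using smooth_on_bounded_linear[OF thick_slab' bounded_linear_Re synth_smooth[OF w[of i]]]
      by (simp add: W_def)
  qed
  have Qs: "smooth_on Q slab"
    unfolding Q_def by (rule smooth_on_bounded_linear[OF thick_slab' bounded_linear_Re synth_smooth[OF ww(4)]])
  have DW: "D u (synth (w i)) z = of_real (D u W z $ i)" if "z \<in> slab" for u i z
    unfolding Wc by (rule D_bounded_linear[OF bounded_linear_of_real_nth Ws that])
  have DV: "D u (Vc i) z = of_real (D u V z $ i)" if "z \<in> slab" for u i z
    unfolding Vc_def by (rule D_bounded_linear[OF bounded_linear_of_real_nth V(1) that])
  have DQ: "D u (synth q) z = of_real (D u Q z)" if "z \<in> slab" for u z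
    unfolding Qc by (rule D_bounded_linear[OF bounded_linear_of_real Qs that])
  have DDW: "D u (D u (synth (w i))) z = of_real (D u (D u W) z $ i)" if z: "z \<in> slab" for u i z
  proof -
    have "D u (D u (synth (w i))) z = D u (\<lambda>z. of_real (D u W z $ i)) z"
      by (rule D_cong[OF DW smooth_complex_nth[OF D_smooth[OF Ws]] z])
    then show ?thesis
      by (simp only: D_bounded_linear[OF bounded_linear_of_real_nth D_smooth[OF Ws] z])
  qed
  have divW: "div_free W"
    unfolding div_free_def
  proof
    fix z assume z: "z \<in> slab"
    then have t: "fst z \<in> {0..T}" by auto
    have "complex_of_real (\<Sum>i\<in>UNIV. D (ei i) W z $ i) = (\<Sum>i\<in>UNIV. D (ei i) (synth (w i)) z)"
      by (simp add: DW[OF z])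
    also have "\<dots> = (\<Sum>i\<in>UNIV. synth (\<lambda>k t. \<i> * of_real (xi k $ i) * w i k t) z)"
      by (simp only: synth_D_space[OF w z])
    also have "\<dots> = synth (\<lambda>k t. \<Sum>i\<in>UNIV. \<i> * of_real (xi k $ i) * w i k t) z"
      by (rule synth_sum[symmetric]) (intro finite_class.finite_UNIV sreg_mult polyb_ixi w t)+
    also have "\<dots> = synth (\<lambda>k t. 0) z"
    proof (rule synth_cong)
      fix k
      have "(\<Sum>i\<in>UNIV. \<i> * of_real (xi k $ i) * w i k (fst z)) = \<i> * (\<Sum>i\<in>UNIV. of_real (xi k $ i) * w i k (fst z))"
        by (simp add: sum_distrib_left mult.assoc)
      then show "(\<Sum>i\<in>UNIV. \<i> * of_real (xi k $ i) * w i k (fst z)) = 0" using ww(10) t by simp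
    qed
    also have "\<dots> = 0" by (simp add: synth_def)
    finally show "(\<Sum>i\<in>UNIV. D (ei i) W z $ i) = 0" by (simp only: of_real_eq_0_iff)
  qed
  define U where "U z = V z + W z" for z
  have Us: "smooth_on U slab" unfolding U_def by (rule smooth_on_add[OF thick_slab' V(1) Ws])
  have DU: "D u U z = D u V z + D u W z" if "z \<in> slab" for u z
    unfolding U_def by (rule D_add[OF V(1) Ws that])
  have DDU: "D u (D u U) z = D u (D u V) z + D u (D u W) z" if z: "z \<in> slab" for u z
  proof -
    have "D u (D u U) z = D u (\<lambda>z. D u V z + D u W z) z"
      by (rule D_cong[OF DU smooth_on_add[OF thick_slab' D_smooth[OF V(1)] D_smooth[OF Ws]] z])
    then show ?thesis by (simp only: D_add[OF D_smooth[OF V(1)] D_smooth[OF Ws] z])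
  qed
  define R where "R z = P z + Q z" for z
  have Rs: "smooth_on R slab" unfolding R_def by (rule smooth_on_add[OF thick_slab' P Qs])
  have DR: "D u R z = D u P z + D u Q z" if "z \<in> slab" for u z
    unfolding R_def by (rule D_add[OF P Qs that])
  have "ns_eq U R G"
    unfolding ns_eq_def
  proof
    fix z assume z: "z \<in> slab"
    have eV: "D (1, 0) V z + (\<Sum>i\<in>UNIV. V z $ i *\<^sub>R D (ei i) V z)
        = (\<Sum>i\<in>UNIV. D (ei i) (D (ei i) V) z) - (\<chi> i. D (ei i) P z) + 0"
      by (rule bspec[OF ns[unfolded ns_eq_def] z])
    have eW: "D (1, 0) W z $ i + (\<Sum>j\<in>UNIV. V z $ j * D (ei j) W z $ i + W z $ j * D (ei j) V z $ i + W z $ j * D (ei j) W z $ i)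
        = (\<Sum>j\<in>UNIV. D (ei j) (D (ei j) W) z $ i) - D (ei i) Q z + G z $ i" for i
    proof -
      have dV: "(\<Sum>j\<in>UNIV. D (ei j) (Vc j) z) = 0"
        using bspec[OF V(2)[unfolded div_free_def] z] by (simp only: DV[OF z] of_real_sum[symmetric] of_real_0)
      have dW: "(\<Sum>j\<in>UNIV. D (ei j) (synth (w j)) z) = 0"
        using bspec[OF divW[unfolded div_free_def] z] by (simp only: DW[OF z] of_real_sum[symmetric] of_real_0)
      have "D (1, 0) (synth (w i)) z + (\<Sum>j\<in>UNIV. Vc j z * D (ei j) (synth (w i)) z
          + synth (w j) z * D (ei j) (Vc i) z + synth (w j) z * D (ei j) (synth (w i)) z)
        = (\<Sum>j\<in>UNIV. D (ei j) (D (ei j) (synth (w i))) z) - D (ei i) (synth q) z + synth (F i) z"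
        by (rule momentum_equation[OF v(1) w ww(4) Fs z v_synth Vs dV dW]) (use ww(9) in auto)
      then have "complex_of_real (D (1, 0) W z $ i + (\<Sum>j\<in>UNIV. V z $ j * D (ei j) W z $ i + W z $ j * D (ei j) V z $ i + W z $ j * D (ei j) W z $ i))
        = of_real ((\<Sum>j\<in>UNIV. D (ei j) (D (ei j) W) z $ i) - D (ei i) Q z + G z $ i)"
        unfolding DW[OF z] DDW[OF z] DV[OF z] DQ[OF z] unfolding Wc Gc Vc_def
        by (simp only: of_real_add of_real_diff of_real_mult of_real_sum)
      then show ?thesis by (simp only: of_real_eq_iff)
    qed
    show "D (1, 0) U z + (\<Sum>i\<in>UNIV. U z $ i *\<^sub>R D (ei i) U z)
        = (\<Sum>i\<in>UNIV. D (ei i) (D (ei i) U) z) - (\<chi> i. D (ei i) R z) + G z"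
    proof (rule vec_eq_iff[THEN iffD2], rule allI)
      fix i
      have eVi: "D (1, 0) V z $ i + (\<Sum>j\<in>UNIV. V z $ j * D (ei j) V z $ i)
          = (\<Sum>j\<in>UNIV. D (ei j) (D (ei j) V) z $ i) - D (ei i) P z"
        using arg_cong[OF eV, of "\<lambda>x. x $ i"] by simp
      show "(D (1, 0) U z + (\<Sum>i\<in>UNIV. U z $ i *\<^sub>R D (ei i) U z)) $ i
        = ((\<Sum>i\<in>UNIV. D (ei i) (D (ei i) U) z) - (\<chi> i. D (ei i) R z) + G z) $ i"
        using eVi eW[of i]
        by (simp add: DU[OF z] DDU[OF z] DR[OF z] U_def sum.distrib algebra_simps)
    qed
  qed
  moreover have "div_free U"
    unfolding div_free_def
  proof
    fix z assume z: "z \<in> slab"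
    show "(\<Sum>i\<in>UNIV. D (ei i) U z $ i) = 0"
      using bspec[OF V(2)[unfolded div_free_def] z] bspec[OF divW[unfolded div_free_def] z]
      by (simp add: DU[OF z] sum.distrib)
  qed
  moreover have "per U"
    using V(3) by (simp add: per_def lattice_periodic_def U_def W_def synth_period)
  moreover have "U (0, x) = V (0, x)" for x
    using ww(3) by (simp add: U_def W_def synth_def vec_eq_iff)
  moreover define c where "c t = (\<chi> i. Re (fh i 0 t))" for t
  \<comment> \<open>A family concentrated at k = 0, whose series is the mean of the force as a
    function on the slab; \<open>synth_smooth\<close> then gives the smoothness of c in
    time.\<close>
  define z0 where "z0 i k t = (if k = 0 then 1 else 0) * fh i k t" for i k t
  have z0: "sreg (z0 i)" for i
    unfolding z0_def[abs_def] by (intro sreg_mult fh polyb_bounded[where b = 1]) auto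
  have z0_synth: "synth (z0 i) z = fh i 0 (fst z)" for i z
  proof -
    have "synth (z0 i) z = infsum (\<lambda>k. fh i 0 (fst z)) {0 :: int^3}"
      unfolding synth_def by (rule infsum_cong_neutral) (auto simp: z0_def)
    then show ?thesis by simp
  qed
  have "smooth_on (\<lambda>z. c (fst z)) slab"
  proof (rule smooth_on_vec[OF thick_slab'])
    show "smooth_on (\<lambda>z. c (fst z) $ i) slab" for i
      using smooth_on_bounded_linear[OF thick_slab' bounded_linear_Re synth_smooth[OF z0[of i]]]
      by (simp add: c_def z0_synth)
  qed
  moreover have "G (shear \<kappa> \<omega> z) = f z - c (fst z)" if z: "z \<in> slab" for z
  proof -
    have t: "fst z \<in> {0..T}" using z by auto
    have "synth (F i) (shear \<kappa> \<omega> z) = fc' i z - fh i 0 (fst z)" for i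
    proof -
      have "F i k (fst z) * mode k (snd (shear \<kappa> \<omega> z)) = (fh i k (fst z) + (- 1) * z0 i k (fst z)) * mode k (snd z)" for k
      proof -
        \<comment> \<open>The phase put into F is undone exactly by evaluating the mode at the
          sheared point, so the original force without its mean reappears.\<close>
        have "cis ((xi k \<bullet> \<omega>) * \<kappa> * (fst z)\<^sup>2) * mode k (snd z - (\<kappa> * (fst z)\<^sup>2) *\<^sub>R \<omega>) = mode k (snd z)"
          by (simp add: mode_def cis_mult inner_diff_right mult_ac)
        then show ?thesis using ww(8) by (simp add: z0_def shear_def mult.commute[of _ "fh i k (fst z)"] mult.assoc)
      qed
      then have "synth (F i) (shear \<kappa> \<omega> z) = synth (\<lambda>k t. fh i k t + (- 1) * z0 i k t) z"
        by (simp add: synth_def shear_def)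
      also have "\<dots> = synth (fh i) z + (- 1) * synth (z0 i) z"
        using synth_add[OF sreg_rapid[OF fh(1)] sreg_rapid[OF sreg_mult[OF polyb_const z0]] t]
        by (simp only: synth_cmult)
      finally show ?thesis by (simp add: f_synth[OF z] z0_synth)
    qed
    then show ?thesis by (simp add: G_def c_def vec_eq_iff fc'_def)
  qed
  ultimately show ?thesis using Us Rs by blast
qed

theorem forced_solution:
  assumes "smooth_periodic_solution L v p u0 (\<lambda>t x. 0) T" and data: "smooth_periodic_data L u0 f T"
  shows "\<exists>u p. smooth_periodic_solution L u p u0 f T"
proof -
  have z: "case_prod (\<lambda>t x. 0) = (\<lambda>z. 0 :: real^3)" by auto
  have V: "smooth_on (case_prod v) slab" "div_free (case_prod v)" "per (case_prod v)"
    and P: "smooth_on (case_prod p) slab" and ns: "ns_eq (case_prod v) (case_prod p) (\<lambda>z. 0)"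
    and v0: "\<And>x. v 0 x = u0 x"
    using assms(1) unfolding solution_iff z by blast+
  have f: "smooth_on (case_prod f) slab" "per (case_prod f)"
    using data by (auto simp: smooth_periodic_data_def spacetime_smooth_def per_def)
  obtain \<kappa> \<omega> U Q F c where U: "smooth_on U slab" "div_free U" "per U" "smooth_on Q slab" "ns_eq U Q F"
      "smooth_on (\<lambda>z. c (fst z)) slab"
      "\<forall>z\<in>slab. F (shear \<kappa> \<omega> z) = case_prod f z - c (fst z)" "\<forall>x. U (0, x) = case_prod v (0, x)"
    using perturbed_flow[OF V P ns f] by (elim exE conjE) (rule that)
  obtain u r where u: "smooth_on u slab" "div_free u" "per u" "smooth_on r slab" "ns_eq u r (case_prod f)"
      "\<forall>x. u (0, x) = U (0, x)"
    using accelerated_frame[OF U(1,2,3,4,5,6) bspec[OF U(7)]] by blast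
  have "smooth_periodic_solution L (\<lambda>t x. u (t, x)) (\<lambda>t x. r (t, x)) u0 f T"
    unfolding solution_iff using u data U(8) v0 by simp
  then show ?thesis by blast
qed

end

theorem proposition1p7:
  shows "(\<forall>L u0 f T. smooth_periodic_data L u0 f T \<longrightarrow>
            (\<exists>u p. smooth_periodic_solution L u p u0 f T))
     \<longleftrightarrow>
         (\<forall>L u0 T. smooth_periodic_data L u0 (\<lambda>t x. 0) T \<longrightarrow>
            (\<exists>u p. smooth_periodic_solution L u p u0 (\<lambda>t x. 0) T))"
proof
  assume "\<forall>L u0 f T. smooth_periodic_data L u0 f T \<longrightarrow> (\<exists>u p. smooth_periodic_solution L u p u0 f T)"
  then show "\<forall>L u0 T. smooth_periodic_data L u0 (\<lambda>t x. 0) T \<longrightarrow>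
      (\<exists>u p. smooth_periodic_solution L u p u0 (\<lambda>t x. 0) T)" by blast
next
  assume B: "\<forall>L u0 T. smooth_periodic_data L u0 (\<lambda>t x. 0) T \<longrightarrow>
      (\<exists>u p. smooth_periodic_solution L u p u0 (\<lambda>t x. 0) T)"
  show "\<forall>L u0 f T. smooth_periodic_data L u0 f T \<longrightarrow> (\<exists>u p. smooth_periodic_solution L u p u0 f T)"
  proof (intro allI impI)
    fix L u0 f T assume data: "smooth_periodic_data L u0 f T"
    then interpret torus L T by unfold_locales (auto simp: smooth_periodic_data_def)
    have "smooth_periodic_data L u0 (\<lambda>t x. 0) T"
      using data smooth_on_const[OF thick_slab', of 0]
      by (auto simp: smooth_periodic_data_def spacetime_smooth_def lattice_periodic_def case_prod_unfold)
    then obtain v p where "smooth_periodic_solution L v p u0 (\<lambda>t x. 0) T" using B by blast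
    from forced_solution[OF this data] show "\<exists>u p. smooth_periodic_solution L u p u0 f T" .
  qed
qed

end
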